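(* Let $S$ be a finite set with dihedral structure $\delta$, let $f=\prod_{i=1}^kf_{T_i}:\mathfrak{M}_{0,S}\to\prod_{i=1}^k\mathfrak{M}_{0,T_i}$ be a non-degenerate coordinate system, and let $\delta_i$ be the dihedral structure on $T_i$ induced by $\delta$. For $1\le i\le k$ let $\omega_i$ be an algebraic volume form (regular form of degree $|T_i|-3$) on $\mathfrak{M}_{0,T_i}(\mathbb{R})$ whose integral over $X_{T_i,\delta_i}$ converges absolutely. Then $$\prod_{i=1}^k\int_{X_{T_i,\delta_i}}\omega_i=\sum_{\gamma\in G_f}\int_{X_{S,\gamma}}f^*(\omega_1\otimes\cdots\otimes\omega_k).$$
   Context: For a finite set $S$ with $|S|=n\ge4$, $\mathfrak{M}_{0,S}=\mathrm{PSL}_2\backslash(\mathbb{P}^1)^S_*$ is the moduli space of $n$ distinct points of $\mathbb{P}^1$ labelled by $S$. A dihedral structure on $S$ is an identification of $S$ with the edges of an unoriented $n$-gon modulo dihedral symmetries (so there are $n!/2n$ of them); it induces one on each subset. $\mathfrak{M}_{0,S}(\mathbb{R})$ is the disjoint union, over dihedral structures $\gamma$ on $S$, of the open cells $X_{S,\gamma}$, where $X_{S,\gamma}$ is the set of configurations of points of $\mathbb{P}^1(\mathbb{R})$ lying on the circle $\mathbb{P}^1(\mathbb{R})$ in the dihedral order $\gamma$. For $T\subset S$, $|T|\ge3$, $f_T:\mathfrak{M}_{0,S}\to\mathfrak{M}_{0,T}$ forgets the points not in $T$. A product map is $f_{T_1}\times f_{T_2}:\mathfrak{M}_{0,S}\to\mathfrak{M}_{0,T_1}\times\mathfrak{M}_{0,T_2}$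 with $|T_1|,|T_2|\ge4$, $|T_1\cap T_2|=3$, $S=T_1\cup T_2$; it is an open embedding between spaces of the same dimension. Iterating (decomposing the $T_i$ further in the same way) gives maps $f=\prod_{i=1}^kf_{T_i}:\mathfrak{M}_{0,S}\to\prod_{i=1}^k\mathfrak{M}_{0,T_i}$ with $S=\bigcup T_i$, $|T_i|\ge4$ and $|S|+3(k-1)=\sum_i|T_i|$, which identify $\mathfrak{M}_{0,S}$ with a dense open subscheme of the product; such $f$ is called a non-degenerate coordinate system. $G_f$ is the set of dihedral structures $\gamma$ on $S$ whose restriction to $T_i$ is $\delta_i$ for every $i$. $f^*(\omega_1\otimes\cdots\otimes\omega_k)=f_{T_1}^*\omega_1\wedge\cdots\wedge f_{T_k}^*\omega_k$, and each $X_{S,\gamma}$, $\gamma\in G_f$, is oriented via the embedding $f$ by the product orientation of $\prod_iX_{T_i,\delta_i}$. *)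

theory Defs
  imports "HOL-Analysis.Analysis" "HOL-Combinatorics.Permutations" "HOL-Library.Option_ord"
begin

section \<open>The real points of the moduli space\<close>

text \<open>The real projective line, with \<^term>\<open>None\<close> as the point at infinity. In the linear order of
  \<^theory>\<open>HOL-Library.Option_ord\<close> infinity is the least element: this is the cyclic order of the
  circle, cut open at infinity.\<close>

type_synonym proj1 = "real option"

definition homog :: "proj1 \<Rightarrow> real \<times> real" where
  "homog z = (case z of None \<Rightarrow> (1, 0) | Some x \<Rightarrow> (x, 1))"

definition moebius :: "real \<Rightarrow> real \<Rightarrow> real \<Rightarrow> real \<Rightarrow> proj1 \<Rightarrow> proj1" where
  "moebius a b c d z = (let (x, y) = homog z in
     if c * x + d * y = 0 then None else Some ((a * x + b * y) / (c * x + d * y)))"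

text \<open>A point of the moduli space is an orbit of injective configurations. The real points of the
  algebraic group $\mathrm{PSL}_2 = \mathrm{PGL}_2$ are all invertible real matrices up to scalars,
  so negative determinants are allowed.\<close>

type_synonym 'a mpoint = "('a \<Rightarrow> proj1) set"

definition orbit :: "'a set \<Rightarrow> ('a \<Rightarrow> proj1) \<Rightarrow> 'a mpoint" where
  "orbit S p = {(\<lambda>i\<in>S. moebius a b c d (p i)) | a b c d. a * d - b * c \<noteq> 0}"

definition moduli :: "'a set \<Rightarrow> 'a mpoint set" where
  "moduli S = {orbit S p | p. inj_on p S}"

definition forget :: "'a set \<Rightarrow> 'a mpoint \<Rightarrow> 'a mpoint" where
  "forget T x = (\<lambda>p. restrict p T) ` x"


section \<open>Dihedral structures and cells\<close>

text \<open>A labelling of the edges of an \<open>n\<close>-gon is a list without repetitions; a dihedral structure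
  is the class of such a list under rotations and reflections.\<close>

definition dihedral_class :: "'a list \<Rightarrow> 'a list set" where
  "dihedral_class xs = {rotate m xs | m. True} \<union> {rotate m (rev xs) | m. True}"

definition dihedral_structure :: "'a set \<Rightarrow> 'a list set \<Rightarrow> bool" where
  "dihedral_structure S \<gamma> \<longleftrightarrow> (\<exists>xs. distinct xs \<and> set xs = S \<and> \<gamma> = dihedral_class xs)"

definition restrict_dihedral :: "'a list set \<Rightarrow> 'a set \<Rightarrow> 'a list set" where
  "restrict_dihedral \<gamma> T = filter (\<lambda>i. i \<in> T) ` \<gamma>"

definition cell :: "'a set \<Rightarrow> 'a list set \<Rightarrow> 'a mpoint set" where
  "cell S \<gamma> = {orbit S p | p. inj_on p S \<and> (\<exists>xs\<in>\<gamma>. sorted_wrt (<) (map p xs))}"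


section \<open>Regular functions and differential forms\<close>

definition bracket :: "proj1 \<Rightarrow> proj1 \<Rightarrow> real" where
  "bracket z w = fst (homog z) * snd (homog w) - fst (homog w) * snd (homog z)"

text \<open>The value does not depend on the representative chosen.\<close>

definition cross_ratio :: "'a \<Rightarrow> 'a \<Rightarrow> 'a \<Rightarrow> 'a \<Rightarrow> 'a mpoint \<Rightarrow> real" where
  "cross_ratio i j k l x = (let p = (SOME p. p \<in> x) in
     (bracket (p i) (p k) * bracket (p j) (p l)) / (bracket (p i) (p l) * bracket (p j) (p k)))"

text \<open>The coordinate ring of the affine variety $\mathfrak{M}_{0,S}$ over the reals is generated by
  the cross-ratios. If three points are placed at $0, 1, \infty$ and $t_i$ are the remaining ones,
  this is the ring $\mathbb{R}[t_i, t_i^{-1}, (1-t_i)^{-1}, (t_i-t_j)^{-1}]$. Only the values on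
  \<^term>\<open>moduli S\<close> matter.\<close>

inductive regular_fun :: "'a set \<Rightarrow> ('a mpoint \<Rightarrow> real) \<Rightarrow> bool" for S where
  const: "regular_fun S (\<lambda>_. c)"
| cross_ratio: "{i, j, k, l} \<subseteq> S \<Longrightarrow> distinct [i, j, k, l] \<Longrightarrow> regular_fun S (cross_ratio i j k l)"
| add: "regular_fun S g \<Longrightarrow> regular_fun S h \<Longrightarrow> regular_fun S (\<lambda>x. g x + h x)"
| mult: "regular_fun S g \<Longrightarrow> regular_fun S h \<Longrightarrow> regular_fun S (\<lambda>x. g x * h x)"
| cong: "regular_fun S g \<Longrightarrow> (\<And>x. x \<in> moduli S \<Longrightarrow> h x = g x) \<Longrightarrow> regular_fun S h"

text \<open>Tangent vectors at \<open>x\<close> are the point derivations of the coordinate ring at \<open>x\<close>.\<close>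

type_synonym 'a tangent = "('a mpoint \<Rightarrow> real) \<Rightarrow> real"

definition tangent_vector :: "'a set \<Rightarrow> 'a mpoint \<Rightarrow> 'a tangent \<Rightarrow> bool" where
  "tangent_vector S x D \<longleftrightarrow>
     (\<forall>c. D (\<lambda>_. c) = 0) \<and>
     (\<forall>g h. regular_fun S g \<longrightarrow> regular_fun S h \<longrightarrow>
        ((\<forall>y\<in>moduli S. g y = h y) \<longrightarrow> D g = D h) \<and>
        D (\<lambda>y. g y + h y) = D g + D h \<and>
        D (\<lambda>y. g y * h y) = D g * h x + g x * D h)"

text \<open>A form of degree \<open>d\<close> on $\mathfrak{M}_{0,S}$ takes a point of \<^term>\<open>moduli S\<close> and a list of
  \<open>d\<close> tangent vectors there; its values elsewhere are irrelevant.\<close>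

type_synonym 'a form = "'a mpoint \<Rightarrow> 'a tangent list \<Rightarrow> real"

definition differential :: "('a mpoint \<Rightarrow> real) \<Rightarrow> 'a form" where
  "differential h x vs = hd vs h"

text \<open>The tensor and exterior products of a list of forms paired with their degrees. The exterior
  product is normalised so that $dh_1 \wedge \dots \wedge dh_d$ takes the value
  $\det (v_i(h_j))$ on $(v_1, \dots, v_d)$.\<close>

fun tensor :: "(nat \<times> 'a form) list \<Rightarrow> 'a form" where
  "tensor [] x vs = 1"
| "tensor ((p, \<omega>) # r) x vs = \<omega> x (take p vs) * tensor r x (drop p vs)"

definition wedge :: "(nat \<times> 'a form) list \<Rightarrow> 'a form" where
  "wedge F x vs =
     (\<Sum>\<sigma> | \<sigma> permutes {..<length vs}. of_int (sign \<sigma>) * tensor F x (permute_list \<sigma> vs))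
       / (\<Prod>(p, \<omega>)\<leftarrow>F. fact p)"

definition pullback :: "('a mpoint \<Rightarrow> 'a mpoint) \<Rightarrow> 'a form \<Rightarrow> 'a form" where
  "pullback f \<omega> x vs = \<omega> (f x) (map (\<lambda>D h. D (h \<circ> f)) vs)"

text \<open>The regular forms of degree \<open>d\<close> are the finite sums of $g \, dh_1 \wedge \dots \wedge dh_d$
  with $g$ and all $h_j$ regular.\<close>

definition regular_form :: "'a set \<Rightarrow> nat \<Rightarrow> 'a form \<Rightarrow> bool" where
  "regular_form S d \<omega> \<longleftrightarrow>
     (\<exists>F :: (('a mpoint \<Rightarrow> real) \<times> ('a mpoint \<Rightarrow> real) list) list.
        (\<forall>(g, hs)\<in>set F. regular_fun S g \<and> length hs = d \<and> (\<forall>h\<in>set hs. regular_fun S h)) \<and>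
        (\<forall>x\<in>moduli S. \<forall>vs. length vs = d \<longrightarrow> (\<forall>v\<in>set vs. tangent_vector S x v) \<longrightarrow>
           \<omega> x vs = (\<Sum>(g, hs)\<leftarrow>F. g x * wedge (map (\<lambda>h. (1, differential h)) hs) x vs)))"

definition volume_form :: "'a set \<Rightarrow> 'a form \<Rightarrow> bool" where
  "volume_form S \<omega> \<longleftrightarrow> regular_form S (card S - 3) \<omega>"


section \<open>Orientations and integrals\<close>

text \<open>An orientation of an open set \<open>X\<close> of real points is given by a volume form without zeros
  on \<open>X\<close>; a cell is connected, so both of its orientations arise in this way (from
  $\pm dt_1 \wedge \dots \wedge dt_{n-3}$ in coordinates as below).\<close>

definition orientation_form :: "'a set \<Rightarrow> 'a mpoint set \<Rightarrow> 'a form \<Rightarrow> bool" where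
  "orientation_form S X \<eta> \<longleftrightarrow> volume_form S \<eta> \<and>
     (\<forall>x\<in>X. \<exists>vs. length vs = card S - 3 \<and> (\<forall>v\<in>set vs. tangent_vector S x v) \<and> \<eta> x vs \<noteq> 0)"

text \<open>An enumeration \<open>e\<close> of \<open>S\<close> gives global coordinates: the first three points are moved to
  $0, 1, \infty$ and \<open>t i\<close> is the position of each of the others.\<close>

definition param :: "'a list \<Rightarrow> ('a \<Rightarrow> real) \<Rightarrow> 'a mpoint" where
  "param e t = orbit (set e)
     (\<lambda>i. if i = e ! 0 then Some 0 else if i = e ! 1 then Some 1 else if i = e ! 2 then None
          else Some (t i))"

abbreviation coords :: "'a list \<Rightarrow> 'a list" where
  "coords e \<equiv> drop 3 e"

abbreviation coord_measure :: "'a list \<Rightarrow> ('a \<Rightarrow> real) measure" where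
  "coord_measure e \<equiv> \<Pi>\<^sub>M i\<in>set (coords e). lborel"

definition coord_vector :: "'a list \<Rightarrow> ('a \<Rightarrow> real) \<Rightarrow> 'a \<Rightarrow> 'a tangent" where
  "coord_vector e t i h = deriv (\<lambda>s. h (param e (t(i := s)))) (t i)"

text \<open>The function \<open>g\<close> such that the volume form is $g \, dt_1 \wedge \dots \wedge dt_{n-3}$.\<close>

definition coefficient :: "'a list \<Rightarrow> 'a form \<Rightarrow> ('a \<Rightarrow> real) \<Rightarrow> real" where
  "coefficient e \<omega> t = \<omega> (param e t) (map (coord_vector e t) (coords e))"

definition coord_region :: "'a list \<Rightarrow> 'a mpoint set \<Rightarrow> ('a \<Rightarrow> real) set" where
  "coord_region e X = {t \<in> space (coord_measure e). param e t \<in> X}"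

text \<open>Absolute convergence and the integral do not depend on the enumeration: under a change of
  coordinates the coefficients of \<open>\<omega>\<close> and of the orientation \<open>\<eta>\<close> are both multiplied by the Jacobian
  determinant.\<close>

definition some_enum :: "'a set \<Rightarrow> 'a list" where
  "some_enum S = (SOME e. distinct e \<and> set e = S)"

definition converges_abs :: "'a set \<Rightarrow> 'a mpoint set \<Rightarrow> 'a form \<Rightarrow> bool" where
  "converges_abs S X \<omega> \<longleftrightarrow> (let e = some_enum S in
     set_integrable (coord_measure e) (coord_region e X) (coefficient e \<omega>))"

definition oriented_integral :: "'a set \<Rightarrow> 'a mpoint set \<Rightarrow> 'a form \<Rightarrow> 'a form \<Rightarrow> real" where
  "oriented_integral S X \<eta> \<omega> = (let e = some_enum S in
     set_lebesgue_integral (coord_measure e) (coord_region e X)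
       (\<lambda>t. sgn (coefficient e \<eta> t) * coefficient e \<omega> t))"


section \<open>Non-degenerate coordinate systems\<close>

definition product_map :: "'a set \<Rightarrow> 'a set \<Rightarrow> 'a set \<Rightarrow> bool" where
  "product_map S T1 T2 \<longleftrightarrow>
     card T1 \<ge> 4 \<and> card T2 \<ge> 4 \<and> card (T1 \<inter> T2) = 3 \<and> S = T1 \<union> T2"

text \<open>The list \<open>Ts\<close> encodes the map $\prod_i f_{T_i}$ on $\mathfrak{M}_{0,S}$. The factors obtained by
  iterated decomposition may be listed in any order.\<close>

inductive nondegenerate :: "'a set \<Rightarrow> 'a set list \<Rightarrow> bool" where
  single: "card S \<ge> 4 \<Longrightarrow> nondegenerate S [S]"
| decompose: "product_map S T1 T2 \<Longrightarrow> nondegenerate T1 Ts1 \<Longrightarrow> nondegenerate T2 Ts2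
    \<Longrightarrow> mset Ts = mset Ts1 + mset Ts2 \<Longrightarrow> nondegenerate S Ts"

text \<open>The pullback of $\omega_1 \otimes \dots \otimes \omega_k$ along $\prod_i f_{T_i}$. Applied to
  orientation forms of the factors, it gives the orientation induced by the product orientation.\<close>

definition product_pullback :: "'a set list \<Rightarrow> (nat \<Rightarrow> 'a form) \<Rightarrow> 'a form" where
  "product_pullback Ts \<omega> =
     wedge (map (\<lambda>i. (card (Ts ! i) - 3, pullback (forget (Ts ! i)) (\<omega> i))) [0..<length Ts])"

definition compatible_structures :: "'a set \<Rightarrow> 'a list set \<Rightarrow> 'a set list \<Rightarrow> 'a list set set" where
  "compatible_structures S \<delta> Ts =
     {\<gamma>. dihedral_structure S \<gamma> \<and>
          (\<forall>i<length Ts. restrict_dihedral \<gamma> (Ts ! i) = restrict_dihedral \<delta> (Ts ! i))}"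

end

(* Put three points at 0, 1 and infinity. Then the positions of the others identify a moduli space
   with the complement of a null set in a product of lines, and a product map that shares those three
   points becomes the identity in coordinates. So for k = 2 Fubini's theorem gives the product of the
   integrals, once the integral is known not to depend on the choice of the three points; iterating gives
   the general case. A change of the three points is a composition of transpositions, each of which acts
   by a fractional linear substitution in every coordinate or, when infinity is exchanged with a free
   point, by a triangular map whose fibres are such substitutions; hence one-dimensional
   substitution suffices. On the side of forms, a top form is its coefficient times the determinant of
   the tangent vectors against the coordinate functions, because a derivation of the coordinate ring is
   determined by its values on the coordinates; so the pullback of the tensor product is the product
   of the coefficients times a Jacobian determinant, whose sign is the same for the forms and for the
   orientations. Finally the cells partition the moduli space, and restricting the dihedral order shows
   which of them lie over the given cells of the factors. *)

theory Submission
  imports Defs "Jordan_Normal_Form.Determinant"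
begin

section \<open>Projective configurations and their coordinates\<close>

text \<open>Each integral is read in the coordinates of \<open>some_enum\<close>, an arbitrary
  choice made separately for S and for every factor, so the triples sent to 0, 1, infinity need not
  be related; a product map becomes the identity only in enumerations that begin with the three
  common points. Independence of the enumeration is therefore needed for arbitrary pairs of
  enumerations, and it is stated as a substitution rule for all nonnegative measurable integrands
  (\<open>change_of_enum\<close>), which composes without integrability hypotheses. Absolute
  Jacobians also make it harmless that the factors may be listed in any order. The product formula
  for nonnegative functions, tested on indicators, says that the map to the product of charts
  carries |J| dt to the product measure; this identity of measures is then applied to signed
  integrands. Since regular functions, and hence coefficients, are arbitrary outside
  \<open>moduli S\<close>, measurability and substitution statements are cut down to the set
  \<open>chart e\<close> of admissible coordinates.\<close>

lemma moebius_alt: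
  "moebius a b c d z =
    (if c * fst (homog z) + d * snd (homog z) = 0 then None
     else Some ((a * fst (homog z) + b * snd (homog z)) / (c * fst (homog z) + d * snd (homog z))))"
  by (simp add: moebius_def split_beta Let_def)

lemma homog_simps [simp]: "homog None = (1, 0)" "homog (Some x) = (x, 1)"
  by (simp_all add: homog_def)

text \<open>An invertible matrix does not kill the nonzero vector \<open>homog z\<close>;
  \<open>l\<close> is the factor by which the image vector differs from its normalised
  representative, namely its second entry, or its first entry when the second is 0 and the image is
  \<open>None\<close>.\<close>

lemma homog_moebius:
  assumes "a * d - b * c \<noteq> 0"
  obtains l where "l \<noteq> 0"
    "a * fst (homog z) + b * snd (homog z) = l * fst (homog (moebius a b c d z))"
    "c * fst (homog z) + d * snd (homog z) = l * snd (homog (moebius a b c d z))"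
proof (cases "c * fst (homog z) + d * snd (homog z) = 0")
  case True
  have "a * fst (homog z) + b * snd (homog z) \<noteq> 0"
  proof
    assume "a * fst (homog z) + b * snd (homog z) = 0"
    with True have "(a * d - b * c) * fst (homog z) = 0" "(a * d - b * c) * snd (homog z) = 0"
    proof -
      assume *: "a * fst (homog z) + b * snd (homog z) = 0"
      \<comment> \<open>Multiplying by the adjugate matrix recovers the vector up to the
        determinant.\<close>
      have "(a * d - b * c) * fst (homog z) =
          d * (a * fst (homog z) + b * snd (homog z)) - b * (c * fst (homog z) + d * snd (homog z))"
        "(a * d - b * c) * snd (homog z) =
          a * (c * fst (homog z) + d * snd (homog z)) - c * (a * fst (homog z) + b * snd (homog z))"
        by (simp_all add: algebra_simps)
      with True * show "(a * d - b * c) * fst (homog z) = 0" "(a * d - b * c) * snd (homog z) = 0"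
        by simp_all
    qed
    with assms show False
      by (cases z) auto
  qed
  then show ?thesis
    using that[of "a * fst (homog z) + b * snd (homog z)"] True by (simp add: moebius_alt)
next
  case False
  then show ?thesis
    using that[of "c * fst (homog z) + d * snd (homog z)"] by (simp add: moebius_alt)
qed

text \<open>The matrix product applied to \<open>homog z\<close> is \<open>l\<close> times the outer
  matrix applied to the normalised inner image. Numerator and denominator thus change by the same
  nonzero factor, and the test for infinity is unaffected.\<close>

lemma moebius_compose:
  assumes "a' * d' - b' * c' \<noteq> 0"
  shows "moebius a b c d (moebius a' b' c' d' z) =
    moebius (a * a' + b * c') (a * b' + b * d') (c * a' + d * c') (c * b' + d * d') z"
proof -
  obtain l where l: "l \<noteq> 0"
    "a' * fst (homog z) + b' * snd (homog z) = l * fst (homog (moebius a' b' c' d' z))"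
    "c' * fst (homog z) + d' * snd (homog z) = l * snd (homog (moebius a' b' c' d' z))"
    using homog_moebius[OF assms] by blast
  let ?w = "homog (moebius a' b' c' d' z)"
  have eq: "(r * a' + s * c') * fst (homog z) + (r * b' + s * d') * snd (homog z)
      = l * (r * fst ?w + s * snd ?w)" for r s
  proof -
    have "(r * a' + s * c') * fst (homog z) + (r * b' + s * d') * snd (homog z)
      = r * (a' * fst (homog z) + b' * snd (homog z)) + s * (c' * fst (homog z) + d' * snd (homog z))"
      by (simp add: algebra_simps)
    also have "\<dots> = l * (r * fst ?w + s * snd ?w)"
      unfolding l by (simp add: algebra_simps)
    finally show ?thesis .
  qed
  show ?thesis
    unfolding moebius_alt[of a b c d "moebius a' b' c' d' z"]
      moebius_alt[of "a * a' + b * c'" "a * b' + b * d'" "c * a' + d * c'" "c * b' + d * d'" z] eq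
    using l(1) by simp
qed

lemma moebius_scalar [simp]: "l \<noteq> 0 \<Longrightarrow> moebius l 0 0 l z = z"
  by (cases z) (auto simp: moebius_alt)

lemma moebius_inverse:
  assumes "a * d - b * c \<noteq> 0"
  shows "moebius d (- b) (- c) a (moebius a b c d z) = z"
  using assms by (simp add: moebius_compose algebra_simps)

text \<open>\<open>bracket\<close> is the determinant of two homogeneous vectors, so it is
  multiplied by the determinant of the matrix; \<open>l\<close> undoes the normalisation of each
  image point separately.\<close>

lemma bracket_moebius:
  assumes "a * d - b * c \<noteq> 0"
  obtains l where "\<And>z. l z \<noteq> 0"
    "\<And>z w. (a * d - b * c) * bracket z w =
       l z * l w * bracket (moebius a b c d z) (moebius a b c d w)"
proof -
  have "\<forall>z. \<exists>l. l \<noteq> 0 \<and>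
    a * fst (homog z) + b * snd (homog z) = l * fst (homog (moebius a b c d z)) \<and>
    c * fst (homog z) + d * snd (homog z) = l * snd (homog (moebius a b c d z))"
    using homog_moebius[OF assms] by metis
  then obtain l where l: "\<And>z. l z \<noteq> 0"
    "\<And>z. a * fst (homog z) + b * snd (homog z) = l z * fst (homog (moebius a b c d z))"
    "\<And>z. c * fst (homog z) + d * snd (homog z) = l z * snd (homog (moebius a b c d z))"
    by metis
  have "(a * d - b * c) * bracket z w =
       l z * l w * bracket (moebius a b c d z) (moebius a b c d w)" for z w
  proof -
    have "(a * d - b * c) * bracket z w =
      (a * fst (homog z) + b * snd (homog z)) * (c * fst (homog w) + d * snd (homog w)) -
      (a * fst (homog w) + b * snd (homog w)) * (c * fst (homog z) + d * snd (homog z))"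
      by (simp add: bracket_def algebra_simps)
    also have "\<dots> = l z * l w * bracket (moebius a b c d z) (moebius a b c d w)"
      unfolding l bracket_def by (simp add: algebra_simps)
    finally show ?thesis .
  qed
  with l(1) show ?thesis
    using that by blast
qed

lemma bracket_eq_0_iff: "bracket z w = 0 \<longleftrightarrow> z = w"
  by (cases z; cases w) (auto simp: bracket_def)

lemma bracket_simps [simp]:
  "bracket (Some x) (Some y) = x - y" "bracket None (Some y) = 1" "bracket (Some x) None = - 1"
  "bracket None None = 0"
  by (auto simp: bracket_def)

lemma restrict_in_orbit: "restrict p S \<in> orbit S p"
  unfolding orbit_def
  by (rule CollectI, rule exI[of _ 1], rule exI[of _ 0], rule exI[of _ 0], rule exI[of _ 1])
    (simp add: restrict_def fun_eq_iff)

lemma orbit_cong: "(\<And>i. i \<in> S \<Longrightarrow> p i = q i) \<Longrightarrow> orbit S p = orbit S q"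
proof -
  assume "\<And>i. i \<in> S \<Longrightarrow> p i = q i"
  then have "(\<lambda>i\<in>S. f (p i)) = (\<lambda>i\<in>S. f (q i))" for f :: "proj1 \<Rightarrow> proj1"
    by (auto simp: restrict_def fun_eq_iff)
  then show ?thesis
    unfolding orbit_def by simp
qed

lemma orbit_moebius_subset:
  assumes "a * d - b * c \<noteq> 0"
  shows "orbit S (\<lambda>i. moebius a b c d (p i)) \<subseteq> orbit S p"
proof
  fix q assume "q \<in> orbit S (\<lambda>i. moebius a b c d (p i))"
  then obtain a' b' c' d' where q: "q = (\<lambda>i\<in>S. moebius a' b' c' d' (moebius a b c d (p i)))"
    and det: "a' * d' - b' * c' \<noteq> 0"
    by (auto simp: orbit_def)
  have "(a' * a + b' * c) * (c' * b + d' * d) - (a' * b + b' * d) * (c' * a + d' * c)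
      = (a' * d' - b' * c') * (a * d - b * c)"
    by (simp add: algebra_simps)
  then show "q \<in> orbit S p"
    using det assms unfolding q moebius_compose[OF assms] orbit_def mem_Collect_eq
    by (metis mult_eq_0_iff)
qed

lemma orbit_moebius:
  assumes "a * d - b * c \<noteq> 0"
  shows "orbit S (\<lambda>i. moebius a b c d (p i)) = orbit S p"
proof
  show "orbit S (\<lambda>i. moebius a b c d (p i)) \<subseteq> orbit S p"
    by (rule orbit_moebius_subset[OF assms])
  have "orbit S (\<lambda>i. moebius d (- b) (- c) a (moebius a b c d (p i)))
      \<subseteq> orbit S (\<lambda>i. moebius a b c d (p i))"
    using assms by (intro orbit_moebius_subset) (simp add: algebra_simps)
  then show "orbit S p \<subseteq> orbit S (\<lambda>i. moebius a b c d (p i))"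
    by (simp add: moebius_inverse[OF assms])
qed

lemma orbit_eqD:
  assumes "orbit S p = orbit S q"
  shows "\<exists>a b c d. a * d - b * c \<noteq> 0 \<and> (\<forall>i\<in>S. q i = moebius a b c d (p i))"
proof -
  have "restrict q S \<in> orbit S p"
    using restrict_in_orbit[of q S] assms by simp
  then obtain a b c d where 1: "a * d - b * c \<noteq> 0"
    and 2: "restrict q S = (\<lambda>i\<in>S. moebius a b c d (p i))"
    unfolding orbit_def mem_Collect_eq by (elim exE conjE)
  have "q i = moebius a b c d (p i)" if "i \<in> S" for i
    using fun_cong[OF 2, of i] that by simp
  with 1 show ?thesis
    by (intro exI conjI) auto
qed

lemma orbit_in_moduli_iff: "orbit S p \<in> moduli S \<longleftrightarrow> inj_on p S"
proof
  assume "orbit S p \<in> moduli S"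
  then obtain q where q: "orbit S p = orbit S q" "inj_on q S"
    by (auto simp: moduli_def)
  from orbit_eqD[OF q(1)] obtain a b c d where
    "\<forall>i\<in>S. q i = moebius a b c d (p i)"
    by (elim exE conjE)
  then show "inj_on p S"
    using q(2) by (simp add: inj_on_def)
qed (auto simp: moduli_def)

lemma forget_orbit:
  assumes "T \<subseteq> S"
  shows "forget T (orbit S p) = orbit T p"
proof -
  have eq: "restrict (\<lambda>i\<in>S. f (p i)) T = (\<lambda>i\<in>T. f (p i))" for f :: "proj1 \<Rightarrow> proj1"
    using assms by (auto simp: restrict_def fun_eq_iff)
  have "forget T (orbit S p) =
    {restrict (\<lambda>i\<in>S. moebius a b c d (p i)) T | a b c d. a * d - b * c \<noteq> 0}"
    unfolding forget_def orbit_def by blast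
  then show ?thesis
    unfolding eq orbit_def .
qed

lemma forget_moduli:
  assumes "T \<subseteq> S" "x \<in> moduli S"
  shows "forget T x \<in> moduli T"
proof -
  obtain p where "x = orbit S p" "inj_on p S"
    using assms(2) by (auto simp: moduli_def)
  then show ?thesis
    using assms(1) by (auto simp: forget_orbit orbit_in_moduli_iff intro: inj_on_subset)
qed

text \<open>Each of the four points occurs once above and once below the fraction bar, so the
  factors from \<open>bracket_moebius\<close> cancel and the representative picked by
  \<open>SOME\<close> is irrelevant.\<close>

lemma cross_ratio_orbit:
  assumes "{i, j, k, l} \<subseteq> S"
  shows "cross_ratio i j k l (orbit S p) =
    (bracket (p i) (p k) * bracket (p j) (p l)) / (bracket (p i) (p l) * bracket (p j) (p k))"
proof -
  define q where "q = (SOME q. q \<in> orbit S p)"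
  have "q \<in> orbit S p"
    unfolding q_def by (rule someI[where P = "\<lambda>q. q \<in> orbit S p", OF restrict_in_orbit])
  then obtain a b c d where det: "a * d - b * c \<noteq> 0" and q: "q = (\<lambda>i\<in>S. moebius a b c d (p i))"
    by (auto simp: orbit_def)
  define D where "D = a * d - b * c"
  have qs: "q i = moebius a b c d (p i)" "q j = moebius a b c d (p j)"
    "q k = moebius a b c d (p k)" "q l = moebius a b c d (p l)"
    using assms by (auto simp: q)
  obtain f where f: "\<And>z. f z \<noteq> 0"
    "\<And>z w. D * bracket z w = f z * f w * bracket (moebius a b c d z) (moebius a b c d w)"
    using bracket_moebius[OF det] unfolding D_def by blast
  let ?c = "D * D"
  let ?g = "f (p i) * f (p j) * f (p k) * f (p l)"
  have nz: "?c \<noteq> 0" "?g \<noteq> 0"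
    using det f(1) by (auto simp: D_def)
  have "(bracket (p i) (p k) * bracket (p j) (p l)) / (bracket (p i) (p l) * bracket (p j) (p k)) =
    ((D * bracket (p i) (p k)) * (D * bracket (p j) (p l))) /
    ((D * bracket (p i) (p l)) * (D * bracket (p j) (p k)))"
    using nz by simp
  also have "\<dots> = (?g * (bracket (q i) (q k) * bracket (q j) (q l))) /
      (?g * (bracket (q i) (q l) * bracket (q j) (q k)))"
    unfolding f(2) qs by (simp only: ac_simps)
  also have "\<dots> = (bracket (q i) (q k) * bracket (q j) (q l)) / (bracket (q i) (q l) * bracket (q j) (q k))"
    using nz(2) by (rule mult_divide_mult_cancel_left)
  finally show ?thesis
    by (simp add: cross_ratio_def q_def Let_def)
qed

section \<open>Coordinates from three points at 0, 1 and infinity\<close>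

definition normal_config :: "'a list \<Rightarrow> ('a \<Rightarrow> real) \<Rightarrow> 'a \<Rightarrow> proj1" where
  "normal_config e t i = (if i = e ! 0 then Some 0 else if i = e ! 1 then Some 1
     else if i = e ! 2 then None else Some (t i))"

lemma param_normal_config: "param e t = orbit (set e) (normal_config e t)"
  by (simp add: param_def normal_config_def[abs_def])

definition enum_of :: "'a set \<Rightarrow> 'a list \<Rightarrow> bool" where
  "enum_of S e \<longleftrightarrow> distinct e \<and> set e = S \<and> 3 \<le> length e"

text \<open>The arguments are ordered so that with \<open>e ! 0\<close>, \<open>e ! 1\<close>,
  \<open>e ! 2\<close> at 0, 1, infinity the cross-ratio is the position of \<open>i\<close>
  itself.\<close>

definition tcoord :: "'a list \<Rightarrow> 'a \<Rightarrow> 'a mpoint \<Rightarrow> real" where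
  "tcoord e i = cross_ratio i (e ! 1) (e ! 0) (e ! 2)"

text \<open>Restricting to the free points makes the result a point of
  \<open>space (coord_measure e)\<close>, whose elements are extensional functions.\<close>

definition tmap :: "'a list \<Rightarrow> 'a mpoint \<Rightarrow> 'a \<Rightarrow> real" where
  "tmap e x = (\<lambda>i\<in>set (coords e). tcoord e i x)"

lemma enum_ofE:
  assumes "enum_of S e"
  obtains a b c r where "e = [a, b, c] @ r" "distinct ([a, b, c] @ r)" "S = {a, b, c} \<union> set r"
    "coords e = r" "e ! 0 = a" "e ! 1 = b" "e ! 2 = c"
proof -
  from assms obtain a b c r where "e = [a, b, c] @ r"
    by (cases e; cases "tl e"; cases "tl (tl e)") (auto simp: enum_of_def)
  then show ?thesis
    using that[of a b c r] assms by (auto simp: enum_of_def numeral_2_eq_2)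
qed

lemma enum_ofD:
  assumes "enum_of S e"
  shows "distinct ([e ! 0, e ! 1, e ! 2] @ coords e)" "S = {e ! 0, e ! 1, e ! 2} \<union> set (coords e)"
  using enum_ofE[OF assms] by metis+

lemma param_tmap:
  assumes "enum_of S e" "x \<in> moduli S"
  shows "param e (tmap e x) = x"
proof -
  obtain a b c r where e: "e = [a, b, c] @ r" "distinct ([a, b, c] @ r)" "S = {a, b, c} \<union> set r"
    "coords e = r" "e ! 0 = a" "e ! 1 = b" "e ! 2 = c"
    using enum_ofE[OF assms(1)] by blast
  obtain p where x: "x = orbit S p" and inj: "inj_on p S"
    using assms(2) by (auto simp: moduli_def)
  have S: "set e = S"
    using assms(1) by (simp add: enum_of_def)
  have ne: "bracket (p i) (p j) \<noteq> 0" if "i \<in> S" "j \<in> S" "i \<noteq> j" for i j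
    using inj that by (auto simp: bracket_eq_0_iff inj_on_def)
  \<comment> \<open>With these factors the map \<open>z\<close> to
    \<open>bracket z (p a) * k / (bracket z (p c) * m)\<close> vanishes at \<open>p a\<close>, has
    its pole at \<open>p c\<close> and takes the value 1 at \<open>p b\<close>; the matrix below
    lists its coefficients.\<close>
  define k where "k = bracket (p b) (p c)"
  define m where "m = bracket (p b) (p a)"
  let ?a = "snd (homog (p a)) * k" and ?b = "- fst (homog (p a)) * k"
    and ?c = "snd (homog (p c)) * m" and ?d = "- fst (homog (p c)) * m"
  have km: "k \<noteq> 0" "m \<noteq> 0"
    using e ne[of b c] ne[of b a] by (auto simp: k_def m_def)
  have det: "?a * ?d - ?b * ?c = k * m * bracket (p a) (p c)"
    by (simp add: bracket_def algebra_simps)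
  also have "\<dots> \<noteq> 0"
    using km e ne[of a c] by auto
  finally have det: "?a * ?d - ?b * ?c \<noteq> 0" .
  have moeb: "moebius ?a ?b ?c ?d z = (if bracket z (p c) = 0 then None
     else Some ((bracket z (p a) * k) / (bracket z (p c) * m)))" for z
  proof -
    have "?a * fst (homog z) + ?b * snd (homog z) = bracket z (p a) * k"
      "?c * fst (homog z) + ?d * snd (homog z) = bracket z (p c) * m"
      by (simp_all add: bracket_def algebra_simps)
    then show ?thesis
      using km unfolding moebius_alt by simp
  qed
  have "moebius ?a ?b ?c ?d (p i) = normal_config e (tmap e x) i" if "i \<in> S" for i
  proof -
    consider "i = a" | "i = b" | "i = c" | "i \<in> set r" "i \<notin> {a, b, c}"
      using \<open>i \<in> S\<close> e by auto
    then show ?thesis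
    proof cases
      case 1
      then show ?thesis
        using e(2,3,5) ne[of a c] unfolding moeb by (simp add: normal_config_def bracket_eq_0_iff[of "p a" "p a"])
    next
      case 2
      then show ?thesis
        using e(2,3,5,6) ne[of b c] km unfolding moeb by (auto simp: normal_config_def k_def m_def)
    next
      case 3
      then show ?thesis
        using e(2,5-7) unfolding moeb by (auto simp: normal_config_def bracket_eq_0_iff)
    next
      case 4
      have "{i, b, a, c} \<subseteq> S"
        using that e by auto
      then show ?thesis
        using 4 e(1,4-7) ne[of i c] that
        unfolding moeb by (simp add: normal_config_def tmap_def tcoord_def x cross_ratio_orbit k_def m_def)
    qed
  qed
  then have "orbit S (normal_config e (tmap e x)) = orbit S (\<lambda>i. moebius ?a ?b ?c ?d (p i))"
    by (intro orbit_cong) auto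
  also have "\<dots> = x"
    unfolding x by (rule orbit_moebius[OF det])
  finally show ?thesis
    by (simp add: param_normal_config S)
qed

lemma tcoord_param:
  assumes "enum_of S e" "i \<in> set (coords e)"
  shows "tcoord e i (param e t) = t i"
proof -
  have "{i, e ! 1, e ! 0, e ! 2} \<subseteq> set e"
    using enum_ofD[OF assms(1)] assms by (auto simp: enum_of_def)
  then show ?thesis
    using enum_ofD(1)[OF assms(1)] assms(2)
    by (auto simp: tcoord_def param_normal_config cross_ratio_orbit normal_config_def)
qed

lemma tmap_param:
  assumes "enum_of S e" "t \<in> extensional (set (coords e))"
  shows "tmap e (param e t) = t"
  using assms by (auto simp: tmap_def tcoord_param fun_eq_iff extensional_def)

lemma param_in_moduli_iff:
  assumes "enum_of S e"
  shows "param e t \<in> moduli S \<longleftrightarrow>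
    (\<forall>i\<in>set (coords e). t i \<noteq> 0 \<and> t i \<noteq> 1) \<and> inj_on t (set (coords e))"
proof -
  obtain a b c r where e: "e = [a, b, c] @ r" "distinct ([a, b, c] @ r)" "S = {a, b, c} \<union> set r"
    "coords e = r" "e ! 0 = a" "e ! 1 = b" "e ! 2 = c"
    using enum_ofE[OF assms(1)] by blast
  have S: "set e = S"
    using assms(1) by (simp add: enum_of_def)
  have nc: "normal_config e t i = Some (t i)" if "i \<in> set r" for i
    using e(2,5-7) that by (auto simp: normal_config_def)
  have nc': "normal_config e t a = Some 0" "normal_config e t b = Some 1" "normal_config e t c = None"
    using e(2,5-7) by (auto simp: normal_config_def)
  have img: "normal_config e t ` set r = Some ` t ` set r"
    by (auto simp: nc image_iff)
  have 1: "inj_on (normal_config e t) (set r) \<longleftrightarrow> inj_on t (set r)"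
    by (simp add: inj_on_def nc)
  have 2: "inj_on (normal_config e t) {a, b, c}"
    by (simp add: inj_on_def nc')
  have 3: "normal_config e t ` {a, b, c} = {Some 0, Some 1, None}"
    by (simp add: nc')
  have 4: "{a, b, c} - set r = {a, b, c}" "set r - {a, b, c} = set r"
    using e by auto
  show ?thesis
    unfolding param_normal_config S orbit_in_moduli_iff e(3) inj_on_Un 4 1 3 img e(4)
    using 2 by (auto simp: image_iff)
qed

section \<open>Tangent vectors and determinants\<close>

lemma regular_fun_diff:
  assumes "regular_fun S g" "regular_fun S h"
  shows "regular_fun S (\<lambda>x. g x - h x)"
proof -
  have "regular_fun S (\<lambda>x. g x + (\<lambda>_. -1) x * h x)"
    by (intro regular_fun.add regular_fun.mult regular_fun.const assms)
  then show ?thesis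
    by simp
qed

text \<open>A cross-ratio of points in T does not see the forgotten points. The equality is
  available on \<open>moduli S\<close>, where every element is an orbit, so it is used through
  \<open>regular_fun.cong\<close>.\<close>

lemma regular_fun_forget:
  assumes "regular_fun T h" "T \<subseteq> S"
  shows "regular_fun S (h \<circ> forget T)"
  using assms(1)
proof induction
  case (cross_ratio i j k l)
  have "cross_ratio i j k l (forget T x) = cross_ratio i j k l x" if x: "x \<in> moduli S" for x
  proof -
    obtain p where p: "x = orbit S p"
      using x by (auto simp: moduli_def)
    show ?thesis
      unfolding p forget_orbit[OF assms(2)]
      by (simp only: cross_ratio_orbit[OF cross_ratio(1)]
          cross_ratio_orbit[OF order_trans[OF cross_ratio(1) assms(2)]])
  qed
  moreover have "regular_fun S (cross_ratio i j k l)"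
    using cross_ratio assms(2) by (intro regular_fun.cross_ratio) auto
  ultimately show ?case
    by (rule_tac regular_fun.cong) auto
next
  case (cong g h)
  show ?case
    by (rule regular_fun.cong[OF cong.IH]) (simp add: forget_moduli[OF assms(2)] cong.hyps)
qed (auto simp: o_def intro: regular_fun.const regular_fun.add regular_fun.mult)

lemma regular_fun_tcoord:
  assumes "enum_of S e" "i \<in> set (coords e)"
  shows "regular_fun S (tcoord e i)"
  using enum_ofD[OF assms(1)] assms(2) unfolding tcoord_def[abs_def]
  by (intro regular_fun.cross_ratio) auto

text \<open>The admissible values of one coordinate form the complement of the finite set
  \<open>B\<close>, which is open. Hence partial derivatives at a point of the moduli space depend
  only on values on the moduli space.\<close>

lemma eventually_param_in_moduli:
  assumes "enum_of S e" "i \<in> set (coords e)" "param e t \<in> moduli S"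
  shows "\<forall>\<^sub>F s in nhds (t i). param e (t(i := s)) \<in> moduli S"
proof -
  define B where "B = {0, 1} \<union> t ` (set (coords e) - {i})"
  have inj: "inj_on t (set (coords e))" and ne: "\<forall>j\<in>set (coords e). t j \<noteq> 0 \<and> t j \<noteq> 1"
    using assms by (auto simp: param_in_moduli_iff)
  have "t i \<notin> B"
    using inj ne assms(2) by (auto simp: B_def inj_on_def)
  moreover have "open (- B)"
    by (intro open_Compl finite_imp_closed) (auto simp: B_def)
  ultimately have "\<forall>\<^sub>F s in nhds (t i). s \<in> - B"
    by (intro eventually_nhds_in_open) auto
  then show ?thesis
  proof eventually_elim
    case (elim s)
    have "inj_on (t(i := s)) (set (coords e))"
      using inj elim by (auto simp: inj_on_def B_def)
    then show ?case
      using elim ne assms by (auto simp: param_in_moduli_iff B_def)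
  qed
qed

lemma bracket_normal_config_differentiable:
  "(\<lambda>s. bracket (normal_config e (t(i := s)) j) (normal_config e (t(i := s)) k)) differentiable (at x)"
proof -
  have 1: "(\<lambda>s. fst (homog (normal_config e (t(i := s)) j))) differentiable (at x)" for j
    by (cases "j = e ! 0"; cases "j = e ! 1"; cases "j = e ! 2"; cases "j = i")
      (simp_all add: normal_config_def)
  have 2: "(\<lambda>s. snd (homog (normal_config e (t(i := s)) j))) = (\<lambda>s. snd (homog (normal_config e t j)))" for j
    by (auto simp: normal_config_def)
  then have 2: "(\<lambda>s. snd (homog (normal_config e (t(i := s)) j))) differentiable (at x)" for j
    by simp
  show ?thesis
    unfolding bracket_def by (intro differentiable_diff differentiable_mult 1 2)
qed

lemma regular_fun_differentiable:
  assumes "regular_fun S h" "enum_of S e" "i \<in> set (coords e)" "param e t \<in> moduli S"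
  shows "(\<lambda>s. h (param e (t(i := s)))) differentiable (at (t i))"
  using assms(1)
proof induction
  case (cross_ratio j k l m)
  have S: "set e = S"
    using assms(2) by (simp add: enum_of_def)
  have "inj_on (normal_config e t) S"
    using assms(4) by (simp add: param_normal_config S orbit_in_moduli_iff)
  then have "bracket (normal_config e t j) (normal_config e t m) \<noteq> 0"
    "bracket (normal_config e t k) (normal_config e t l) \<noteq> 0"
    using cross_ratio by (auto simp: bracket_eq_0_iff inj_on_def)
  then show ?case
    unfolding param_normal_config S cross_ratio_orbit[OF cross_ratio(1)]
    by (intro differentiable_divide differentiable_mult bracket_normal_config_differentiable) simp
next
  case (add g h)
  then show ?case
    by (intro differentiable_add)
next
  case (mult g h)
  then show ?case
    by (intro differentiable_mult)
next
  case (cong g h)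
  have "\<forall>\<^sub>F s in nhds (t i). h (param e (t(i := s))) = g (param e (t(i := s)))"
    using eventually_param_in_moduli[OF assms(2-4)] by (rule eventually_mono) (rule cong.hyps(2))
  then show ?case
    using cong.IH real_differentiable_def DERIV_cong_ev[OF refl _ refl] by metis
qed auto

lemma coord_vector_deriv:
  assumes "regular_fun S h" "enum_of S e" "i \<in> set (coords e)" "param e t \<in> moduli S"
  shows "((\<lambda>s. h (param e (t(i := s)))) has_real_derivative coord_vector e t i h) (at (t i))"
  using regular_fun_differentiable[OF assms]
  by (simp add: coord_vector_def DERIV_deriv_iff_real_differentiable)

lemma coord_vector_eqI:
  assumes "((\<lambda>s. h (param e (t(i := s)))) has_real_derivative d) (at (t i))"
  shows "coord_vector e t i h = d"
  using assms by (simp add: coord_vector_def DERIV_imp_deriv)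

section \<open>Point derivations and the basis of partial derivatives\<close>

lemma tangent_vector_const: "tangent_vector S x v \<Longrightarrow> v (\<lambda>_. c) = 0"
  unfolding tangent_vector_def by blast

lemma tangent_vector_mult:
  "tangent_vector S x v \<Longrightarrow> regular_fun S g \<Longrightarrow> regular_fun S h \<Longrightarrow>
    v (\<lambda>y. g y * h y) = v g * h x + g x * v h"
  unfolding tangent_vector_def by blast

lemma tangent_vector_add:
  "tangent_vector S x v \<Longrightarrow> regular_fun S g \<Longrightarrow> regular_fun S h \<Longrightarrow> v (\<lambda>y. g y + h y) = v g + v h"
  unfolding tangent_vector_def by blast

lemma tangent_vector_cong:
  "tangent_vector S x v \<Longrightarrow> regular_fun S g \<Longrightarrow> regular_fun S h \<Longrightarrow>
    (\<And>y. y \<in> moduli S \<Longrightarrow> g y = h y) \<Longrightarrow> v g = v h"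
  unfolding tangent_vector_def by blast

lemma tangent_coord_vector:
  assumes "enum_of S e" "i \<in> set (coords e)" "param e t \<in> moduli S"
  shows "tangent_vector S (param e t) (coord_vector e t i)"
  unfolding tangent_vector_def
proof (intro conjI allI impI)
  show "coord_vector e t i (\<lambda>_. c) = 0" for c
    by (simp add: coord_vector_def)
next
  fix g h :: "'a mpoint \<Rightarrow> real"
  assume g: "regular_fun S g" and h: "regular_fun S h"
  note d = coord_vector_deriv[OF g assms] coord_vector_deriv[OF h assms]
  show "coord_vector e t i (\<lambda>y. g y + h y) = coord_vector e t i g + coord_vector e t i h"
    by (intro coord_vector_eqI DERIV_add d)
  show "coord_vector e t i (\<lambda>y. g y * h y) =
      coord_vector e t i g * h (param e t) + g (param e t) * coord_vector e t i h"
    by (rule coord_vector_eqI) (use DERIV_mult[OF d] in \<open>simp add: algebra_simps\<close>)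
  assume eq: "\<forall>y\<in>moduli S. g y = h y"
  have "\<forall>\<^sub>F s in nhds (t i). g (param e (t(i := s))) = h (param e (t(i := s)))"
    using eventually_param_in_moduli[OF assms] by (rule eventually_mono) (use eq in blast)
  then show "coord_vector e t i g = coord_vector e t i h"
    unfolding coord_vector_def by (intro deriv_cong_ev refl)
qed

text \<open>This is the differential of the forgetful map; \<open>pullback\<close> feeds these
  derivations to the form on the target.\<close>

lemma tangent_vector_forget:
  assumes "T \<subseteq> S" "tangent_vector S x v"
  shows "tangent_vector T (forget T x) (\<lambda>h. v (h \<circ> forget T))"
  unfolding tangent_vector_def
proof (intro conjI allI impI)
  show "v ((\<lambda>_. c) \<circ> forget T) = 0" for c
    using tangent_vector_const[OF assms(2)] by (simp add: o_def)
next
  fix g h :: "'a mpoint \<Rightarrow> real"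
  assume "regular_fun T g" "regular_fun T h"
  then have reg: "regular_fun S (g \<circ> forget T)" "regular_fun S (h \<circ> forget T)"
    using assms(1) by (auto intro: regular_fun_forget)
  show "v ((\<lambda>y. g y + h y) \<circ> forget T) = v (g \<circ> forget T) + v (h \<circ> forget T)"
    using tangent_vector_add[OF assms(2) reg] by (simp add: o_def)
  show "v ((\<lambda>y. g y * h y) \<circ> forget T) =
      v (g \<circ> forget T) * h (forget T x) + g (forget T x) * v (h \<circ> forget T)"
    using tangent_vector_mult[OF assms(2) reg] by (simp add: o_def)
  assume "\<forall>y\<in>moduli T. g y = h y"
  then show "v (g \<circ> forget T) = v (h \<circ> forget T)"
    by (intro tangent_vector_cong[OF assms(2) reg]) (simp add: forget_moduli[OF assms(1)])
qed

lemma tangent_vector_sum: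
  assumes w: "\<And>b. b \<in> A \<Longrightarrow> tangent_vector S x (w b)"
  shows "tangent_vector S x (\<lambda>h. \<Sum>b\<in>A. c b * w b h)"
  unfolding tangent_vector_def
proof (intro conjI allI impI)
  show "(\<Sum>b\<in>A. c b * w b (\<lambda>_. k)) = 0" for k
    by (simp add: tangent_vector_const[OF w])
next
  fix g h
  assume r: "regular_fun S g" "regular_fun S h"
  show "(\<Sum>b\<in>A. c b * w b (\<lambda>y. g y + h y)) = (\<Sum>b\<in>A. c b * w b g) + (\<Sum>b\<in>A. c b * w b h)"
    by (simp add: tangent_vector_add[OF w r] distrib_left sum.distrib)
  show "(\<Sum>b\<in>A. c b * w b (\<lambda>y. g y * h y)) =
      (\<Sum>b\<in>A. c b * w b g) * h x + g x * (\<Sum>b\<in>A. c b * w b h)"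
    by (simp add: tangent_vector_mult[OF w r] distrib_left sum.distrib sum_distrib_left
        sum_distrib_right mult.assoc mult.left_commute)
  assume "\<forall>y\<in>moduli S. g y = h y"
  then show "(\<Sum>b\<in>A. c b * w b g) = (\<Sum>b\<in>A. c b * w b h)"
    using tangent_vector_cong[OF w r] by (intro sum.cong refl) simp
qed

lemma tangent_vector_diff:
  assumes "tangent_vector S x v" "regular_fun S g" "regular_fun S h"
  shows "v (\<lambda>y. g y - h y) = v g - v h"
proof -
  have m: "regular_fun S (\<lambda>y. (\<lambda>_. - 1) y * h y)"
    by (intro regular_fun.mult regular_fun.const assms)
  have "v (\<lambda>y. (\<lambda>_. - 1) y * h y) = v (\<lambda>_. - 1) * h x + - 1 * v h"
    by (rule tangent_vector_mult[OF assms(1) regular_fun.const assms(3)])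
  also have "v (\<lambda>_. - 1) = 0"
    using assms(1) by (rule tangent_vector_const)
  finally show ?thesis
    using tangent_vector_add[OF assms(1,2) m] by simp
qed

text \<open>The cross-ratios are quotients of brackets of the normalised configuration, so a derivation is
  determined by its values on the coordinates.\<close>

lemma tangent_vector_eqI:
  assumes e: "enum_of S e" and x: "x \<in> moduli S"
    and v: "tangent_vector S x v" and w: "tangent_vector S x w"
    and eq: "\<And>i. i \<in> set (coords e) \<Longrightarrow> v (tcoord e i) = w (tcoord e i)"
    and h: "regular_fun S h"
  shows "v h = w h"
  using h
proof induction
  case (const c)
  show ?case
    by (simp add: tangent_vector_const[OF v] tangent_vector_const[OF w])
next
  case (add g h)
  then show ?case
    by (simp add: tangent_vector_add[OF v] tangent_vector_add[OF w])
next
  case (mult g h)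
  then show ?case
    by (simp add: tangent_vector_mult[OF v] tangent_vector_mult[OF w])
next
  case (cong g h)
  have "regular_fun S h"
    using cong by (rule_tac regular_fun.cong)
  then have "v h = v g" "w h = w g"
    using tangent_vector_cong[OF v, of h g] tangent_vector_cong[OF w, of h g] cong by simp_all
  then show ?case
    using cong.IH by simp
next
  case (cross_ratio i j k l)
  have S: "set e = S"
    using e by (simp add: enum_of_def)
  \<comment> \<open>\<open>P\<close> joins regularity to agreement of \<open>v\<close> and
    \<open>w\<close> because the product and difference rules are available for regular functions
    only.\<close>
  define P where "P g \<longleftrightarrow> regular_fun S g \<and> v g = w g" for g
  have P_const: "P (\<lambda>_. c)" for c
    by (simp add: P_def regular_fun.const tangent_vector_const[OF v] tangent_vector_const[OF w])
  have P_tc: "P (\<lambda>y. tmap e y i)" if "i \<in> set (coords e)" for i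
    using regular_fun_tcoord[OF e that] eq[OF that] that by (simp add: P_def tmap_def)
  have P_diff: "P (\<lambda>x. g x - h x)" if "P g" "P h" for g h
    using that tangent_vector_diff[OF v] tangent_vector_diff[OF w]
    by (simp add: P_def regular_fun_diff)
  have P_mult: "P (\<lambda>x. g x * h x)" if "P g" "P h" for g h
    using that tangent_vector_mult[OF v] tangent_vector_mult[OF w]
    by (simp add: P_def regular_fun.mult)
  have P_fst: "P (\<lambda>y. fst (homog (normal_config e (tmap e y) i)))" if "i \<in> S" for i
    using that enum_ofD(2)[OF e] P_const P_tc[of i]
    by (cases "i = e ! 0"; cases "i = e ! 1"; cases "i = e ! 2") (auto simp: normal_config_def)
  have "snd (homog (normal_config e t i)) = (if i = e ! 0 \<or> i = e ! 1 \<or> i \<noteq> e ! 2 then 1 else 0)" for t i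
    by (simp add: normal_config_def)
  then have P_snd: "P (\<lambda>y. snd (homog (normal_config e (tmap e y) i)))" for i
    using P_const by simp
  let ?B = "\<lambda>i j y. bracket (normal_config e (tmap e y) i) (normal_config e (tmap e y) j)"
  have P_B: "P (?B i j)" if "i \<in> S" "j \<in> S" for i j
    unfolding bracket_def using that by (intro P_diff P_mult P_fst P_snd)
  let ?num = "\<lambda>y. ?B i k y * ?B j l y" and ?den = "\<lambda>y. ?B i l y * ?B j k y"
  have P_num: "P ?num" and P_den: "P ?den"
    using cross_ratio by (auto intro!: P_mult P_B)
  have inj: "inj_on (normal_config e (tmap e y)) S" if "y \<in> moduli S" for y
    using param_tmap[OF e that] that orbit_in_moduli_iff by (metis S param_normal_config)
  have den: "?den y \<noteq> 0" if "y \<in> moduli S" for y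
    using inj[OF that] cross_ratio by (auto simp: bracket_eq_0_iff inj_on_def)
  \<comment> \<open>Derivations come with a product rule but no quotient rule: the quotient is
    multiplied out, differentiated as a product, and the nonzero value of the denominator at
    \<open>x\<close> is cancelled.\<close>
  have "cross_ratio i j k l y * ?den y = ?num y" if "y \<in> moduli S" for y
  proof -
    have "cross_ratio i j k l y = cross_ratio i j k l (orbit S (normal_config e (tmap e y)))"
      using param_tmap[OF e that] by (simp add: param_normal_config S)
    also have "\<dots> = ?num y / ?den y"
      by (rule cross_ratio_orbit[OF cross_ratio(1)])
    finally show ?thesis
      using den[OF that] by simp
  qed
  then have "u (cross_ratio i j k l) * ?den x + cross_ratio i j k l x * u ?den = u ?num"
    if u: "tangent_vector S x u" for u
    using tangent_vector_cong[OF u, of "\<lambda>y. cross_ratio i j k l y * ?den y" ?num]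
      tangent_vector_mult[OF u, of "cross_ratio i j k l" ?den] P_num P_den
      regular_fun.cross_ratio[OF cross_ratio] regular_fun.mult[of S "cross_ratio i j k l" ?den]
    by (simp add: P_def)
  moreover have "v ?num = w ?num" "v ?den = w ?den"
    using P_num P_den unfolding P_def by blast+
  ultimately have "v (cross_ratio i j k l) * ?den x = w (cross_ratio i j k l) * ?den x"
    using v w by (metis (no_types, lifting) add_right_cancel)
  then show ?case
    using den[OF x] by simp
qed

lemma coord_vector_tcoord:
  assumes "enum_of S e" "i \<in> set (coords e)" "j \<in> set (coords e)"
  shows "coord_vector e t i (tcoord e j) = (if i = j then 1 else 0)"
  using assms by (intro coord_vector_eqI) (simp add: tcoord_param)

text \<open>The coordinate vectors are dual to the functions \<open>tcoord e k\<close>, so both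
  sides are derivations with the same values on the coordinates.\<close>

lemma tangent_vector_expansion:
  assumes "enum_of S e" "param e t \<in> moduli S" "tangent_vector S (param e t) v" "regular_fun S h"
  shows "v h = (\<Sum>k\<in>set (coords e). v (tcoord e k) * coord_vector e t k h)"
proof (rule tangent_vector_eqI[OF assms(1,2,3) _ _ assms(4)])
  show "tangent_vector S (param e t) (\<lambda>h. \<Sum>k\<in>set (coords e). v (tcoord e k) * coord_vector e t k h)"
    using assms by (intro tangent_vector_sum tangent_coord_vector) auto
qed (use assms(1) in \<open>simp add: coord_vector_tcoord if_distrib cong: if_cong\<close>)

text \<open>The value of dh_1 wedge ... wedge dh_d on \<open>vs\<close>; on coordinate vectors it is
  the Jacobian determinant of \<open>hs\<close>. The size is read off \<open>vs\<close>, and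
  \<open>hs\<close> is meant to have the same length.\<close>

definition tdet :: "('b \<Rightarrow> real) list \<Rightarrow> 'b list \<Rightarrow> real" where
  "tdet vs hs = Determinant.det (Matrix.mat (length vs) (length vs) (\<lambda>(i, j). (vs ! i) (hs ! j)))"

text \<open>Expanding every vector in the coordinate basis factors the matrix into (vectors against
  coordinates) times (coordinate vectors against \<open>hs\<close>), and determinants
  multiply.\<close>

lemma tdet_chain:
  assumes e: "enum_of S e" and t: "param e t \<in> moduli S"
    and vs: "\<And>v. v \<in> set vs \<Longrightarrow> tangent_vector S (param e t) v"
    and hs: "\<And>h. h \<in> set hs \<Longrightarrow> regular_fun S h"
    and len: "length vs = length (coords e)" "length hs = length (coords e)"
  shows "tdet vs hs =
    tdet vs (map (tcoord e) (coords e)) * tdet (map (coord_vector e t) (coords e)) hs"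
proof -
  let ?n = "length (coords e)"
  let ?A = "Matrix.mat ?n ?n (\<lambda>(i, j). (vs ! i) (tcoord e (coords e ! j)))"
  let ?B = "Matrix.mat ?n ?n (\<lambda>(i, j). coord_vector e t (coords e ! i) (hs ! j))"
  have dist: "distinct (coords e)"
    using e by (simp add: enum_of_def)
  have "Matrix.mat ?n ?n (\<lambda>(i, j). (vs ! i) (hs ! j)) = ?A * ?B"
  proof (rule eq_matI)
    fix i j assume "i < dim_row (?A * ?B)" "j < dim_col (?A * ?B)"
    then have i: "i < ?n" and j: "j < ?n"
      by auto
    have "(vs ! i) (hs ! j) = (\<Sum>k\<in>set (coords e). (vs ! i) (tcoord e k) * coord_vector e t k (hs ! j))"
      using i j len by (intro tangent_vector_expansion[OF e t] vs hs) auto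
    also have "\<dots> = (\<Sum>k<?n. (vs ! i) (tcoord e (coords e ! k)) * coord_vector e t (coords e ! k) (hs ! j))"
      by (rule sum.reindex_bij_betw[symmetric]) (rule bij_betw_nth[OF dist refl refl])
    finally show "Matrix.mat ?n ?n (\<lambda>(i, j). (vs ! i) (hs ! j)) $$ (i, j) = (?A * ?B) $$ (i, j)"
      using i j by (simp add: scalar_prod_def lessThan_atLeast0)
  qed auto
  then have "tdet vs hs = Determinant.det (?A * ?B)"
    by (simp add: tdet_def len)
  also have "\<dots> = Determinant.det ?A * Determinant.det ?B"
    by (rule det_mult[of _ ?n]) auto
  also have "?A = Matrix.mat ?n ?n (\<lambda>(i, j). (vs ! i) (map (tcoord e) (coords e) ! j))"
    by (rule eq_matI) auto
  also have "?B = Matrix.mat ?n ?n (\<lambda>(i, j). (map (coord_vector e t) (coords e) ! i) (hs ! j))"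
    by (rule eq_matI) auto
  finally show ?thesis
    by (simp add: tdet_def len)
qed

lemma permutes_lessThan: "p permutes {..<n} \<Longrightarrow> j < n \<Longrightarrow> p j < n"
  using permutes_in_image[of p "{..<n}" j] by simp

text \<open>The Leibniz formula is taken with the permutation acting on the vectors, matching
  \<open>permute_list\<close> on the arguments in \<open>wedge\<close>.\<close>

lemma tdet_alt:
  "tdet vs hs = (\<Sum>\<sigma> | \<sigma> permutes {..<length vs}. of_int (sign \<sigma>) *
     (\<Prod>j<length vs. (vs ! \<sigma> j) (hs ! j)))"
  unfolding tdet_def
  by (subst det_col[of _ "length vs"])
    (auto intro!: sum.cong prod.cong simp: lessThan_atLeast0 permutes_lessThan)

text \<open>Reordering the functions permutes the columns and changes at most the sign; this absorbs
  the free order of the factors in \<open>Ts\<close>.\<close>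

lemma abs_tdet_mset:
  assumes "mset hs = mset hs'" "length vs = length hs"
  shows "\<bar>tdet vs hs\<bar> = \<bar>tdet vs hs'\<bar>"
proof -
  let ?n = "length vs"
  obtain p where p: "p permutes {..<length hs'}" "permute_list p hs' = hs"
    using mset_eq_permutation[OF assms(1)] by blast
  have len: "length hs' = ?n"
    using assms mset_eq_length by metis
  let ?A = "Matrix.mat ?n ?n (\<lambda>(j, i). (vs ! i) (hs' ! j))"
  have p': "p permutes {0..<?n}"
    using p len by (simp add: lessThan_atLeast0)
  \<comment> \<open>The functions index columns, whereas the permutation rule for determinants
    concerns rows.\<close>
  have "tdet vs hs = Determinant.det (transpose_mat (Matrix.mat ?n ?n (\<lambda>(j, i). (vs ! i) (hs ! j))))"
    unfolding tdet_def by (rule arg_cong[where f = Determinant.det], rule eq_matI) auto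
  also have "\<dots> = Determinant.det (Matrix.mat ?n ?n (\<lambda>(j, i). (vs ! i) (hs ! j)))"
    by (rule det_transpose) auto
  also have "Matrix.mat ?n ?n (\<lambda>(j, i). (vs ! i) (hs ! j)) = Matrix.mat ?n ?n (\<lambda>(j, i). ?A $$ (p j, i))"
    using p p' len by (intro eq_matI) (auto simp: permute_list_nth permutes_lessThan)
  also have "Determinant.det \<dots> = signof p * Determinant.det ?A"
    by (rule det_permute_rows[OF _ p']) auto
  also have "Determinant.det ?A = Determinant.det (transpose_mat ?A)"
    by (rule det_transpose[symmetric, of _ ?n]) auto
  also have "transpose_mat ?A = Matrix.mat ?n ?n (\<lambda>(i, j). (vs ! i) (hs' ! j))"
    by (rule eq_matI) auto
  finally show ?thesis
    by (simp add: tdet_def abs_mult sign_def)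
qed

text \<open>The matrix is block triangular: the upper right block vanishes, the lower left one is
  arbitrary.\<close>

lemma tdet_append:
  assumes "\<And>v h. v \<in> set vs1 \<Longrightarrow> h \<in> set hs2 \<Longrightarrow> v h = 0"
    and "length vs1 = length hs1" "length vs2 = length hs2"
  shows "tdet (vs1 @ vs2) (hs1 @ hs2) = tdet vs1 hs1 * tdet vs2 hs2"
proof -
  let ?m = "length vs1" and ?n = "length vs2"
  let ?A = "Matrix.mat ?m ?m (\<lambda>(i, j). (vs1 ! i) (hs1 ! j))"
  let ?C = "Matrix.mat ?n ?m (\<lambda>(i, j). (vs2 ! i) (hs1 ! j))"
  let ?D = "Matrix.mat ?n ?n (\<lambda>(i, j). (vs2 ! i) (hs2 ! j))"
  have "Matrix.mat (?m + ?n) (?m + ?n) (\<lambda>(i, j). ((vs1 @ vs2) ! i) ((hs1 @ hs2) ! j))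
    = four_block_mat ?A (0\<^sub>m ?m ?n) ?C ?D"
    using assms by (intro eq_matI) (auto simp: nth_append)
  then have "tdet (vs1 @ vs2) (hs1 @ hs2) = Determinant.det (four_block_mat ?A (0\<^sub>m ?m ?n) ?C ?D)"
    by (simp add: tdet_def)
  also have "\<dots> = Determinant.det ?A * Determinant.det ?D"
    by (rule det_four_block_mat_upper_right_zero[of _ ?m _ ?n]) auto
  finally show ?thesis
    by (simp add: tdet_def)
qed

lemma tdet_triangular:
  assumes "\<And>i j. j < i \<Longrightarrow> i < length vs \<Longrightarrow> (vs ! i) (hs ! j) = 0"
  shows "tdet vs hs = (\<Prod>i<length vs. (vs ! i) (hs ! i))"
proof -
  let ?A = "Matrix.mat (length vs) (length vs) (\<lambda>(i, j). (vs ! i) (hs ! j))"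
  have "Determinant.det ?A = prod_list (diag_mat ?A)"
    by (rule det_upper_triangular[of _ "length vs"]) (use assms in \<open>auto simp: upper_triangular_def\<close>)
  also have "\<dots> = (\<Prod>i<length vs. (vs ! i) (hs ! i))"
    by (simp add: diag_mat_def prod.list_conv_set_nth lessThan_atLeast0)
  finally show ?thesis
    by (simp add: tdet_def)
qed

lemma tdet_diagonal:
  assumes "distinct xs" "\<And>i j. i \<in> set xs \<Longrightarrow> j \<in> set xs \<Longrightarrow> V i (H j) = (if i = j then g i else 0)"
  shows "tdet (map V xs) (map H xs) = (\<Prod>i\<in>set xs. g i)"
proof -
  have "tdet (map V xs) (map H xs) = (\<Prod>i<length xs. g (xs ! i))"
    using assms by (subst tdet_triangular) (auto simp: nth_eq_iff_index_eq)
  also have "\<dots> = (\<Prod>i\<in>set xs. g i)"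
    by (rule prod.reindex_bij_betw) (rule bij_betw_nth[OF assms(1) refl refl])
  finally show ?thesis .
qed

text \<open>Below its first entry the first column is zero and the remaining block is diagonal; the
  entries \<open>v (H j)\<close> stay arbitrary. This is the shape of the Jacobian when infinity is
  exchanged with a free point.\<close>

lemma tdet_triangular_Cons:
  assumes "distinct xs" "\<And>i j. i \<in> set xs \<Longrightarrow> j \<in> set xs \<Longrightarrow> V i (H j) = (if i = j then g i else 0)"
    and "\<And>i. i \<in> set xs \<Longrightarrow> V i h = 0"
  shows "tdet (v # map V xs) (h # map H xs) = v h * (\<Prod>i\<in>set xs. g i)"
proof -
  have "tdet (map V xs) (map H xs) = (\<Prod>i<length xs. V (xs ! i) (H (xs ! i)))"
    using assms by (subst tdet_triangular) (auto simp: nth_eq_iff_index_eq)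
  moreover have "tdet (v # map V xs) (h # map H xs) = v h * (\<Prod>i<length xs. V (xs ! i) (H (xs ! i)))"
    using assms by (subst tdet_triangular)
      (auto simp: nth_Cons nth_eq_iff_index_eq prod.lessThan_Suc_shift simp del: prod.lessThan_Suc split: nat.splits)
  moreover have "tdet (map V xs) (map H xs) = (\<Prod>i\<in>set xs. g i)"
    by (rule tdet_diagonal[OF assms(1)]) (rule assms(2))
  ultimately show ?thesis
    by simp
qed

section \<open>Wedge products of volume forms\<close>

definition one_forms :: "('a mpoint \<Rightarrow> real) list \<Rightarrow> (nat \<times> 'a form) list" where
  "one_forms hs = map (\<lambda>h. (1, differential h)) hs"

text \<open>The alternating sum of \<open>wedge\<close> without the division by factorials, so that
  factors can be replaced one at a time before normalising.\<close>

definition alternation :: "('b list \<Rightarrow> real) \<Rightarrow> 'b list \<Rightarrow> real" where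
  "alternation \<phi> vs = (\<Sum>\<sigma> | \<sigma> permutes {..<length vs}. of_int (sign \<sigma>) * \<phi> (permute_list \<sigma> vs))"

lemma tensor_one_forms:
  "length us = length hs \<Longrightarrow> tensor (one_forms hs) x us = (\<Prod>j<length hs. (us ! j) (hs ! j))"
proof (induction hs arbitrary: us)
  case (Cons h hs)
  then obtain u us' where us: "us = u # us'" "length us' = length hs"
    by (cases us) auto
  then show ?case
    using Cons.IH[OF us(2)]
    by (simp add: one_forms_def differential_def prod.lessThan_Suc_shift del: prod.lessThan_Suc)
qed (simp add: one_forms_def)

lemma tensor_append:
  "tensor (A @ B) x us =
    tensor A x (take (sum_list (map fst A)) us) * tensor B x (drop (sum_list (map fst A)) us)"
  by (induction A arbitrary: us) (auto simp: min_def take_drop add.commute split: prod.splits)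

lemma sum_list_one_forms [simp]: "sum_list (map fst (one_forms hs)) = length hs"
  by (induction hs) (auto simp: one_forms_def)

lemma one_forms_append: "one_forms (hs @ hs') = one_forms hs @ one_forms hs'"
  by (simp add: one_forms_def)

lemma wedge_alternation:
  "wedge F x vs = alternation (tensor F x) vs / (\<Prod>(p, \<omega>)\<leftarrow>F. fact p)"
  by (simp add: wedge_def alternation_def)

lemma alternation_one_forms:
  "length vs = length hs \<Longrightarrow> alternation (tensor (one_forms hs) x) vs = tdet vs hs"
  unfolding alternation_def tdet_alt
  by (intro sum.cong refl) (auto simp: tensor_one_forms permute_list_nth)

lemma wedge_differentials:
  assumes "length vs = length hs"
  shows "wedge (map (\<lambda>h. (1, differential h)) hs) x vs = tdet vs hs"
proof -
  have "(\<Prod>(p, \<omega>)\<leftarrow>one_forms hs. fact p) = (1 :: real)"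
    by (induction hs) (auto simp: one_forms_def)
  then show ?thesis
    using alternation_one_forms[OF assms, of x] unfolding wedge_alternation one_forms_def by simp
qed

text \<open>Reindexing the sum by right multiplication with \<open>\<tau>\<close> permutes the
  arguments once more and contributes the sign of \<open>\<tau>\<close>.\<close>

lemma alternation_permute:
  assumes "\<tau> permutes {..<length vs}"
  shows "(\<Sum>\<sigma> | \<sigma> permutes {..<length vs}.
      of_int (sign \<sigma>) * (of_int (sign \<tau>) * \<phi> (permute_list \<tau> (permute_list \<sigma> vs)))) = alternation \<phi> vs"
proof -
  have "alternation \<phi> vs = (\<Sum>\<sigma> | \<sigma> permutes {..<length vs}.
      of_int (sign (\<sigma> \<circ> \<tau>)) * \<phi> (permute_list (\<sigma> \<circ> \<tau>) vs))"
    unfolding alternation_def by (rule sum_permutations_compose_right[OF assms])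
  also have "\<dots> = (\<Sum>\<sigma> | \<sigma> permutes {..<length vs}.
      of_int (sign \<sigma>) * (of_int (sign \<tau>) * \<phi> (permute_list \<tau> (permute_list \<sigma> vs))))"
  proof (intro sum.cong refl)
    fix \<sigma> assume "\<sigma> \<in> {\<sigma>. \<sigma> permutes {..<length vs}}"
    then have \<sigma>: "\<sigma> permutes {..<length vs}"
      by simp
    have "sign (\<sigma> \<circ> \<tau>) = sign \<sigma> * sign \<tau>"
      using \<sigma> assms by (intro sign_compose) (auto intro: permutes_imp_permutation)
    moreover have "permute_list (\<sigma> \<circ> \<tau>) vs = permute_list \<tau> (permute_list \<sigma> vs)"
      by (rule permute_list_compose[OF assms])
    ultimately show "of_int (sign (\<sigma> \<circ> \<tau>)) * \<phi> (permute_list (\<sigma> \<circ> \<tau>) vs) =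
        of_int (sign \<sigma>) * (of_int (sign \<tau>) * \<phi> (permute_list \<tau> (permute_list \<sigma> vs)))"
      by simp
  qed
  finally show ?thesis by simp
qed

text \<open>Expanding the determinant on one block of arguments, each of its \<open>d!\<close> terms contributes the
  same amount to the alternating sum.\<close>

lemma alternation_block:
  assumes len: "length hs = d" "length pre + d \<le> length vs"
    and \<omega>: "\<And>us. length us = d \<Longrightarrow> set us \<subseteq> set vs \<Longrightarrow> \<omega> x us = c * tdet us hs"
  shows "alternation (tensor (one_forms pre @ (d, \<omega>) # F) x) vs =
    c * fact d * alternation (tensor (one_forms (pre @ hs) @ F) x) vs"
proof -
  let ?q = "length pre" and ?N = "length vs"
  let ?\<Psi> = "tensor (one_forms (pre @ hs) @ F) x"
  \<comment> \<open>\<open>shift \<tau>\<close> permutes only the argument positions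
    \<open>?q, ..., ?q + d - 1\<close> that the form \<open>\<omega>\<close> receives and fixes all
    others.\<close>
  define shift where "shift = map_permutation {..<d} (\<lambda>i. ?q + i)"
  have bij: "bij_betw (\<lambda>i. ?q + i) {..<d} {?q..<?q + d}"
    by (intro bij_betwI[where g = "\<lambda>i. i - ?q"]) auto
  have shift: "shift \<tau> permutes {?q..<?q + d}" if "\<tau> permutes {..<d}" for \<tau>
    unfolding shift_def by (rule map_permutation_permutes[OF bij that])
  have shift': "shift \<tau> permutes {..<?N}" if "\<tau> permutes {..<d}" for \<tau>
    by (rule permutes_subset[OF shift[OF that]]) (use len in auto)
  have sign_shift: "sign (shift \<tau>) = sign \<tau>" if "\<tau> permutes {..<d}" for \<tau>
    unfolding shift_def by (rule sign_map_permutation) (use that in auto)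
  have step: "tensor (one_forms pre @ (d, \<omega>) # F) x us =
      c * (\<Sum>\<tau> | \<tau> permutes {..<d}. of_int (sign (shift \<tau>)) * ?\<Psi> (permute_list (shift \<tau>) us))"
    if us: "length us = ?N" "set us \<subseteq> set vs" for us
  proof -
    let ?b = "take d (drop ?q us)"
    have lb: "length ?b = d"
      using us len by simp
    have "tensor (one_forms pre @ (d, \<omega>) # F) x us =
      tensor (one_forms pre) x (take ?q us) * (\<omega> x ?b * tensor F x (drop (?q + d) us))"
      by (simp add: tensor_append add.commute)
    also have "\<omega> x ?b = c * tdet ?b hs"
      by (rule \<omega>[OF lb]) (use us set_take_subset[of d "drop ?q us"] set_drop_subset[of ?q us] in blast)
    also have "tdet ?b hs = (\<Sum>\<tau> | \<tau> permutes {..<d}. of_int (sign \<tau>) * (\<Prod>j<d. (?b ! \<tau> j) (hs ! j)))"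
      unfolding tdet_alt lb ..
    also have "tensor (one_forms pre) x (take ?q us) * (c * \<dots> * tensor F x (drop (?q + d) us)) =
      c * (\<Sum>\<tau> | \<tau> permutes {..<d}. of_int (sign \<tau>) * (tensor (one_forms pre) x (take ?q us) *
        (\<Prod>j<d. (?b ! \<tau> j) (hs ! j)) * tensor F x (drop (?q + d) us)))"
      by (simp add: sum_distrib_left sum_distrib_right mult.assoc mult.left_commute mult.commute)
    also have "\<dots> = c * (\<Sum>\<tau> | \<tau> permutes {..<d}. of_int (sign (shift \<tau>)) * ?\<Psi> (permute_list (shift \<tau>) us))"
    proof (intro arg_cong[where f = "\<lambda>y. c * y"] sum.cong refl)
      fix \<tau> assume "\<tau> \<in> {\<tau>. \<tau> permutes {..<d}}"
      then have \<tau>: "\<tau> permutes {..<d}"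
        by simp
      let ?ws = "permute_list (shift \<tau>) us"
      have sN: "shift \<tau> permutes {..<length us}"
        using shift'[OF \<tau>] us by simp
      have id: "shift \<tau> i = i" if "i < ?q \<or> ?q + d \<le> i" for i
        using permutes_not_in[OF shift[OF \<tau>], of i] that by auto
      have take: "take ?q ?ws = take ?q us"
        using us by (intro nth_equalityI) (auto simp: permute_list_nth[OF sN] id)
      have drop: "drop (?q + d) ?ws = drop (?q + d) us"
        using us by (intro nth_equalityI) (auto simp: permute_list_nth[OF sN] id)
      have "?b ! \<tau> j = take d (drop ?q ?ws) ! j" if "j < d" for j
      proof -
        have "\<tau> j < d"
          by (rule permutes_lessThan[OF \<tau> that])
        moreover have "shift \<tau> (?q + j) = ?q + \<tau> j"
          unfolding shift_def using map_permutation_apply[of "\<lambda>i. ?q + i" "{..<d}" j \<tau>] that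
          by simp
        ultimately show ?thesis
          using that us len by (simp add: permute_list_nth[OF sN])
      qed
      then have "(\<Prod>j<d. (?b ! \<tau> j) (hs ! j)) = (\<Prod>j<d. (take d (drop ?q ?ws) ! j) (hs ! j))"
        by simp
      also have "\<dots> = tensor (one_forms hs) x (take d (drop ?q ?ws))"
        using us len by (simp add: tensor_one_forms)
      finally have "tensor (one_forms pre) x (take ?q us) *
        (\<Prod>j<d. (?b ! \<tau> j) (hs ! j)) * tensor F x (drop (?q + d) us) = ?\<Psi> ?ws"
        using take drop len(1)
        by (simp add: one_forms_append tensor_append add.commute)
      then show "of_int (sign \<tau>) * (tensor (one_forms pre) x (take ?q us) *
        (\<Prod>j<d. (?b ! \<tau> j) (hs ! j)) * tensor F x (drop (?q + d) us)) =
        of_int (sign (shift \<tau>)) * ?\<Psi> ?ws"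
        by (simp add: sign_shift[OF \<tau>])
    qed
    finally show ?thesis .
  qed
  have "alternation (tensor (one_forms pre @ (d, \<omega>) # F) x) vs =
    (\<Sum>\<sigma> | \<sigma> permutes {..<?N}. \<Sum>\<tau> | \<tau> permutes {..<d}. c * (of_int (sign \<sigma>) *
      (of_int (sign (shift \<tau>)) * ?\<Psi> (permute_list (shift \<tau>) (permute_list \<sigma> vs)))))"
    unfolding alternation_def
    by (intro sum.cong refl) (simp add: step sum_distrib_left mult.left_commute)
  also have "\<dots> = (\<Sum>\<tau> | \<tau> permutes {..<d}. c * (\<Sum>\<sigma> | \<sigma> permutes {..<?N}. of_int (sign \<sigma>) *
      (of_int (sign (shift \<tau>)) * ?\<Psi> (permute_list (shift \<tau>) (permute_list \<sigma> vs)))))"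
    by (subst sum.swap) (simp add: sum_distrib_left)
  also have "\<dots> = (\<Sum>\<tau> | \<tau> permutes {..<d}. c * alternation ?\<Psi> vs)"
    by (intro sum.cong refl arg_cong[where f = "\<lambda>y. c * y"] alternation_permute shift') simp
  also have "\<dots> = c * fact d * alternation ?\<Psi> vs"
    by (simp add: card_permutations[of "{..<d}" d])
  finally show ?thesis .
qed

text \<open>\<open>pre\<close> collects the differentials of the blocks already expanded, so the
  induction can expand the factors from left to right.\<close>

lemma alternation_blocks:
  assumes "\<And>i. i \<in> set is \<Longrightarrow> length (hs i) = d i"
    and "length pre + sum_list (map d is) \<le> length vs"
    and "\<And>i us. i \<in> set is \<Longrightarrow> length us = d i \<Longrightarrow> set us \<subseteq> set vs \<Longrightarrow> \<omega> i x us = c i * tdet us (hs i)"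
  shows "alternation (tensor (one_forms pre @ map (\<lambda>i. (d i, \<omega> i)) is) x) vs =
    (\<Prod>i\<leftarrow>is. c i * fact (d i)) * alternation (tensor (one_forms (pre @ concat (map hs is))) x) vs"
  using assms
proof (induction "is" arbitrary: pre)
  case (Cons i "is")
  have "alternation (tensor (one_forms pre @ (d i, \<omega> i) # map (\<lambda>i. (d i, \<omega> i)) is) x) vs =
    c i * fact (d i) *
    alternation (tensor (one_forms (pre @ hs i) @ map (\<lambda>i. (d i, \<omega> i)) is) x) vs"
    by (rule alternation_block) (use Cons.prems in auto)
  also have "alternation (tensor (one_forms (pre @ hs i) @ map (\<lambda>i. (d i, \<omega> i)) is) x) vs =
    (\<Prod>i\<leftarrow>is. c i * fact (d i)) *
    alternation (tensor (one_forms ((pre @ hs i) @ concat (map hs is))) x) vs"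
    by (rule Cons.IH) (use Cons.prems in auto)
  finally show ?case
    by simp
qed simp

text \<open>Each block of degree \<open>d i\<close> produces a factor \<open>fact (d i)\<close>, and
  the normalisation of \<open>wedge\<close> divides by exactly these; what is left is one
  determinant against all functions together.\<close>

lemma wedge_blocks:
  assumes "\<And>i. i \<in> set is \<Longrightarrow> length (hs i) = d i"
    and "length vs = sum_list (map d is)"
    and "\<And>i us. i \<in> set is \<Longrightarrow> length us = d i \<Longrightarrow> set us \<subseteq> set vs \<Longrightarrow> \<omega> i x us = c i * tdet us (hs i)"
  shows "wedge (map (\<lambda>i. (d i, \<omega> i)) is) x vs = (\<Prod>i\<leftarrow>is. c i) * tdet vs (concat (map hs is))"
proof -
  have "length (concat (map hs is)) = length vs"
    using assms(1) unfolding assms(2) length_concat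
    by (intro arg_cong[where f = sum_list]) simp
  then have "alternation (tensor (map (\<lambda>i. (d i, \<omega> i)) is) x) vs =
    (\<Prod>i\<leftarrow>is. c i * fact (d i)) * tdet vs (concat (map hs is))"
    using alternation_blocks[of "is" hs d "[]" vs \<omega> x c] assms
    by (simp add: alternation_one_forms) (simp add: one_forms_def)
  moreover have "(\<Prod>i\<leftarrow>is. c i * fact (d i)) = (\<Prod>i\<leftarrow>is. c i) * (\<Prod>i\<leftarrow>is. fact (d i) :: real)"
    by (induction "is") auto
  moreover have "(\<Prod>i\<leftarrow>is. fact (d i) :: real) \<noteq> 0"
    by (induction "is") auto
  moreover have "(\<Prod>(p, \<omega>)\<leftarrow>map (\<lambda>i. (d i, \<omega> i)) is. fact p) = (\<Prod>i\<leftarrow>is. fact (d i) :: real)"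
    by (simp add: comp_def)
  ultimately show ?thesis
    unfolding wedge_alternation by simp
qed

section \<open>Volume forms and their pullback along a coordinate system\<close>

lemma length_coords:
  assumes "enum_of S e"
  shows "length (coords e) = card S - 3"
  using assms distinct_card[of e] by (simp add: enum_of_def)

lemma volume_form_expansion:
  assumes "volume_form S \<omega>"
  obtains F :: "(('a mpoint \<Rightarrow> real) \<times> ('a mpoint \<Rightarrow> real) list) list" where
    "\<And>g hs. (g, hs) \<in> set F \<Longrightarrow> regular_fun S g \<and> length hs = card S - 3 \<and> (\<forall>h\<in>set hs. regular_fun S h)"
    "\<And>x vs. x \<in> moduli S \<Longrightarrow> length vs = card S - 3 \<Longrightarrow> (\<And>v. v \<in> set vs \<Longrightarrow> tangent_vector S x v) \<Longrightarrow>
      \<omega> x vs = (\<Sum>(g, hs)\<leftarrow>F. g x * tdet vs hs)"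
proof -
  obtain F :: "(('a mpoint \<Rightarrow> real) \<times> ('a mpoint \<Rightarrow> real) list) list"
    where F: "\<And>g hs. (g, hs) \<in> set F \<Longrightarrow> regular_fun S g \<and> length hs = card S - 3 \<and> (\<forall>h\<in>set hs. regular_fun S h)"
    and eq: "\<And>x vs. x \<in> moduli S \<Longrightarrow> length vs = card S - 3 \<Longrightarrow>
      (\<And>v. v \<in> set vs \<Longrightarrow> tangent_vector S x v) \<Longrightarrow>
      \<omega> x vs = (\<Sum>(g, hs)\<leftarrow>F. g x * wedge (map (\<lambda>h. (1, differential h)) hs) x vs)"
    using assms unfolding volume_form_def regular_form_def by (force split: prod.splits)
  have "\<omega> x us = (\<Sum>(g, hs)\<leftarrow>F. g x * tdet us hs)"
    if "x \<in> moduli S" "length us = card S - 3" "\<And>v. v \<in> set us \<Longrightarrow> tangent_vector S x v" for x us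
  proof -
    have "\<omega> x us = (\<Sum>(g, hs)\<leftarrow>F. g x * wedge (map (\<lambda>h. (1, differential h)) hs) x us)"
      by (rule eq[OF that])
    also have "\<dots> = (\<Sum>(g, hs)\<leftarrow>F. g x * tdet us hs)"
    proof (intro arg_cong[where f = sum_list] map_cong refl, clarify)
      fix g hs assume "(g, hs) \<in> set F"
      then show "g x * wedge (map (\<lambda>h. (1, differential h)) hs) x us = g x * tdet us hs"
        using F that(2) wedge_differentials[of us hs x] by (metis (no_types, lifting))
    qed
    finally show ?thesis .
  qed
  with F show ?thesis
    using that by blast
qed

text \<open>By \<open>tdet_chain\<close> every summand g dh_1 ... dh_d acquires the same factor, the
  determinant of \<open>vs\<close> against the coordinates; the cofactor that remains is the value
  of the form on the coordinate vectors.\<close>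

lemma volume_form_eq_coefficient:
  assumes \<omega>: "volume_form S \<omega>" and e: "enum_of S e" and t: "param e t \<in> moduli S"
    and vs: "\<And>v. v \<in> set vs \<Longrightarrow> tangent_vector S (param e t) v"
    and len: "length vs = card S - 3"
  shows "\<omega> (param e t) vs = coefficient e \<omega> t * tdet vs (map (tcoord e) (coords e))"
proof -
  let ?x = "param e t" and ?cv = "map (coord_vector e t) (coords e)"
  obtain F where F: "\<And>g hs. (g, hs) \<in> set F \<Longrightarrow>
      regular_fun S g \<and> length hs = card S - 3 \<and> (\<forall>h\<in>set hs. regular_fun S h)"
    and eq: "\<And>x vs. x \<in> moduli S \<Longrightarrow> length vs = card S - 3 \<Longrightarrow>
      (\<And>v. v \<in> set vs \<Longrightarrow> tangent_vector S x v) \<Longrightarrow> \<omega> x vs = (\<Sum>(g, hs)\<leftarrow>F. g x * tdet vs hs)"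
    using volume_form_expansion[OF \<omega>] by blast
  have cv: "length ?cv = card S - 3" "\<And>v. v \<in> set ?cv \<Longrightarrow> tangent_vector S ?x v"
    using length_coords[OF e] tangent_coord_vector[OF e _ t] by auto
  have "\<omega> ?x vs = (\<Sum>(g, hs)\<leftarrow>F. g ?x * tdet vs hs)"
    by (rule eq[OF t len vs])
  also have "\<dots> = (\<Sum>(g, hs)\<leftarrow>F. g ?x * (tdet vs (map (tcoord e) (coords e)) * tdet ?cv hs))"
  proof (intro arg_cong[where f = sum_list] map_cong refl, clarify)
    fix g hs assume "(g, hs) \<in> set F"
    then have hs: "length hs = card S - 3" "\<And>h. h \<in> set hs \<Longrightarrow> regular_fun S h"
      using F by blast+
    have "tdet vs hs = tdet vs (map (tcoord e) (coords e)) * tdet ?cv hs"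
      using len hs(1) length_coords[OF e] by (intro tdet_chain[OF e t vs hs(2)]) auto
    then show "g ?x * tdet vs hs = g ?x * (tdet vs (map (tcoord e) (coords e)) * tdet ?cv hs)"
      by (rule arg_cong)
  qed
  also have "\<dots> = (\<Sum>(g, hs)\<leftarrow>F. g ?x * tdet ?cv hs) * tdet vs (map (tcoord e) (coords e))"
    by (induction F) (auto simp: algebra_simps)
  also have "(\<Sum>(g, hs)\<leftarrow>F. g ?x * tdet ?cv hs) = coefficient e \<omega> t"
    unfolding coefficient_def by (rule eq[OF t cv, symmetric])
  finally show ?thesis .
qed

text \<open>The coordinates of one factor as functions on the large moduli space;
  \<open>some_enum\<close> is the enumeration in which the integrals over the factor are
  defined.\<close>

definition pulled_coords :: "'a set \<Rightarrow> ('a mpoint \<Rightarrow> real) list" where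
  "pulled_coords T = map (\<lambda>j. tcoord (some_enum T) j \<circ> forget T) (coords (some_enum T))"

lemma enum_of_some_enum:
  assumes "3 \<le> card T"
  shows "enum_of T (some_enum T)"
proof -
  have "finite T"
    using assms card_ge_0_finite by force
  then have "\<exists>e. distinct e \<and> set e = T"
    using finite_distinct_list by blast
  then have "distinct (some_enum T) \<and> set (some_enum T) = T"
    unfolding some_enum_def by (rule someI_ex)
  then show ?thesis
    using assms distinct_card[of "some_enum T"] by (auto simp: enum_of_def)
qed

text \<open>Every factor is of top degree on its own moduli space, hence a coefficient times a
  determinant, and \<open>wedge_blocks\<close> merges these into one. The determinant does not
  depend on the forms, so \<open>\<omega>\<close> and \<open>\<eta>\<close> will share it.\<close>

lemma product_pullback_eq:
  assumes Ts: "\<And>T. T \<in> set Ts \<Longrightarrow> T \<subseteq> S \<and> 3 \<le> card T"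
    and \<omega>: "\<And>i. i < length Ts \<Longrightarrow> volume_form (Ts ! i) (\<omega> i)"
    and x: "x \<in> moduli S"
    and vs: "\<And>v. v \<in> set vs \<Longrightarrow> tangent_vector S x v"
    and len: "length vs = (\<Sum>T\<leftarrow>Ts. card T - 3)"
  shows "product_pullback Ts \<omega> x vs =
    (\<Prod>i<length Ts. coefficient (some_enum (Ts ! i)) (\<omega> i) (tmap (some_enum (Ts ! i)) (forget (Ts ! i) x))) *
    tdet vs (concat (map pulled_coords Ts))"
proof -
  let ?c = "\<lambda>i. coefficient (some_enum (Ts ! i)) (\<omega> i) (tmap (some_enum (Ts ! i)) (forget (Ts ! i) x))"
  have "product_pullback Ts \<omega> x vs = (\<Prod>i\<leftarrow>[0..<length Ts]. ?c i) *
      tdet vs (concat (map (\<lambda>i. pulled_coords (Ts ! i)) [0..<length Ts]))"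
    unfolding product_pullback_def
  proof (rule wedge_blocks)
    fix i assume "i \<in> set [0..<length Ts]"
    then have T: "Ts ! i \<subseteq> S" "3 \<le> card (Ts ! i)" and i: "i < length Ts"
      using Ts[of "Ts ! i"] by auto
    note e = enum_of_some_enum[OF T(2)]
    show "length (pulled_coords (Ts ! i)) = card (Ts ! i) - 3"
      using length_coords[OF e] by (simp add: pulled_coords_def)
    fix us assume us: "length us = card (Ts ! i) - 3" "set us \<subseteq> set vs"
    let ?y = "forget (Ts ! i) x"
    have y: "param (some_enum (Ts ! i)) (tmap (some_enum (Ts ! i)) ?y) = ?y" "?y \<in> moduli (Ts ! i)"
      using forget_moduli[OF T(1) x] by (auto simp: param_tmap[OF e])
    let ?us = "map (\<lambda>D h. D (h \<circ> forget (Ts ! i))) us"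
    have "\<omega> i ?y ?us = ?c i * tdet ?us (map (tcoord (some_enum (Ts ! i))) (coords (some_enum (Ts ! i))))"
      using volume_form_eq_coefficient[OF \<omega>[OF i] e, of "tmap (some_enum (Ts ! i)) ?y" ?us]
        us vs tangent_vector_forget[OF T(1)] y by auto
    moreover have "tdet ?us (map (tcoord (some_enum (Ts ! i))) (coords (some_enum (Ts ! i)))) =
        tdet us (pulled_coords (Ts ! i))"
      unfolding tdet_def using us length_coords[OF e]
      by (intro arg_cong[where f = Determinant.det] eq_matI) (auto simp: pulled_coords_def)
    ultimately show "pullback (forget (Ts ! i)) (\<omega> i) x us = ?c i * tdet us (pulled_coords (Ts ! i))"
      by (simp add: pullback_def)
  next
    have "map (\<lambda>i. card (Ts ! i) - 3) [0..<length Ts] = map (\<lambda>T. card T - 3) Ts"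
      by (rule nth_equalityI) auto
    then show "length vs = (\<Sum>i\<leftarrow>[0..<length Ts]. card (Ts ! i) - 3)"
      using len by simp
  qed
  also have "map (\<lambda>i. pulled_coords (Ts ! i)) [0..<length Ts] = map pulled_coords Ts"
    by (rule nth_equalityI) auto
  also have "(\<Prod>i\<leftarrow>[0..<length Ts]. ?c i) = (\<Prod>i<length Ts. ?c i)"
    by (simp add: prod.distinct_set_conv_list[symmetric] lessThan_atLeast0)
  finally show ?thesis .
qed

section \<open>Moebius substitutions\<close>

text \<open>Away from its pole \<open>g\<close> is injective and misses at most its value at
  infinity, so at most one point is lost on either side; equality of the measures is tested on
  intervals.\<close>

lemma moebius_substitution:
  fixes a b c d :: real
  defines "g \<equiv> \<lambda>s. (a * s + b) / (c * s + d)" and "g' \<equiv> \<lambda>s. (a * d - b * c) / (c * s + d)^2"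
  assumes det: "a * d - b * c \<noteq> 0"
  shows "distr (density lborel (\<lambda>s. ennreal \<bar>g' s\<bar>)) borel g = lborel"
proof (rule lborel_eqI[symmetric])
  have [measurable]: "g \<in> borel_measurable borel" "g' \<in> borel_measurable borel"
    by (simp_all add: g_def g'_def)
  fix l u :: real assume "\<And>b. b \<in> Basis \<Longrightarrow> l \<bullet> b \<le> u \<bullet> b"
  then have lu: "l \<le> u"
    by simp
  \<comment> \<open>The pole is removed because division by zero yields 0 there, which may lie in
    the interval.\<close>
  define B where "B = {s. c * s + d \<noteq> 0 \<and> g s \<in> {l<..<u}}"
  have B[measurable]: "B \<in> sets borel"
    unfolding B_def by measurable
  have inj: "inj_on g B"
  proof (rule inj_onI)
    fix s t assume "s \<in> B" "t \<in> B" "g s = g t"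
    then have "(a * s + b) * (c * t + d) = (a * t + b) * (c * s + d)"
      by (simp add: B_def g_def frac_eq_eq)
    then have "(a * d - b * c) * (s - t) = 0"
      by (simp add: algebra_simps)
    with det show "s = t"
      by simp
  qed
  have der: "(g has_field_derivative g' s) (at s within B)" if "s \<in> B" for s
  proof -
    have "(g has_field_derivative (a * (c * s + d) - (a * s + b) * c) / (c * s + d)\<^sup>2) (at s within B)"
      unfolding g_def using that
      by (auto intro!: derivative_eq_intros simp: B_def power2_eq_square)
    then show ?thesis
      by (simp add: g'_def algebra_simps)
  qed
  have img: "g ` B = {l<..<u} - {r. c * r = a}"
  proof (intro equalityI subsetI)
    fix r assume "r \<in> g ` B"
    then obtain s where s: "s \<in> B" "r = g s"
      by blast
    have "c * r \<noteq> a"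
    proof
      assume "c * r = a"
      then have "c * (a * s + b) = a * (c * s + d)"
        using s by (simp add: g_def B_def field_simps)
      with det show False
        by (simp add: algebra_simps)
    qed
    with s show "r \<in> {l<..<u} - {r. c * r = a}"
      by (auto simp: B_def)
  next
    fix r assume r: "r \<in> {l<..<u} - {r. c * r = a}"
    \<comment> \<open>The preimage is given by the inverse matrix.\<close>
    define s where "s = (d * r - b) / (a - c * r)"
    have nz: "a - c * r \<noteq> 0"
      using r by auto
    have 1: "c * s + d = (a * d - b * c) / (a - c * r)" "a * s + b = r * (a * d - b * c) / (a - c * r)"
      using nz by (simp_all add: s_def field_simps)
    then have "c * s + d \<noteq> 0" "g s = r"
      using nz det by (simp_all add: g_def)
    then show "r \<in> g ` B"
      using r by (intro image_eqI[of _ _ s]) (auto simp: B_def)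
  qed
  have fin: "finite {r. c * r = a}" "finite {s. c * s + d = 0}"
  proof -
    have "{r. c * r = a} \<subseteq> {a / c}"
      using det by (cases "c = 0") (auto simp: field_simps)
    then show "finite {r. c * r = a}"
      by (rule finite_subset) simp
    have "{s. c * s + d = 0} \<subseteq> {- d / c}"
      using det by (cases "c = 0") (auto simp: field_simps)
    then show "finite {s. c * s + d = 0}"
      by (rule finite_subset) simp
  qed
  have "((\<lambda>x. 1 :: real) has_integral (u - l)) {l<..<u}"
    using has_integral_const_real[of "1::real" l u] lu
    by (simp add: has_integral_Icc_iff_Ioo)
  then have "((\<lambda>x. 1 :: real) has_integral (u - l)) (g ` B)"
    unfolding img using fin(1)
    by (subst has_integral_spike_set_eq) (auto intro: negligible_subset[OF negligible_finite])
  moreover from this have "(\<lambda>x. 1 :: real) absolutely_integrable_on (g ` B)"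
    by (intro nonnegative_absolutely_integrable_1) auto
  ultimately have "(\<lambda>x. \<bar>g' x\<bar> * 1) absolutely_integrable_on B \<and> integral B (\<lambda>x. \<bar>g' x\<bar> * 1) = u - l"
    using has_absolute_integral_change_of_variables_1'[of B g g' "\<lambda>_. 1" "u - l"] der inj B
    by (auto simp: integral_unique)
  then have "((\<lambda>x. \<bar>g' x\<bar>) has_integral (u - l)) B"
    by (simp add: set_lebesgue_integral_eq_integral(1) has_integral_iff)
  then have "(\<integral>\<^sup>+ x. ennreal (indicator B x * \<bar>g' x\<bar>) \<partial>lborel) = ennreal (u - l)"
    by (intro nn_integral_has_integral_lebesgue) auto
  moreover have "AE x in lborel. c * x + d \<noteq> 0"
    using fin(2) by (intro AE_I'[of "{s. c * s + d = 0}"] finite_imp_null_set_lborel) auto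
  then have "(\<integral>\<^sup>+ x. ennreal (indicator B x * \<bar>g' x\<bar>) \<partial>lborel) =
    (\<integral>\<^sup>+ x. ennreal \<bar>g' x\<bar> * indicator (g -` box l u) x \<partial>lborel)"
    by (intro nn_integral_cong_AE, eventually_elim) (auto simp: B_def indicator_def)
  moreover have "emeasure (distr (density lborel (\<lambda>s. ennreal \<bar>g' s\<bar>)) borel g) (box l u) =
    (\<integral>\<^sup>+ x. ennreal \<bar>g' x\<bar> * indicator (g -` box l u) x \<partial>lborel)"
    using measurable_sets[of g borel borel "box l u"]
    by (subst emeasure_distr) (simp_all add: emeasure_density)
  ultimately show "emeasure (distr (density lborel (\<lambda>s. ennreal \<bar>g' s\<bar>)) borel g) (box l u) =
      ennreal (prod (\<lambda>b. (u - l) \<bullet> b) Basis)"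
    by simp
qed simp

interpretation lborel_product: product_sigma_finite "\<lambda>_. lborel :: real measure" ..

text \<open>On boxes both the density and the indicator split into factors, one per coordinate, so
  the one-dimensional rule determines the image measure.\<close>

lemma moebius_substitution_PiM:
  fixes a b c d :: real
  defines "g \<equiv> \<lambda>s. (a * s + b) / (c * s + d)" and "g' \<equiv> \<lambda>s. (a * d - b * c) / (c * s + d)^2"
  assumes det: "a * d - b * c \<noteq> 0" and J: "finite J"
    and F [measurable]: "F \<in> borel_measurable (\<Pi>\<^sub>M i\<in>J. lborel)"
  shows "(\<integral>\<^sup>+ t. F t \<partial>(\<Pi>\<^sub>M i\<in>J. lborel)) =
    (\<integral>\<^sup>+ t. F (\<lambda>i\<in>J. g (t i)) * ennreal \<bar>\<Prod>i\<in>J. g' (t i)\<bar> \<partial>(\<Pi>\<^sub>M i\<in>J. lborel))"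
proof -
  have [measurable]: "g \<in> borel_measurable borel" "g' \<in> borel_measurable borel"
    by (simp_all add: g_def g'_def)
  let ?P = "\<Pi>\<^sub>M i\<in>J. lborel :: real measure"
  let ?D = "density ?P (\<lambda>t. ennreal \<bar>\<Prod>i\<in>J. g' (t i)\<bar>)"
  let ?G = "\<lambda>t. \<lambda>i\<in>J. g (t i)"
  have [measurable]: "?G \<in> measurable ?P ?P"
    by measurable
  have "distr ?D ?P ?G = ?P"
  proof (rule lborel_product.PiM_eqI[OF J])
    fix A :: "'a \<Rightarrow> real set"
    assume A: "\<And>i. i \<in> J \<Longrightarrow> A i \<in> sets lborel"
    then have [measurable]: "\<And>i. i \<in> J \<Longrightarrow> A i \<in> sets borel"
      by simp
    have "emeasure (distr ?D ?P ?G) (Pi\<^sub>E J A) =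
      (\<integral>\<^sup>+ t. ennreal \<bar>\<Prod>i\<in>J. g' (t i)\<bar> * indicator (?G -` Pi\<^sub>E J A \<inter> space ?P) t \<partial>?P)"
      using A J by (subst emeasure_distr) (auto simp: emeasure_density intro!: sets_PiM_I_finite)
    also have "\<dots> = (\<integral>\<^sup>+ t. (\<Prod>i\<in>J. ennreal \<bar>g' (t i)\<bar> * indicator (g -` A i) (t i)) \<partial>?P)"
    proof (rule nn_integral_cong)
      fix t assume "t \<in> space ?P"
      then have "?G -` Pi\<^sub>E J A \<inter> space ?P = {t \<in> space ?P. \<forall>i\<in>J. g (t i) \<in> A i}"
        by auto
      with \<open>t \<in> space ?P\<close>
      have "indicator (?G -` Pi\<^sub>E J A \<inter> space ?P) t = (\<Prod>i\<in>J. indicator (g -` A i) (t i) :: ennreal)"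
        using J by (cases "\<forall>i\<in>J. g (t i) \<in> A i") (auto simp: indicator_def)
      then show "ennreal \<bar>\<Prod>i\<in>J. g' (t i)\<bar> * indicator (?G -` Pi\<^sub>E J A \<inter> space ?P) t =
          (\<Prod>i\<in>J. ennreal \<bar>g' (t i)\<bar> * indicator (g -` A i) (t i))"
        by (simp add: prod.distrib abs_prod prod_ennreal)
    qed
    also have "\<dots> = (\<Prod>i\<in>J. \<integral>\<^sup>+ s. ennreal \<bar>g' s\<bar> * indicator (g -` A i) s \<partial>lborel)"
      by (rule lborel_product.product_nn_integral_prod[OF J]) measurable
    also have "\<dots> = (\<Prod>i\<in>J. emeasure lborel (A i))"
    proof (rule prod.cong[OF refl])
      fix i assume i[measurable]: "i \<in> J"
      have "emeasure lborel (A i) = emeasure (distr (density lborel (\<lambda>s. ennreal \<bar>g' s\<bar>)) borel g) (A i)"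
        unfolding g_def g'_def by (subst moebius_substitution[OF det]) simp
      also have "\<dots> = (\<integral>\<^sup>+ s. ennreal \<bar>g' s\<bar> * indicator (g -` A i) s \<partial>lborel)"
        using A[OF i] measurable_sets[of g borel borel "A i"]
        by (subst emeasure_distr) (simp_all add: emeasure_density)
      finally show "(\<integral>\<^sup>+ s. ennreal \<bar>g' s\<bar> * indicator (g -` A i) s \<partial>lborel) = emeasure lborel (A i)" ..
    qed
    finally show "emeasure (distr ?D ?P ?G) (Pi\<^sub>E J A) = (\<Prod>i\<in>J. emeasure lborel (A i))" .
  qed simp
  then have "integral\<^sup>N ?P F = integral\<^sup>N (distr ?D ?P ?G) F"
    by simp
  also have "\<dots> = (\<integral>\<^sup>+ t. F (?G t) \<partial>?D)"
    by (rule nn_integral_distr) measurable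
  also have "\<dots> = (\<integral>\<^sup>+ t. ennreal \<bar>\<Prod>i\<in>J. g' (t i)\<bar> * F (?G t) \<partial>?P)"
    by (rule nn_integral_density) measurable
  finally show ?thesis
    by (simp add: mult.commute)
qed

section \<open>Measurability\<close>

text \<open>The complement of the hyperplanes t_i = 0, t_i = 1 and t_i = t_j.\<close>

definition chart :: "'a list \<Rightarrow> ('a \<Rightarrow> real) set" where
  "chart e = coord_region e (moduli (set e))"

lemma chart_iff:
  assumes "enum_of S e"
  shows "t \<in> chart e \<longleftrightarrow> t \<in> space (coord_measure e) \<and>
    (\<forall>i\<in>set (coords e). t i \<noteq> 0 \<and> t i \<noteq> 1) \<and> inj_on t (set (coords e))"
  using assms param_in_moduli_iff[OF assms, of t]
  by (auto simp: chart_def coord_region_def enum_of_def)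

lemma param_in_moduli: "enum_of S e \<Longrightarrow> t \<in> chart e \<Longrightarrow> param e t \<in> moduli S"
  by (auto simp: chart_def coord_region_def enum_of_def)

lemma chart_in_space: "t \<in> chart e \<Longrightarrow> t \<in> space (coord_measure e)"
  by (auto simp: chart_def coord_region_def)

lemma tmap_in_space: "tmap e x \<in> space (coord_measure e)"
  by (auto simp: tmap_def space_PiM)

lemma tmap_in_chart:
  assumes "enum_of S e" "x \<in> moduli S"
  shows "tmap e x \<in> chart e"
  using assms param_tmap[OF assms] tmap_in_space[of e x]
  by (auto simp: chart_def coord_region_def enum_of_def)

lemma chart_measurable [measurable]:
  assumes "enum_of S e"
  shows "chart e \<in> sets (coord_measure e)"
proof -
  have comp: "(\<lambda>t. t i) \<in> borel_measurable (coord_measure e)" if "i \<in> set (coords e)" for i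
    using measurable_component_singleton[OF that, of "\<lambda>_. lborel"] by simp
  have "chart e = {t \<in> space (coord_measure e). \<forall>i\<in>set (coords e). t i \<noteq> 0 \<and> t i \<noteq> 1 \<and>
      (\<forall>j\<in>set (coords e) - {i}. t i \<noteq> t j)}"
    using chart_iff[OF assms] by (auto simp: inj_on_def)
  also have "\<dots> \<in> sets (coord_measure e)"
    by (intro sets.sets_Collect_finite_All sets.sets_Collect_conj borel_measurable_neq comp
        borel_measurable_const) auto
  finally show ?thesis .
qed

lemma bracket_measurable:
  assumes "enum_of S e" "i \<in> S" "j \<in> S"
  shows "(\<lambda>t. bracket (normal_config e t i) (normal_config e t j)) \<in> borel_measurable (coord_measure e)"
proof -
  have 1: "(\<lambda>t. fst (homog (normal_config e t k))) \<in> borel_measurable (coord_measure e)" if "k \<in> S" for k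
    using that enum_ofD(2)[OF assms(1)]
    by (cases "k = e ! 0"; cases "k = e ! 1"; cases "k = e ! 2") (auto simp: normal_config_def)
  have "snd (homog (normal_config e t k)) = (if k = e ! 0 \<or> k = e ! 1 \<or> k \<noteq> e ! 2 then 1 else 0)" for t k
    by (simp add: normal_config_def)
  then have 2: "(\<lambda>t. snd (homog (normal_config e t k))) \<in> borel_measurable (coord_measure e)" for k
    by simp
  show ?thesis
    unfolding bracket_def using assms by (intro borel_measurable_diff borel_measurable_times 1 2) auto
qed

lemma cross_ratio_measurable:
  assumes "enum_of S e" "T \<subseteq> S" "{i, j, k, l} \<subseteq> T"
  shows "(\<lambda>t. cross_ratio i j k l (forget T (param e t))) \<in> borel_measurable (coord_measure e)"
proof -
  have S: "set e = S"
    using assms(1) by (simp add: enum_of_def)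
  have mem: "i \<in> S" "j \<in> S" "k \<in> S" "l \<in> S"
    using assms by auto
  show ?thesis
    unfolding param_normal_config S forget_orbit[OF assms(2)] cross_ratio_orbit[OF assms(3)]
    by (intro borel_measurable_divide borel_measurable_times bracket_measurable[OF assms(1)] mem)
qed

lemma tmap_measurable:
  assumes "enum_of S e" "enum_of T e'" "T \<subseteq> S"
  shows "(\<lambda>t. tmap e' (forget T (param e t))) \<in> measurable (coord_measure e) (coord_measure e')"
proof -
  have "(\<lambda>t. tcoord e' i (forget T (param e t))) \<in> borel_measurable (coord_measure e)"
    if "i \<in> set (coords e')" for i
    unfolding tcoord_def using that enum_ofD(2)[OF assms(2)] by (intro cross_ratio_measurable[OF assms(1,3)]) auto
  then show ?thesis
    unfolding tmap_def by (intro measurable_restrict) simp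
qed

lemma forget_param:
  assumes "enum_of S e"
  shows "forget S (param e t) = param e t"
  using assms by (auto simp: param_normal_config enum_of_def forget_orbit)

text \<open>A regular function may be arbitrary off \<open>moduli S\<close>, so measurability can be
  expected only after multiplication with the indicator of the chart.\<close>

lemma regular_fun_measurable:
  assumes "regular_fun S h" "enum_of S e"
  shows "(\<lambda>t. h (param e t) * indicator (chart e) t) \<in> borel_measurable (coord_measure e)"
  using assms(1)
proof induction
  case (const c)
  show ?case
    by (intro borel_measurable_times borel_measurable_indicator borel_measurable_const
        chart_measurable[OF assms(2)])
next
    case (cross_ratio i j k l)
    show ?case
      using cross_ratio_measurable[OF assms(2) subset_refl cross_ratio(1)]
      by (intro borel_measurable_times borel_measurable_indicator chart_measurable[OF assms(2)])
        (simp add: forget_param[OF assms(2)])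
  next
    case (add g h)
    then show ?case
      using borel_measurable_add[OF add.IH] by (simp add: distrib_right)
  next
    case (mult g h)
    have "(\<lambda>t. g (param e t) * h (param e t) * indicator (chart e) t) =
      (\<lambda>t. (g (param e t) * indicator (chart e) t) * (h (param e t) * indicator (chart e) t))"
      by (auto simp: indicator_def)
    then show ?case
      using borel_measurable_times[OF mult.IH] by simp
  next
    case (cong g h)
    have "(\<lambda>t. h (param e t) * indicator (chart e) t) = (\<lambda>t. g (param e t) * indicator (chart e) t)"
      using cong.hyps param_in_moduli[OF assms(2)] by (auto simp: indicator_def)
    then show ?case
      using cong.IH by simp
qed

text \<open>The partial derivative is the limit of the difference quotients with increments \<open>1 / n\<close>.\<close>

lemma coord_vector_measurable:
  assumes "regular_fun S h" "enum_of S e" "i \<in> set (coords e)"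
  shows "(\<lambda>t. coord_vector e t i h * indicator (chart e) t) \<in> borel_measurable (coord_measure e)"
proof -
  note [measurable] = chart_measurable[OF assms(2)]
  \<comment> \<open>Cutting off by the chart makes \<open>H\<close> measurable everywhere; its
    difference quotients agree with those of \<open>h\<close> once the increment is small enough to
    stay in the chart.\<close>
  define H where "H t = h (param e t) * indicator (chart e) t" for t
  have [measurable]: "H \<in> borel_measurable (coord_measure e)"
    using regular_fun_measurable[OF assms(1,2)] unfolding H_def .
  define u where "u n t = t(i := t i + 1 / real (Suc n))" for n and t :: "'a \<Rightarrow> real"
  have [measurable]: "u n \<in> measurable (coord_measure e) (coord_measure e)" for n
    unfolding u_def using assms(3)
    by (intro measurable_fun_upd[where J = "set (coords e)"]) auto
  define f where "f n t = (H (u n t) - H t) * real (Suc n) * indicator (chart e) t" for n t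
  have "f n \<in> borel_measurable (coord_measure e)" for n
    unfolding f_def by measurable
  moreover have "(\<lambda>n. f n t) \<longlonglongrightarrow> coord_vector e t i h * indicator (chart e) t"
    if t: "t \<in> space (coord_measure e)" for t
  proof (cases "t \<in> chart e")
    case True
    note p = param_in_moduli[OF assms(2) True]
    have lim: "(\<lambda>n. 1 / real (Suc n)) \<longlonglongrightarrow> 0"
      using LIMSEQ_inverse_real_of_nat by (simp add: inverse_eq_divide)
    have "filterlim (\<lambda>n. 1 / real (Suc n)) (at 0) sequentially"
      unfolding filterlim_at using lim by auto
    then have 1: "(\<lambda>n. (h (param e (u n t)) - h (param e (t(i := t i)))) / (1 / real (Suc n)))
        \<longlonglongrightarrow> coord_vector e t i h"
      using filterlim_compose coord_vector_deriv[OF assms p, unfolded DERIV_def]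
      unfolding u_def by fast
    have "(\<lambda>n. t i + 1 / real (Suc n)) \<longlonglongrightarrow> t i + 0"
      by (intro tendsto_add tendsto_const lim)
    then have "\<forall>\<^sub>F n in sequentially. param e (u n t) \<in> moduli S"
      using eventually_compose_filterlim[OF eventually_param_in_moduli[OF assms(2,3) p]]
      by (simp add: u_def)
    then have "\<forall>\<^sub>F n in sequentially.
      (h (param e (u n t)) - h (param e (t(i := t i)))) / (1 / real (Suc n)) = f n t"
    proof (rule eventually_mono)
      fix n assume "param e (u n t) \<in> moduli S"
      moreover have "u n t \<in> space (coord_measure e)"
        using t assms(3) by (auto simp: u_def space_PiM PiE_def extensional_def)
      ultimately have "u n t \<in> chart e"
        using assms(2) by (simp add: chart_def coord_region_def enum_of_def)
      then show "(h (param e (u n t)) - h (param e (t(i := t i)))) / (1 / real (Suc n)) = f n t"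
        using True by (simp add: f_def H_def)
    qed
    with 1 True show ?thesis
      by (simp add: tendsto_cong)
  qed (simp add: f_def)
  ultimately show ?thesis
    by (rule borel_measurable_LIMSEQ_real[rotated])
qed

lemma tdet_measurable:
  assumes "enum_of S e" "\<And>h. h \<in> set hs \<Longrightarrow> regular_fun S h" "length hs = length (coords e)"
  shows "(\<lambda>t. tdet (map (coord_vector e t) (coords e)) hs * indicator (chart e) t)
    \<in> borel_measurable (coord_measure e)"
proof -
  note [measurable] = chart_measurable[OF assms(1)]
  let ?n = "length (coords e)"
  \<comment> \<open>Every entry carries the indicator, without which it need not be measurable. The
    product is empty if there are no free points, hence the further indicator on the whole sum
    below.\<close>
  let ?f = "\<lambda>t. \<Sum>\<sigma> | \<sigma> permutes {..<?n}. of_int (sign \<sigma>) *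
     (\<Prod>j<?n. coord_vector e t (coords e ! \<sigma> j) (hs ! j) * indicator (chart e) t)"
  have "?f \<in> borel_measurable (coord_measure e)"
  proof (rule borel_measurable_sum, rule borel_measurable_times[OF borel_measurable_const],
      rule borel_measurable_prod)
    fix \<sigma> j assume "\<sigma> \<in> {\<sigma>. \<sigma> permutes {..<?n}}" "j \<in> {..<?n}"
    then have "\<sigma> j < ?n" "j < ?n"
      using permutes_lessThan by auto
    then show "(\<lambda>t. coord_vector e t (coords e ! \<sigma> j) (hs ! j) * indicator (chart e) t)
        \<in> borel_measurable (coord_measure e)"
      using assms(3) nth_mem[of "\<sigma> j" "coords e"]
      by (intro coord_vector_measurable[OF assms(2,1)]) auto
  qed
  then have "(\<lambda>t. ?f t * indicator (chart e) t) \<in> borel_measurable (coord_measure e)"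
    by measurable
  also have "(\<lambda>t. ?f t * indicator (chart e) t) =
    (\<lambda>t. tdet (map (coord_vector e t) (coords e)) hs * indicator (chart e) t)"
  proof
    fix t
    show "?f t * indicator (chart e) t = tdet (map (coord_vector e t) (coords e)) hs * indicator (chart e) t"
    proof (cases "t \<in> chart e")
      case True
      have "?f t = tdet (map (coord_vector e t) (coords e)) hs"
        unfolding tdet_alt using True permutes_lessThan
        by (intro sum.cong prod.cong arg_cong2[where f = "(*)"]) (auto simp: permutes_lessThan)
      then show ?thesis by simp
    qed simp
  qed
  finally show ?thesis .
qed

lemma coefficient_measurable:
  assumes "volume_form S \<omega>" "enum_of S e"
  shows "(\<lambda>t. coefficient e \<omega> t * indicator (chart e) t) \<in> borel_measurable (coord_measure e)"
proof -
  obtain F where F: "\<And>g hs. (g, hs) \<in> set F \<Longrightarrow>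
      regular_fun S g \<and> length hs = card S - 3 \<and> (\<forall>h\<in>set hs. regular_fun S h)"
    and eq: "\<And>x vs. x \<in> moduli S \<Longrightarrow> length vs = card S - 3 \<Longrightarrow>
      (\<And>v. v \<in> set vs \<Longrightarrow> tangent_vector S x v) \<Longrightarrow> \<omega> x vs = (\<Sum>(g, hs)\<leftarrow>F. g x * tdet vs hs)"
    using volume_form_expansion[OF assms(1)] by blast
  let ?cv = "\<lambda>t. map (coord_vector e t) (coords e)"
  have "coefficient e \<omega> t * indicator (chart e) t = (\<Sum>(g, hs)\<leftarrow>F.
    (g (param e t) * indicator (chart e) t) * (tdet (?cv t) hs * indicator (chart e) t))" for t
  proof (cases "t \<in> chart e")
    case True
    note p = param_in_moduli[OF assms(2) True]
    have "coefficient e \<omega> t = (\<Sum>(g, hs)\<leftarrow>F. g (param e t) * tdet (?cv t) hs)"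
      unfolding coefficient_def using length_coords[OF assms(2)] tangent_coord_vector[OF assms(2) _ p]
      by (intro eq[OF p]) auto
    then show ?thesis
      using True by simp
  next
    case False
    then show ?thesis
      by (induction F) auto
  qed
  moreover have "(\<lambda>t. \<Sum>(g, hs)\<leftarrow>G. (g (param e t) * indicator (chart e) t) *
      (tdet (?cv t) hs * indicator (chart e) t)) \<in> borel_measurable (coord_measure e)"
    if "set G \<subseteq> set F" for G
    using that
  proof (induction G)
    case (Cons p G)
    obtain g hs where p: "p = (g, hs)"
      by (cases p)
    then have "regular_fun S g" "length hs = length (coords e)" "\<And>h. h \<in> set hs \<Longrightarrow> regular_fun S h"
      using F[of g hs] Cons.prems length_coords[OF assms(2)] by auto
    then show ?case
      using Cons p regular_fun_measurable[OF _ assms(2)] tdet_measurable[OF assms(2)] by simp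
  qed simp
  ultimately show ?thesis
    by simp
qed

section \<open>Changes of coordinates\<close>

definition jacobian_of :: "'a list \<Rightarrow> ('a mpoint \<Rightarrow> real) list \<Rightarrow> ('a \<Rightarrow> real) \<Rightarrow> real" where
  "jacobian_of e hs t = tdet (map (coord_vector e t) (coords e)) hs"

definition regular_list :: "'a set \<Rightarrow> ('a mpoint \<Rightarrow> real) list \<Rightarrow> bool" where
  "regular_list S hs \<longleftrightarrow> length hs = card S - 3 \<and> (\<forall>h\<in>set hs. regular_fun S h)"

text \<open>The density G |dh_1 wedge ... wedge dh_d| written in the chart \<open>e\<close>; as an
  object on the moduli space it does not depend on \<open>e\<close>.\<close>

definition integrand :: "'a list \<Rightarrow> ('a mpoint \<Rightarrow> real) list \<Rightarrow> ('a mpoint \<Rightarrow> ennreal) \<Rightarrow> ('a \<Rightarrow> real) \<Rightarrow> ennreal" where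
  "integrand e hs G t = G (param e t) * (ennreal \<bar>jacobian_of e hs t\<bar> * indicator (chart e) t)"

abbreviation enum_jacobian :: "'a list \<Rightarrow> 'a list \<Rightarrow> ('a \<Rightarrow> real) \<Rightarrow> real" where
  "enum_jacobian e e' \<equiv> jacobian_of e (map (tcoord e') (coords e'))"

text \<open>The change of variables formula from the chart of \<open>e'\<close> to that of
  \<open>e\<close>. Quantifying over all nonnegative measurable integrands makes the relation
  transitive and admits indicators as test functions.\<close>

definition change_of_enum :: "'a list \<Rightarrow> 'a list \<Rightarrow> bool" where
  "change_of_enum e e' \<longleftrightarrow> (\<forall>F\<in>borel_measurable (coord_measure e').
     (\<integral>\<^sup>+ t. F t * indicator (chart e') t \<partial>coord_measure e') =
     (\<integral>\<^sup>+ t. F (tmap e' (param e t)) * (ennreal \<bar>enum_jacobian e e' t\<bar> * indicator (chart e) t) \<partial>coord_measure e))"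

lemma regular_list_tcoord: "enum_of S e \<Longrightarrow> regular_list S (map (tcoord e) (coords e))"
  using length_coords[of S e] by (auto simp: regular_list_def intro: regular_fun_tcoord)

lemma jacobian_measurable:
  assumes "enum_of S e" "regular_list S hs"
  shows "(\<lambda>t. jacobian_of e hs t * indicator (chart e) t) \<in> borel_measurable (coord_measure e)"
  unfolding jacobian_of_def using assms(2) length_coords[OF assms(1)]
  by (intro tdet_measurable[OF assms(1)]) (auto simp: regular_list_def)

lemma abs_jacobian_measurable:
  assumes "enum_of S e" "regular_list S hs"
  shows "(\<lambda>t. ennreal \<bar>jacobian_of e hs t\<bar> * indicator (chart e) t) \<in> borel_measurable (coord_measure e)"
proof -
  have "(\<lambda>t. ennreal \<bar>jacobian_of e hs t * indicator (chart e) t\<bar>) \<in> borel_measurable (coord_measure e)"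
    using jacobian_measurable[OF assms] by measurable
  also have "(\<lambda>t. ennreal \<bar>jacobian_of e hs t * indicator (chart e) t\<bar>) =
    (\<lambda>t. ennreal \<bar>jacobian_of e hs t\<bar> * indicator (chart e) t)"
    by (auto simp: indicator_def)
  finally show ?thesis .
qed

lemma tmap_param_measurable:
  assumes "enum_of S e" "enum_of S e'"
  shows "(\<lambda>t. tmap e' (param e t)) \<in> measurable (coord_measure e) (coord_measure e')"
  using tmap_measurable[OF assms subset_refl] by (simp add: forget_param[OF assms(1)])

lemma jacobian_chain:
  assumes e: "enum_of S e" "enum_of S e'" and hs: "regular_list S hs" and t: "t \<in> chart e"
  shows "jacobian_of e hs t = enum_jacobian e e' t * jacobian_of e' hs (tmap e' (param e t))"
proof -
  note x = param_in_moduli[OF e(1) t]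
  show ?thesis
    unfolding jacobian_of_def
    using x param_tmap[OF e(2) x] length_coords[OF e(1)] length_coords[OF e(2)] hs
    by (intro tdet_chain[OF e(2)]) (auto simp: regular_list_def intro: tangent_coord_vector[OF e(1)])
qed

text \<open>The Jacobian of the transition map times the Jacobian of \<open>hs\<close> in the chart
  \<open>e'\<close> is the Jacobian of \<open>hs\<close> in the chart \<open>e\<close>, by
  \<open>jacobian_chain\<close>.\<close>

lemma nn_integral_change_of_enum:
  assumes e: "enum_of S e" "enum_of S e'" and ch: "change_of_enum e e'" and hs: "regular_list S hs"
    and G: "integrand e' hs G \<in> borel_measurable (coord_measure e')"
  shows "(\<integral>\<^sup>+ t. integrand e' hs G t \<partial>coord_measure e') = (\<integral>\<^sup>+ t. integrand e hs G t \<partial>coord_measure e)"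
proof -
  have "(\<integral>\<^sup>+ t. integrand e' hs G t \<partial>coord_measure e') =
    (\<integral>\<^sup>+ t. integrand e' hs G t * indicator (chart e') t \<partial>coord_measure e')"
    by (intro nn_integral_cong) (auto simp: integrand_def indicator_def)
  also have "\<dots> = (\<integral>\<^sup>+ t. integrand e' hs G (tmap e' (param e t)) *
      (ennreal \<bar>enum_jacobian e e' t\<bar> * indicator (chart e) t) \<partial>coord_measure e)"
    using ch G by (simp add: change_of_enum_def)
  also have "\<dots> = (\<integral>\<^sup>+ t. integrand e hs G t \<partial>coord_measure e)"
  proof (rule nn_integral_cong)
    fix t
    show "integrand e' hs G (tmap e' (param e t)) *
      (ennreal \<bar>enum_jacobian e e' t\<bar> * indicator (chart e) t) = integrand e hs G t"
    proof (cases "t \<in> chart e")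
      case True
      note x = param_in_moduli[OF e(1) True]
      show ?thesis
        using True tmap_in_chart[OF e(2) x] param_tmap[OF e(2) x] jacobian_chain[OF e hs True]
        by (simp add: integrand_def abs_mult ennreal_mult mult_ac)
    qed (simp add: integrand_def)
  qed
  finally show ?thesis .
qed

text \<open>Take the coordinates of the last enumeration as \<open>hs\<close>: the rule for the
  second step turns the integral into one of a density in the chart \<open>e'\<close>, which the
  first step carries to \<open>e\<close>.\<close>

lemma change_of_enum_trans:
  assumes e: "enum_of S e" "enum_of S e'" "enum_of S e''"
    and 1: "change_of_enum e e'" and 2: "change_of_enum e' e''"
  shows "change_of_enum e e''"
  unfolding change_of_enum_def
proof
  fix F :: "('a \<Rightarrow> real) \<Rightarrow> ennreal" assume F: "F \<in> borel_measurable (coord_measure e'')"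
  note hs = regular_list_tcoord[OF e(3)]
  let ?I = "\<lambda>e. integrand e (map (tcoord e'') (coords e'')) (\<lambda>x. F (tmap e'' x))"
  have "?I e' \<in> borel_measurable (coord_measure e')"
    unfolding integrand_def[abs_def]
    by (intro borel_measurable_times_ennreal abs_jacobian_measurable[OF e(2) hs]
        measurable_compose[OF tmap_param_measurable[OF e(2,3)] F])
  then have "(\<integral>\<^sup>+ t. ?I e' t \<partial>coord_measure e') = (\<integral>\<^sup>+ t. ?I e t \<partial>coord_measure e)"
    by (rule nn_integral_change_of_enum[OF e(1,2) 1 hs])
  then show "(\<integral>\<^sup>+ t. F t * indicator (chart e'') t \<partial>coord_measure e'') =
      (\<integral>\<^sup>+ t. F (tmap e'' (param e t)) * (ennreal \<bar>enum_jacobian e e'' t\<bar> * indicator (chart e) t) \<partial>coord_measure e)"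
    using 2 F by (simp add: change_of_enum_def integrand_def)
qed

lemma nth_first_three: "([a, b, c] @ r) ! 0 = a" "([a, b, c] @ r) ! 1 = b" "([a, b, c] @ r) ! 2 = c"
  by simp_all

text \<open>With the fixed triple unchanged, the charts coincide and the transition map is the
  identity; only the order of the coordinate functions differs, so the Jacobian is 1 or -1.\<close>

lemma change_of_enum_rest:
  assumes e: "enum_of S ([a, b, c] @ r)" "enum_of S ([a, b, c] @ r')" and r: "mset r = mset r'"
  shows "change_of_enum ([a, b, c] @ r) ([a, b, c] @ r')"
proof -
  let ?e = "[a, b, c] @ r" and ?e' = "[a, b, c] @ r'"
  have set: "set r' = set r"
    using r mset_eq_setD by metis
  have tc: "tcoord ?e' = tcoord ?e"
    by (simp only: tcoord_def[abs_def] nth_first_three)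
  have pm: "param ?e' = param ?e"
    by (simp only: param_def[abs_def] nth_first_three set_append set)
  have ch: "chart ?e' = chart ?e"
    unfolding chart_def coord_region_def pm by (simp add: set del: append.simps)
  have tm: "tmap ?e' (param ?e t) = t" if "t \<in> chart ?e" for t
  proof -
    have "tmap ?e' = tmap ?e"
      by (simp add: tmap_def[abs_def] tc set del: append.simps)
    then show ?thesis
      using tmap_param[OF e(1), of t] chart_in_space[OF that] by (simp add: space_PiM PiE_def)
  qed
  have jac: "\<bar>enum_jacobian ?e ?e' t\<bar> = 1" for t
  proof -
    have "distinct r"
      using e(1) by (simp add: enum_of_def)
    have "\<bar>enum_jacobian ?e ?e' t\<bar> = \<bar>tdet (map (coord_vector ?e t) r) (map (tcoord ?e) r')\<bar>"
      unfolding jacobian_of_def tc by simp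
    also have "\<dots> = \<bar>tdet (map (coord_vector ?e t) r) (map (tcoord ?e) r)\<bar>"
      using r mset_eq_length[OF r] by (intro abs_tdet_mset) auto
    also have "tdet (map (coord_vector ?e t) r) (map (tcoord ?e) r) = (\<Prod>i\<in>set r. 1)"
      using coord_vector_tcoord[OF e(1)] by (intro tdet_diagonal[OF \<open>distinct r\<close>]) simp
    finally show ?thesis by simp
  qed
  have cm: "coord_measure ?e' = coord_measure ?e"
    by (simp add: set)
  show ?thesis
    unfolding change_of_enum_def ch cm jac
  proof (intro ballI nn_integral_cong)
    fix F :: "('a \<Rightarrow> real) \<Rightarrow> ennreal" and t
    show "F t * indicator (chart ?e) t = F (tmap ?e' (param ?e t)) * (ennreal 1 * indicator (chart ?e) t)"
      by (cases "t \<in> chart ?e") (simp_all only: tm indicator_simps, simp_all)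
  qed
qed

text \<open>When the same Moebius map acts in every coordinate, the Jacobian is diagonal. The
  hypotheses on \<open>g\<close> say in effect that it permutes 0, 1 and infinity, so the chart
  conditions are preserved.\<close>

lemma change_of_enum_moebius:
  fixes p q u v :: real
  defines "g \<equiv> \<lambda>s. (p * s + q) / (u * s + v)"
  assumes e: "enum_of S e" "enum_of S e'" "coords e' = coords e"
    and det: "p * v - q * u \<noteq> 0"
    and tc: "\<And>t j. j \<in> set (coords e) \<Longrightarrow> tcoord e' j (param e t) = g (t j)"
    and pole: "\<And>y. y \<noteq> 0 \<Longrightarrow> y \<noteq> 1 \<Longrightarrow> u * y + v \<noteq> 0"
    and g01: "\<And>y. g y \<noteq> 0 \<and> g y \<noteq> 1 \<longleftrightarrow> y \<noteq> 0 \<and> y \<noteq> 1"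
  shows "change_of_enum e e'"
  unfolding change_of_enum_def
proof
  let ?r = "coords e"
  let ?g' = "\<lambda>s. (p * v - q * u) / (u * s + v)^2"
  fix F :: "('a \<Rightarrow> real) \<Rightarrow> ennreal" assume F: "F \<in> borel_measurable (coord_measure e')"
  have dist: "distinct ?r"
    using e(1) by (simp add: enum_of_def)
  have inj: "y = z" if "g y = g z" "y \<noteq> 0" "y \<noteq> 1" "z \<noteq> 0" "z \<noteq> 1" for y z
  proof -
    have "(p * y + q) * (u * z + v) = (p * z + q) * (u * y + v)"
      using that pole[of y] pole[of z] by (simp add: g_def frac_eq_eq)
    then have "(p * v - q * u) * (y - z) = 0"
      by (simp add: algebra_simps)
    with det show ?thesis
      by simp
  qed
  have ch: "(\<lambda>i\<in>set ?r. g (t i)) \<in> chart e' \<longleftrightarrow> t \<in> chart e" if "t \<in> space (coord_measure e)" for t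
  proof -
    have "inj_on (\<lambda>i\<in>set ?r. g (t i)) (set ?r) \<longleftrightarrow> inj_on t (set ?r)"
      if "\<forall>i\<in>set ?r. t i \<noteq> 0 \<and> t i \<noteq> 1"
      using that inj unfolding inj_on_def by simp metis
    then show ?thesis
      using that g01 by (auto simp: chart_iff[OF e(1)] chart_iff[OF e(2)] e(3) space_PiM)
  qed
  have jac: "enum_jacobian e e' t = (\<Prod>i\<in>set ?r. ?g' (t i))" if t: "t \<in> chart e" for t
  proof -
    have cv: "coord_vector e t i (tcoord e' j) = (if i = j then ?g' (t i) else 0)"
      if "i \<in> set ?r" "j \<in> set ?r" for i j
    proof (rule coord_vector_eqI)
      have "u * t i + v \<noteq> 0"
        using t that pole by (auto simp: chart_iff[OF e(1)])
      then have "(g has_real_derivative (p * (u * t i + v) - (p * t i + q) * u) / (u * t i + v)\<^sup>2) (at (t i))"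
        unfolding g_def by (auto intro!: derivative_eq_intros simp: power2_eq_square)
      then have "(g has_real_derivative ?g' (t i)) (at (t i))"
        by (simp add: algebra_simps)
      then show "((\<lambda>s. tcoord e' j (param e (t(i := s)))) has_real_derivative (if i = j then ?g' (t i) else 0)) (at (t i))"
        using that by (cases "i = j") (simp_all add: tc)
    qed
    show ?thesis
      unfolding jacobian_of_def e(3) by (rule tdet_diagonal[OF dist]) (rule cv)
  qed
  note [measurable] = F[unfolded e(3)] chart_measurable[OF e(2), unfolded e(3)]
  have "(\<integral>\<^sup>+ t. F t * indicator (chart e') t \<partial>coord_measure e') =
    (\<integral>\<^sup>+ t. F (\<lambda>i\<in>set ?r. g (t i)) * indicator (chart e') (\<lambda>i\<in>set ?r. g (t i)) *
      ennreal \<bar>\<Prod>i\<in>set ?r. ?g' (t i)\<bar> \<partial>coord_measure e)"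
    unfolding g_def e(3) by (rule moebius_substitution_PiM[OF det]) (simp, measurable)
  also have "\<dots> = (\<integral>\<^sup>+ t. F (tmap e' (param e t)) *
      (ennreal \<bar>enum_jacobian e e' t\<bar> * indicator (chart e) t) \<partial>coord_measure e)"
  proof (rule nn_integral_cong)
    fix t assume t: "t \<in> space (coord_measure e)"
    have "tmap e' (param e t) = (\<lambda>i\<in>set ?r. g (t i))"
      by (auto simp: tmap_def e(3) tc)
    then show "F (\<lambda>i\<in>set ?r. g (t i)) * indicator (chart e') (\<lambda>i\<in>set ?r. g (t i)) *
      ennreal \<bar>\<Prod>i\<in>set ?r. ?g' (t i)\<bar> =
      F (tmap e' (param e t)) * (ennreal \<bar>enum_jacobian e e' t\<bar> * indicator (chart e) t)"
      using ch[OF t] by (auto simp: indicator_def jac)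
  qed
  finally show "(\<integral>\<^sup>+ t. F t * indicator (chart e') t \<partial>coord_measure e') = \<dots>" .
qed

lemma normal_config_append:
  assumes "distinct ([a, b, c] @ r)"
  shows "normal_config ([a, b, c] @ r) t a = Some 0" "normal_config ([a, b, c] @ r) t b = Some 1"
    "normal_config ([a, b, c] @ r) t c = None"
    "j \<in> set r \<Longrightarrow> normal_config ([a, b, c] @ r) t j = Some (t j)"
  unfolding normal_config_def nth_first_three using assms by auto

lemma tcoord_param_append:
  assumes "enum_of S ([a, b, c] @ r)" "{i, a', b', c'} \<subseteq> S"
  shows "tcoord ([a', b', c'] @ r') i (param ([a, b, c] @ r) t) =
    (let p = normal_config ([a, b, c] @ r) t in
      bracket (p i) (p a') * bracket (p b') (p c') / (bracket (p i) (p c') * bracket (p b') (p a')))"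
  unfolding tcoord_def param_normal_config nth_first_three Let_def
  by (rule cross_ratio_orbit) (use assms in \<open>auto simp: enum_of_def\<close>)

text \<open>The map fixing infinity and exchanging 0 and 1 is t to 1 - t.\<close>

lemma change_of_enum_swap_01:
  assumes e: "enum_of S ([a, b, c] @ r)"
  shows "change_of_enum ([a, b, c] @ r) ([b, a, c] @ r)"
proof -
  have e': "enum_of S ([b, a, c] @ r)"
    using e by (auto simp: enum_of_def)
  have dist: "distinct ([a, b, c] @ r)"
    using e by (simp add: enum_of_def)
  have "tcoord ([b, a, c] @ r) j (param ([a, b, c] @ r) t) = (- 1 * t j + 1) / (0 * t j + 1)"
    if "j \<in> set r" for t j
  proof -
    have "{j, b, a, c} \<subseteq> S"
      using e that by (auto simp: enum_of_def)
    then show ?thesis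
      using that by (simp only: tcoord_param_append[OF e] Let_def normal_config_append[OF dist]) simp
  qed
  then show ?thesis
    by (intro change_of_enum_moebius[where p = "-1" and q = 1 and u = 0 and v = 1, OF e e']) auto
qed

text \<open>The map fixing 0 and exchanging 1 and infinity is t to t / (t - 1).\<close>

lemma change_of_enum_swap_12:
  assumes e: "enum_of S ([a, b, c] @ r)"
  shows "change_of_enum ([a, b, c] @ r) ([a, c, b] @ r)"
proof -
  have e': "enum_of S ([a, c, b] @ r)"
    using e by (auto simp: enum_of_def)
  have dist: "distinct ([a, b, c] @ r)"
    using e by (simp add: enum_of_def)
  have tc: "tcoord ([a, c, b] @ r) j (param ([a, b, c] @ r) t) = (1 * t j + 0) / (1 * t j + - 1)"
    if "j \<in> set r" for t j
  proof -
    have "{j, a, c, b} \<subseteq> S"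
      using e that by (auto simp: enum_of_def)
    then show ?thesis
      using that by (simp only: tcoord_param_append[OF e] Let_def normal_config_append[OF dist]) simp
  qed
  \<comment> \<open>At the pole \<open>y = 1\<close> the quotient is 0 by convention, so both sides
    fail there.\<close>
  have g01: "(1 * y + 0) / (1 * y + - 1) \<noteq> 0 \<and> (1 * y + 0) / (1 * y + - 1) \<noteq> 1 \<longleftrightarrow> y \<noteq> 0 \<and> y \<noteq> 1"
    for y :: real
    by (cases "y = 1") (auto simp: divide_eq_eq)
  show ?thesis
    by (rule change_of_enum_moebius[where p = 1 and q = 0 and u = 1 and v = "-1", OF e e' _ _ _ _ g01])
      (use tc in auto)
qed

text \<open>Exchanging the point at infinity with the first free point is triangular: the new first
  coordinate is \<open>1 - x\<close>, and for fixed \<open>x\<close> the others undergo the map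
  \<open>y \<mapsto> y (1 - x) / (y - x)\<close>.\<close>

lemma change_of_enum_swap_23:
  assumes e: "enum_of S ([a, b, c] @ d # r)"
  shows "change_of_enum ([a, b, c] @ d # r) ([a, b, d] @ c # r)"
  unfolding change_of_enum_def
proof
  let ?e = "[a, b, c] @ d # r" and ?e' = "[a, b, d] @ c # r"
  have e': "enum_of S ?e'"
    using e by (auto simp: enum_of_def)
  have dist: "distinct ?e"
    using e by (simp add: enum_of_def)
  then have dcr: "d \<notin> set r" "c \<notin> set r" "distinct r" "c \<noteq> d"
    by auto
  \<comment> \<open>For fixed \<open>x\<close> this is the Moebius map fixing 0 and 1 and sending
    \<open>x\<close> to infinity; infinity goes to \<open>1 - x\<close>, the new coordinate of
    \<open>c\<close>. Its determinant is \<open>- x * (1 - x)\<close>.\<close>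
  define g where "g x y = ((1 - x) * y + 0) / (1 * y + - x)" for x y :: real
  define g' where "g' x y = ((1 - x) * (- x) - 0 * 1) / (1 * y + - x)^2" for x y :: real
  have tc: "tcoord ?e' j (param ?e t) = g (t d) (t j)" if "j \<in> set r" for t j
  proof -
    have "{j, a, b, d} \<subseteq> S"
      using e that by (auto simp: enum_of_def)
    then show ?thesis
      using that
      by (simp only: tcoord_param_append[OF e] Let_def normal_config_append(1-3)[OF dist]
          normal_config_append(4)[OF dist, OF list.set_intros(1)]
          normal_config_append(4)[OF dist, OF list.set_intros(2)]) (simp add: g_def mult.commute)
  qed
  have tc_c: "tcoord ?e' c (param ?e t) = 1 - t d" for t
  proof -
    have "{c, a, b, d} \<subseteq> S"
      using e by (auto simp: enum_of_def)
    then show ?thesis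
      by (simp only: tcoord_param_append[OF e] Let_def normal_config_append(1-3)[OF dist]
          normal_config_append(4)[OF dist, OF list.set_intros(1)]) simp
  qed
  \<comment> \<open>The value \<open>1 - x\<close> is attained only at infinity, and at the pole
    \<open>y = x\<close> the quotient is 0 by convention, so the excluded values correspond.\<close>
  have g01: "g x y \<noteq> 0 \<and> g x y \<noteq> 1 \<and> g x y \<noteq> 1 - x \<longleftrightarrow> y \<noteq> 0 \<and> y \<noteq> 1 \<and> y \<noteq> x"
    if "x \<noteq> 0" "x \<noteq> 1" for x y
  proof (cases "y = x")
    case False
    then have eq: "g x y = k \<longleftrightarrow> (1 - x) * y = k * (y - x)" for k
      by (simp add: g_def divide_eq_eq)
    have "(1 - x) * y = 1 * (y - x) \<longleftrightarrow> x * (y - 1) = 0"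
      by (auto simp: algebra_simps)
    then show ?thesis
      unfolding eq using that False by auto
  qed (simp add: g_def)
  have inj: "y = z" if "g x y = g x z" "x \<noteq> 0" "x \<noteq> 1" "y \<noteq> x" "z \<noteq> x" for x y z
  proof -
    have "(1 - x) * y * (z - x) = (1 - x) * z * (y - x)"
      using that by (simp add: g_def frac_eq_eq)
    then have "(1 - x) * x * (y - z) = 0"
      by (simp add: algebra_simps)
    with that show ?thesis
      by simp
  qed
  have ch: "(\<lambda>i\<in>set r. g x (t i))(c := 1 - x) \<in> chart ?e' \<longleftrightarrow> t(d := x) \<in> chart ?e"
    if t: "t \<in> space (\<Pi>\<^sub>M i\<in>set r. lborel)" and x: "x \<noteq> 0" "x \<noteq> 1" for t x
  proof -
    have sp: "(\<lambda>i\<in>set r. g x (t i))(c := 1 - x) \<in> space (coord_measure ?e')"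
      "t(d := x) \<in> space (coord_measure ?e)"
      using t by (auto simp: space_PiM PiE_def extensional_def)
    have "inj_on (\<lambda>i. g x (t i)) (set r) \<longleftrightarrow> inj_on t (set r)" if "\<forall>i\<in>set r. t i \<noteq> x"
      using that inj[OF _ x] unfolding inj_on_def by metis
    moreover have "inj_on ((\<lambda>i\<in>set r. g x (t i))(c := 1 - x)) (insert c (set r)) \<longleftrightarrow>
      inj_on (\<lambda>i. g x (t i)) (set r) \<and> (\<forall>i\<in>set r. g x (t i) \<noteq> 1 - x)"
      using dcr(2) by (auto simp: inj_on_def)
    moreover have "inj_on (t(d := x)) (insert d (set r)) \<longleftrightarrow> inj_on t (set r) \<and> (\<forall>i\<in>set r. t i \<noteq> x)"
      using dcr(1) by (auto simp: inj_on_def)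
    moreover have "\<forall>i\<in>set r. (g x (t i) \<noteq> 0 \<and> g x (t i) \<noteq> 1 \<and> g x (t i) \<noteq> 1 - x \<longleftrightarrow>
        t i \<noteq> 0 \<and> t i \<noteq> 1 \<and> t i \<noteq> x)"
      using g01[OF x] by blast
    ultimately show ?thesis
      using sp x dcr unfolding chart_iff[OF e] chart_iff[OF e']
      by simp (smt (verit))
  qed
  have jac: "\<bar>enum_jacobian ?e ?e' t\<bar> = \<bar>\<Prod>i\<in>set r. g' (t d) (t i)\<bar>" if t: "t \<in> chart ?e" for t
  proof -
    have ne: "t i \<noteq> t d" if "i \<in> set r" for i
    proof -
      have "inj_on t (insert d (set r))"
        using t unfolding chart_iff[OF e] by simp
      then show ?thesis
        using that dcr(1) by (metis inj_onD insertI1 insertI2)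
    qed
    \<comment> \<open>The new coordinate of \<open>c\<close> depends on \<open>d\<close> alone.
      These zeros make the Jacobian triangular, and the entry -1 disappears in the absolute
      value.\<close>
    have cv1: "coord_vector ?e t i (tcoord ?e' c) = (if i = d then - 1 else 0)" for i
      by (rule coord_vector_eqI) (auto simp: tc_c[simplified] intro!: derivative_eq_intros)
    have cv2: "coord_vector ?e t i (tcoord ?e' j) = (if i = j then g' (t d) (t i) else 0)"
      if "i \<in> set r" "j \<in> set r" for i j
    proof (rule coord_vector_eqI)
      have "(g (t d) has_real_derivative
          ((1 - t d) * (1 * t i + - t d) - ((1 - t d) * t i + 0)) / (1 * t i + - t d)\<^sup>2) (at (t i))"
        unfolding g_def using ne[OF that(1)]
        by (auto intro!: derivative_eq_intros simp: power2_eq_square)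
      then have "(g (t d) has_real_derivative g' (t d) (t i)) (at (t i))"
        by (simp add: g'_def algebra_simps)
      moreover have "i \<noteq> d" "j \<noteq> d"
        using that dcr by auto
      ultimately show "((\<lambda>s. tcoord ?e' j (param ?e (t(i := s)))) has_real_derivative
          (if i = j then g' (t d) (t i) else 0)) (at (t i))"
        using that by (cases "i = j") (simp_all only: tc, simp_all)
    qed
    have "enum_jacobian ?e ?e' t =
        tdet (coord_vector ?e t d # map (coord_vector ?e t) r) (tcoord ?e' c # map (tcoord ?e') r)"
      by (simp add: jacobian_of_def)
    also have "\<dots> = coord_vector ?e t d (tcoord ?e' c) * (\<Prod>i\<in>set r. g' (t d) (t i))"
      by (rule tdet_triangular_Cons[OF dcr(3)], rule cv2, assumption+, subst cv1) (use dcr(1) in auto)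
    finally show ?thesis
      unfolding cv1 by simp
  qed
  fix F :: "('a \<Rightarrow> real) \<Rightarrow> ennreal" assume F: "F \<in> borel_measurable (coord_measure ?e')"
  define H where "H t = F t * indicator (chart ?e') t" for t
  define K where "K t = F (tmap ?e' (param ?e t)) * (ennreal \<bar>enum_jacobian ?e ?e' t\<bar> * indicator (chart ?e) t)" for t
  let ?R = "\<Pi>\<^sub>M i\<in>set r. lborel :: real measure"
  have "H \<in> borel_measurable (coord_measure ?e')"
    unfolding H_def
    by (intro borel_measurable_times_ennreal borel_measurable_indicator F chart_measurable[OF e'])
  then have H [measurable]: "H \<in> borel_measurable (\<Pi>\<^sub>M i\<in>insert c (set r). lborel)"
    by simp
  have "K \<in> borel_measurable (coord_measure ?e)"
    unfolding K_def by (intro borel_measurable_times_ennreal abs_jacobian_measurable[OF e regular_list_tcoord[OF e']]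
        measurable_compose[OF tmap_param_measurable[OF e e'] F])
  then have K: "K \<in> borel_measurable (\<Pi>\<^sub>M i\<in>insert d (set r). lborel)"
    by simp
  interpret R: finite_product_sigma_finite "\<lambda>_. lborel :: real measure" "set r"
    by standard simp
  have upd [measurable]: "(\<lambda>(x, t). t(c := x)) \<in> measurable (lborel \<Otimes>\<^sub>M ?R) (\<Pi>\<^sub>M i\<in>insert c (set r). lborel)"
    unfolding case_prod_unfold by (rule measurable_fun_upd[where J = "set r"]) auto
  \<comment> \<open>The coordinate of \<open>c\<close> is integrated last: once it is fixed, the
    remaining substitution acts by one Moebius map in every coordinate.\<close>
  define h where "h x = (\<integral>\<^sup>+ t. H (t(c := x)) \<partial>?R)" for x
  have h: "h \<in> borel_measurable borel"
  proof -
    have "(\<lambda>(x, t). H (t(c := x))) \<in> borel_measurable (lborel \<Otimes>\<^sub>M ?R)"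
      using measurable_compose[OF upd H] by (simp add: case_prod_unfold)
    then have "h \<in> borel_measurable lborel"
      unfolding h_def by (rule R.borel_measurable_nn_integral)
    then show ?thesis
      by simp
  qed
  have "(\<integral>\<^sup>+ t. H t \<partial>coord_measure ?e') = (\<integral>\<^sup>+ x. h x \<partial>lborel)"
    using lborel_product.product_nn_integral_insert_rev[OF _ dcr(2) H] by (simp add: h_def)
  also have "\<dots> = (\<integral>\<^sup>+ x. h (1 - x) \<partial>lborel)"
    using nn_integral_real_affine[OF h, of "-1" 1] by simp
  also have "\<dots> = (\<integral>\<^sup>+ x. (\<integral>\<^sup>+ t. K (t(d := x)) \<partial>?R) \<partial>lborel)"
  proof (rule nn_integral_cong_AE)
    \<comment> \<open>At these two values the determinant of the fibre map vanishes.\<close>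
    have "AE x in lborel. x \<noteq> (0 :: real)" "AE x in lborel. x \<noteq> (1 :: real)"
      by (rule AE_lborel_singleton)+
    then show "AE x in lborel. h (1 - x) = (\<integral>\<^sup>+ t. K (t(d := x)) \<partial>?R)"
    proof eventually_elim
      fix x :: real assume x: "x \<noteq> 0" "x \<noteq> 1"
      have "(\<lambda>t. t(c := 1 - x)) \<in> measurable ?R (\<Pi>\<^sub>M i\<in>insert c (set r). lborel)"
        by (rule measurable_fun_upd[where J = "set r"]) auto
      then have "h (1 - x) = (\<integral>\<^sup>+ t. H ((\<lambda>i\<in>set r. g x (t i))(c := 1 - x)) *
          ennreal \<bar>\<Prod>i\<in>set r. g' x (t i)\<bar> \<partial>?R)"
        unfolding h_def g_def g'_def using x
        by (intro moebius_substitution_PiM measurable_compose[OF _ H]) auto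
      also have "\<dots> = (\<integral>\<^sup>+ t. K (t(d := x)) \<partial>?R)"
      proof (rule nn_integral_cong)
        fix t assume t: "t \<in> space ?R"
        show "H ((\<lambda>i\<in>set r. g x (t i))(c := 1 - x)) * ennreal \<bar>\<Prod>i\<in>set r. g' x (t i)\<bar> = K (t(d := x))"
        proof (cases "t(d := x) \<in> chart ?e")
          case True
          have "tmap ?e' (param ?e (t(d := x))) = (\<lambda>i\<in>set r. g x (t i))(c := 1 - x)"
          proof
            fix i
            have "(t(d := x)) i = t i" if "i \<in> set r"
              using that dcr by auto
            then show "tmap ?e' (param ?e (t(d := x))) i = ((\<lambda>i\<in>set r. g x (t i))(c := 1 - x)) i"
              using dcr tc[of i "t(d := x)"] tc_c[of "t(d := x)"] by (auto simp: tmap_def)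
          qed
          moreover have "(\<Prod>i\<in>set r. g' x (t i)) = (\<Prod>i\<in>set r. g' x ((t(d := x)) i))"
            using dcr by (intro prod.cong) auto
          ultimately show ?thesis
            using True ch[OF t x] jac[OF True] by (simp add: H_def K_def)
        next
          case False
          then show ?thesis
            using ch[OF t x] by (simp add: H_def K_def)
        qed
      qed
      finally show "h (1 - x) = (\<integral>\<^sup>+ t. K (t(d := x)) \<partial>?R)" .
    qed
  qed
  also have "\<dots> = (\<integral>\<^sup>+ t. K t \<partial>coord_measure ?e)"
    using lborel_product.product_nn_integral_insert_rev[OF _ dcr(1) K] by simp
  finally show "(\<integral>\<^sup>+ t. F t * indicator (chart ?e') t \<partial>coord_measure ?e') =
    (\<integral>\<^sup>+ t. F (tmap ?e' (param ?e t)) * (ennreal \<bar>enum_jacobian ?e ?e' t\<bar> * indicator (chart ?e) t) \<partial>coord_measure ?e)"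
    unfolding H_def K_def .
qed

section \<open>The product formula for nonnegative integrands\<close>

lemma change_of_enum_refl:
  assumes "enum_of S e"
  shows "change_of_enum e e"
proof -
  obtain a b c r where "e = [a, b, c] @ r"
    using enum_ofE[OF assms] by metis
  then show ?thesis
    using change_of_enum_rest[of S a b c r r] assms by blast
qed

text \<open>According to its position, an adjacent transposition exchanges 0 with 1, 1 with
  infinity, infinity with the first free point, or two free points.\<close>

lemma change_of_enum_swap:
  assumes e: "enum_of S (xs @ x # y # ys)"
  shows "change_of_enum (xs @ x # y # ys) (xs @ y # x # ys)"
proof -
  consider "xs = []" | a where "xs = [a]" | a b where "xs = [a, b]" | a b c zs where "xs = [a, b, c] @ zs"
    by (metis append_Cons append_Nil neq_Nil_conv)
  then show ?thesis
  proof cases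
    case 1
    then obtain c r where "ys = c # r"
      using e by (cases ys) (auto simp: enum_of_def)
    then show ?thesis
      using 1 e change_of_enum_swap_01[of S x y c r] by simp
  next
    case (2 a)
    then show ?thesis
      using e change_of_enum_swap_12[of S a x y ys] by simp
  next
    case (3 a b)
    then show ?thesis
      using e change_of_enum_swap_23[of S a b x y ys] by simp
  next
    case (4 a b c zs)
    have "enum_of S ([a, b, c] @ (zs @ y # x # ys))"
      using e 4 by (auto simp: enum_of_def)
    then show ?thesis
      using e 4 change_of_enum_rest[of S a b c "zs @ x # y # ys" "zs @ y # x # ys"] by simp
  qed
qed

text \<open>Moving \<open>x\<close> past \<open>ys\<close> takes one adjacent transposition per
  element; the elements already passed join the prefix \<open>zs\<close>.\<close>

lemma change_of_enum_move:
  "enum_of S (zs @ x # ys @ ys') \<Longrightarrow> change_of_enum (zs @ x # ys @ ys') (zs @ ys @ x # ys')"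
proof (induction ys arbitrary: zs)
  case Nil
  then show ?case
    by (simp add: change_of_enum_refl)
next
  case (Cons y ys)
  have 1: "change_of_enum (zs @ x # y # ys @ ys') (zs @ y # x # ys @ ys')"
    using Cons.prems by (intro change_of_enum_swap) simp
  have e: "enum_of S ((zs @ [y]) @ x # ys @ ys')" "enum_of S (zs @ (y # ys) @ x # ys')"
    using Cons.prems by (auto simp: enum_of_def)
  have "change_of_enum (zs @ y # x # ys @ ys') (zs @ (y # ys) @ x # ys')"
    using Cons.IH[OF e(1)] by simp
  with 1 show ?case
    using change_of_enum_trans[of S "zs @ x # y # ys @ ys'" "zs @ y # x # ys @ ys'" "zs @ (y # ys) @ x # ys'"]
      Cons.prems e by simp
qed

text \<open>The tail is first arranged behind \<open>x\<close>, then \<open>x\<close> is moved to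
  its place. The prefix \<open>zs\<close> is carried along because a tail alone does not enumerate
  S.\<close>

lemma change_of_enum_append:
  "mset xs = mset ys \<Longrightarrow> enum_of S (zs @ xs) \<Longrightarrow> change_of_enum (zs @ xs) (zs @ ys)"
proof (induction xs arbitrary: zs ys)
  case Nil
  then show ?case
    by (simp add: change_of_enum_refl)
next
  case (Cons x xs)
  have "x \<in> set ys"
    using Cons.prems(1) by (metis list.set_intros(1) mset_eq_setD)
  then obtain ys1 ys2 where ys: "ys = ys1 @ x # ys2"
    using split_list by metis
  have ms: "mset xs = mset (ys1 @ ys2)"
    using Cons.prems(1) by (simp add: ys)
  have "set xs = set (ys1 @ ys2)" "distinct xs \<longleftrightarrow> distinct (ys1 @ ys2)" "length xs = length (ys1 @ ys2)"
    using ms mset_eq_setD mset_eq_imp_distinct_iff mset_eq_length by blast+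
  then have e: "enum_of S (zs @ x # ys1 @ ys2)" "enum_of S (zs @ ys)"
    using Cons.prems(2) by (auto simp: enum_of_def ys)
  have "change_of_enum (zs @ x # xs) (zs @ x # ys1 @ ys2)"
    using Cons.IH[OF ms, of "zs @ [x]"] Cons.prems(2) by simp
  moreover have "change_of_enum (zs @ x # ys1 @ ys2) (zs @ ys)"
    unfolding ys by (rule change_of_enum_move[OF e(1)])
  ultimately show ?case
    using change_of_enum_trans[OF Cons.prems(2) e] by simp
qed

lemma change_of_enum:
  assumes "enum_of S e" "enum_of S e'"
  shows "change_of_enum e e'"
proof -
  have "mset e = mset e'"
    using assms set_eq_iff_mset_eq_distinct[of e e'] by (auto simp: enum_of_def)
  then show ?thesis
    using change_of_enum_append[of e e' S "[]"] assms by simp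
qed

text \<open>The dimensions add up because the two parts share exactly three points. Distinctness
  allows products over the list to be written as products over \<open>set Ts\<close>.\<close>

lemma nondegenerate_facts:
  assumes "nondegenerate S Ts"
  shows "(\<forall>T\<in>set Ts. T \<subseteq> S \<and> 4 \<le> card T) \<and> 4 \<le> card S \<and> distinct Ts \<and>
    card S - 3 = (\<Sum>T\<leftarrow>Ts. card T - 3)"
  using assms
proof induction
  case (decompose S T1 T2 Ts1 Ts2 Ts)
  have pm: "4 \<le> card T1" "4 \<le> card T2" "card (T1 \<inter> T2) = 3" "S = T1 \<union> T2"
    using decompose(1) by (auto simp: product_map_def)
  then have fin: "finite T1" "finite T2"
    using card_ge_0_finite by force+
  have cardS: "card S = card T1 + card T2 - 3"
    using card_Un_Int[OF fin] pm by simp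
  have set: "set Ts = set Ts1 \<union> set Ts2"
    using decompose.hyps(4) by (metis mset_append mset_eq_setD set_append)
  \<comment> \<open>A common factor would have at least four points among the three common
    ones.\<close>
  have "set Ts1 \<inter> set Ts2 = {}"
  proof (rule ccontr)
    assume "set Ts1 \<inter> set Ts2 \<noteq> {}"
    then obtain T where "T \<in> set Ts1" "T \<in> set Ts2"
      by blast
    then have T: "T \<subseteq> T1 \<inter> T2" "4 \<le> card T"
      using decompose.IH by auto
    then have "card T \<le> 3"
      using card_mono[of "T1 \<inter> T2" T] fin pm by simp
    with T show False
      by simp
  qed
  then have "distinct (Ts1 @ Ts2)"
    using decompose.IH by simp
  then have "distinct Ts"
    using decompose.hyps(4) mset_eq_imp_distinct_iff[of Ts "Ts1 @ Ts2"] by simp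
  moreover have "(\<Sum>T\<leftarrow>Ts. card T - 3) = (\<Sum>T\<leftarrow>Ts1. card T - 3) + (\<Sum>T\<leftarrow>Ts2. card T - 3)"
  proof -
    have "mset (map (\<lambda>T. card T - 3) Ts) = mset (map (\<lambda>T. card T - 3) (Ts1 @ Ts2))"
      using decompose.hyps(4) by simp
    then have "sum_list (map (\<lambda>T. card T - 3) Ts) = sum_list (map (\<lambda>T. card T - 3) (Ts1 @ Ts2))"
      by (metis sum_mset_sum_list)
    then show ?thesis
      by simp
  qed
  ultimately show ?case
    using decompose.IH pm cardS set by auto
qed simp

text \<open>With a common normalising triple the position of a point does not depend on which other
  points are present, so only the coordinates in \<open>r'\<close> matter.\<close>

lemma forget_param_append:
  assumes "T \<subseteq> set ([a, b, c] @ r')" "set r' \<subseteq> set r" "\<And>i. i \<in> set r' \<Longrightarrow> t i = t' i"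
  shows "forget T (param ([a, b, c] @ r) t) = forget T (param ([a, b, c] @ r') t')"
proof -
  have "T \<subseteq> set ([a, b, c] @ r)"
    using assms by auto
  then have "forget T (param ([a, b, c] @ r) t) = orbit T (normal_config ([a, b, c] @ r) t)"
    unfolding param_normal_config by (rule forget_orbit)
  also have "\<dots> = orbit T (normal_config ([a, b, c] @ r') t')"
  proof (rule orbit_cong)
    fix i assume "i \<in> T"
    then show "normal_config ([a, b, c] @ r) t i = normal_config ([a, b, c] @ r') t' i"
      unfolding normal_config_def nth_first_three using assms by auto
  qed
  also have "\<dots> = forget T (param ([a, b, c] @ r') t')"
    unfolding param_normal_config by (rule forget_orbit[OF assms(1), symmetric])
  finally show ?thesis .
qed

section \<open>Products over the factors of a coordinate system\<close>

lemma tdet_cong: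
  assumes "length vs = length vs'"
    and "\<And>i j. i < length vs \<Longrightarrow> j < length vs \<Longrightarrow> (vs ! i) (hs ! j) = (vs' ! i) (hs' ! j)"
  shows "tdet vs hs = tdet vs' hs'"
  unfolding tdet_def assms(1)[symmetric]
  by (rule arg_cong[where f = Determinant.det], rule eq_matI) (use assms in auto)

lemma length_pulled_coords:
  assumes "3 \<le> card T"
  shows "length (pulled_coords T) = card T - 3"
  using length_coords[OF enum_of_some_enum[OF assms]] by (simp add: pulled_coords_def)

lemma regular_fun_pulled_coords:
  assumes "3 \<le> card T" "T \<subseteq> S" "h \<in> set (pulled_coords T)"
  shows "regular_fun S h"
  using assms regular_fun_tcoord[OF enum_of_some_enum[OF assms(1)]]
  by (auto simp: pulled_coords_def intro!: regular_fun_forget)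

lemma regular_list_pulled_coords:
  assumes "nondegenerate S Ts"
  shows "regular_list S (concat (map pulled_coords Ts))"
proof -
  have Ts: "\<And>T. T \<in> set Ts \<Longrightarrow> T \<subseteq> S \<and> 4 \<le> card T" "card S - 3 = (\<Sum>T\<leftarrow>Ts. card T - 3)"
    using nondegenerate_facts[OF assms] by auto
  have eq: "map (length \<circ> pulled_coords) Ts = map (\<lambda>T. card T - 3) Ts"
    using Ts(1) by (intro map_cong) (auto intro!: length_pulled_coords dest: Ts(1))
  have "length (concat (map pulled_coords Ts)) = card S - 3"
    unfolding length_concat map_map eq Ts(2) by (rule refl)
  moreover have "regular_fun S h" if h: "T \<in> set Ts" "h \<in> set (pulled_coords T)" for h T
    using Ts(1)[OF h(1)] h(2) by (intro regular_fun_pulled_coords[of T]) auto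
  ultimately show ?thesis
    by (auto simp: regular_list_def)
qed

abbreviation product_jacobian :: "'a list \<Rightarrow> 'a set list \<Rightarrow> ('a \<Rightarrow> real) \<Rightarrow> real" where
  "product_jacobian e Ts \<equiv> jacobian_of e (concat (map pulled_coords Ts))"

text \<open>The values lie in any commutative monoid so that the same product serves nonnegative and
  signed integrands.\<close>

definition product_fun ::
    "('a set \<Rightarrow> ('a \<Rightarrow> real) \<Rightarrow> 'b :: comm_monoid_mult) \<Rightarrow> 'a set list \<Rightarrow> 'a mpoint \<Rightarrow> 'b" where
  "product_fun F Ts x = (\<Prod>T\<in>set Ts. F T (tmap (some_enum T) (forget T x)))"

abbreviation product_integrand ::
    "('a set \<Rightarrow> ('a \<Rightarrow> real) \<Rightarrow> ennreal) \<Rightarrow> 'a list \<Rightarrow> 'a set list \<Rightarrow> ('a \<Rightarrow> real) \<Rightarrow> ennreal" where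
  "product_integrand F e Ts \<equiv> integrand e (concat (map pulled_coords Ts)) (product_fun F Ts)"

lemmas product_integrand_def = integrand_def product_fun_def

lemma product_integrand_measurable:
  assumes "nondegenerate S Ts" "enum_of S e"
    and F: "\<And>T. T \<in> set Ts \<Longrightarrow> F T \<in> borel_measurable (coord_measure (some_enum T))"
  shows "product_integrand F e Ts \<in> borel_measurable (coord_measure e)"
proof -
  have "(\<lambda>t. F T (tmap (some_enum T) (forget T (param e t)))) \<in> borel_measurable (coord_measure e)"
    if T: "T \<in> set Ts" for T
  proof -
    have "T \<subseteq> S" "3 \<le> card T"
      using nondegenerate_facts[OF assms(1)] T by auto
    then show ?thesis
      by (intro measurable_compose[OF tmap_measurable[OF assms(2) enum_of_some_enum] F[OF T]])
  qed
  then show ?thesis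
    unfolding product_integrand_def[abs_def]
    by (intro borel_measurable_times_ennreal borel_measurable_prod_ennreal
        abs_jacobian_measurable[OF assms(2) regular_list_pulled_coords[OF assms(1)]])
qed

text \<open>The exceptional set lies in a box one of whose sides is a single point.\<close>

lemma AE_PiM_lborel_neq:
  assumes "finite I" "i \<in> I"
  shows "AE t in (\<Pi>\<^sub>M i\<in>I. lborel). t i \<noteq> (c :: real)"
proof (rule AE_I')
  let ?N = "Pi\<^sub>E I (\<lambda>j. if j = i then {c} else UNIV)"
  have "emeasure (\<Pi>\<^sub>M i\<in>I. lborel) ?N = (\<Prod>j\<in>I. emeasure lborel (if j = i then {c} else UNIV))"
    using assms by (intro lborel_product.emeasure_PiM) auto
  also have "\<dots> = 0"
    using assms by (intro prod_zero) auto
  finally show "?N \<in> null_sets (\<Pi>\<^sub>M i\<in>I. lborel)"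
    using assms by (intro null_setsI sets_PiM_I_finite) auto
  show "{t \<in> space (\<Pi>\<^sub>M i\<in>I. lborel). \<not> t i \<noteq> c} \<subseteq> ?N"
    by (auto simp: space_PiM PiE_def)
qed

text \<open>Coordinates pulled back from one half of a product map do not feel the free points of
  the other half; this yields the vanishing blocks of the Jacobian.\<close>

lemma coord_vector_append:
  assumes h: "h \<in> set (concat (map pulled_coords Us))"
    and Us: "\<And>T. T \<in> set Us \<Longrightarrow> T \<subseteq> set ([a, b, c] @ r')"
    and r: "set r' \<subseteq> set r" and t: "\<And>i. i \<in> set r' \<Longrightarrow> t i = x i"
  shows "coord_vector ([a, b, c] @ r) t i h =
    (if i \<in> set r' then coord_vector ([a, b, c] @ r') x i h else 0)"
proof -
  obtain T g where T: "T \<in> set Us" "h = g \<circ> forget T"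
    using h by (auto simp: pulled_coords_def)
  have eq: "h (param ([a, b, c] @ r) u) = h (param ([a, b, c] @ r') y)"
    if "\<And>i. i \<in> set r' \<Longrightarrow> u i = y i" for u y
    using forget_param_append[OF Us[OF T(1)] r that] by (simp add: T(2))
  show ?thesis
  proof (cases "i \<in> set r'")
    case True
    have "h (param ([a, b, c] @ r) (t(i := s))) = h (param ([a, b, c] @ r') (x(i := s)))" for s
      by (rule eq) (simp add: t)
    then show ?thesis
      using True by (simp add: coord_vector_def t)
  next
    case False
    have "h (param ([a, b, c] @ r) (t(i := s))) = h (param ([a, b, c] @ r') x)" for s
      by (rule eq) (use False t in auto)
    then show ?thesis
      using False by (simp add: coord_vector_def)
  qed
qed

text \<open>With a common triple the Jacobian splits into two blocks, and the chart of S is the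
  product of the two charts minus the null set where a free point of one side meets one of the
  other; Tonelli's theorem applies.\<close>

lemma nn_integral_product_integrand_merge:
  assumes nd: "nondegenerate T1 Ts1" "nondegenerate T2 Ts2" "nondegenerate S Ts"
    and Ts: "mset Ts = mset Ts1 + mset Ts2"
    and e: "enum_of T1 ([a, b, c] @ r1)" "enum_of T2 ([a, b, c] @ r2)" "enum_of S ([a, b, c] @ r1 @ r2)"
    and F: "\<And>T. T \<in> set Ts \<Longrightarrow> F T \<in> borel_measurable (coord_measure (some_enum T))"
  shows "(\<integral>\<^sup>+ t. product_integrand F ([a, b, c] @ r1) Ts1 t \<partial>coord_measure ([a, b, c] @ r1)) *
      (\<integral>\<^sup>+ t. product_integrand F ([a, b, c] @ r2) Ts2 t \<partial>coord_measure ([a, b, c] @ r2)) =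
    (\<integral>\<^sup>+ t. product_integrand F ([a, b, c] @ r1 @ r2) Ts t \<partial>coord_measure ([a, b, c] @ r1 @ r2))"
proof -
  let ?e = "[a, b, c] @ r1 @ r2" and ?e1 = "[a, b, c] @ r1" and ?e2 = "[a, b, c] @ r2"
  let ?m = "merge (set r1) (set r2)"
  have coords: "coords ?e = r1 @ r2" "coords ?e1 = r1" "coords ?e2 = r2"
    by simp_all
  have dist: "set r1 \<inter> set r2 = {}" "distinct r1" "distinct r2"
    using e(3) by (auto simp: enum_of_def)
  have set: "set Ts = set Ts1 \<union> set Ts2"
    using Ts by (metis mset_append mset_eq_setD set_append)
  have disj: "set Ts1 \<inter> set Ts2 = {}"
  proof -
    have "distinct Ts"
      using nondegenerate_facts[OF nd(3)] by blast
    then have "distinct (Ts1 @ Ts2)"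
      using Ts mset_eq_imp_distinct_iff[of Ts "Ts1 @ Ts2"] by simp
    then show ?thesis
      by simp
  qed
  have sub: "T \<subseteq> set ?e1" if "T \<in> set Ts1" for T
    using nondegenerate_facts[OF nd(1)] e(1) that unfolding enum_of_def by blast
  have sub': "T \<subseteq> set ?e2" if "T \<in> set Ts2" for T
    using nondegenerate_facts[OF nd(2)] e(2) that unfolding enum_of_def by blast
  have m1: "?m (x, y) i = x i" if "i \<in> set r1" for x y :: "'a \<Rightarrow> real" and i
    using that by (simp add: merge_def)
  have m2: "?m (x, y) i = y i" if "i \<in> set r2" for x y :: "'a \<Rightarrow> real" and i
    using that dist by (auto simp: merge_def)
  let ?h1 = "concat (map pulled_coords Ts1)" and ?h2 = "concat (map pulled_coords Ts2)"
  have len: "length r1 = length ?h1" "length r2 = length ?h2" "length (r1 @ r2) = length (concat (map pulled_coords Ts))"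
    using length_coords[OF e(1)] length_coords[OF e(2)] length_coords[OF e(3)]
      regular_list_pulled_coords[OF nd(1)] regular_list_pulled_coords[OF nd(2)]
      regular_list_pulled_coords[OF nd(3)]
    unfolding coords regular_list_def by simp_all
  \<comment> \<open>Only absolute values are compared, since \<open>Ts\<close> may interleave the
    factors of the two sides.\<close>
  have jac: "\<bar>product_jacobian ?e Ts (?m (x, y))\<bar> = \<bar>product_jacobian ?e1 Ts1 x\<bar> * \<bar>product_jacobian ?e2 Ts2 y\<bar>"
    for x y
  proof -
    let ?t = "?m (x, y)"
    have cv1: "coord_vector ?e ?t i h = coord_vector ?e1 x i h" if "i \<in> set r1" "h \<in> set ?h1" for i h
      by (subst coord_vector_append[OF that(2) sub, where x = x]) (use that(1) in \<open>auto simp: m1\<close>)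
    have cv2: "coord_vector ?e ?t i h = coord_vector ?e2 y i h" if "i \<in> set r2" "h \<in> set ?h2" for i h
      by (subst coord_vector_append[OF that(2) sub', where x = y]) (use that(1) in \<open>auto simp: m2\<close>)
    have cv0: "coord_vector ?e ?t i h = 0" if "i \<in> set r1" "h \<in> set ?h2" for i h
      by (subst coord_vector_append[OF that(2) sub', where x = y]) (use that(1) dist in \<open>auto simp: m2\<close>)
    have "mset (concat (map pulled_coords Ts)) = mset (?h1 @ ?h2)"
      using Ts by (simp add: mset_concat flip: mset_map) (metis (no_types) image_mset_union mset_map sum_mset.union sum_mset_sum_list)
    then have "\<bar>product_jacobian ?e Ts ?t\<bar> =
        \<bar>tdet (map (coord_vector ?e ?t) r1 @ map (coord_vector ?e ?t) r2) (?h1 @ ?h2)\<bar>"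
      unfolding jacobian_of_def coords using len by (subst abs_tdet_mset[of _ "?h1 @ ?h2"]) auto
    also have "\<dots> = \<bar>tdet (map (coord_vector ?e ?t) r1) ?h1 * tdet (map (coord_vector ?e ?t) r2) ?h2\<bar>"
      using len cv0 by (subst tdet_append) auto
    also have "tdet (map (coord_vector ?e ?t) r1) ?h1 = product_jacobian ?e1 Ts1 x"
      unfolding jacobian_of_def coords
    proof (rule tdet_cong)
      fix i j assume "i < length (map (coord_vector ?e ?t) r1)" "j < length (map (coord_vector ?e ?t) r1)"
      then show "(map (coord_vector ?e ?t) r1 ! i) (?h1 ! j) = (map (coord_vector ?e1 x) r1 ! i) (?h1 ! j)"
        using cv1[of "r1 ! i" "?h1 ! j"] nth_mem[of j "?h1"] len(1)
        by (simp del: append.simps set_concat)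
    qed simp
    also have "tdet (map (coord_vector ?e ?t) r2) ?h2 = product_jacobian ?e2 Ts2 y"
      unfolding jacobian_of_def coords
    proof (rule tdet_cong)
      fix i j assume "i < length (map (coord_vector ?e ?t) r2)" "j < length (map (coord_vector ?e ?t) r2)"
      then show "(map (coord_vector ?e ?t) r2 ! i) (?h2 ! j) = (map (coord_vector ?e2 y) r2 ! i) (?h2 ! j)"
        using cv2[of "r2 ! i" "?h2 ! j"] nth_mem[of j "?h2"] len(2)
        by (simp del: append.simps set_concat)
    qed simp
    finally show ?thesis
      by (simp add: abs_mult)
  qed
  have chart: "?m (x, y) \<in> chart ?e \<longleftrightarrow> x \<in> chart ?e1 \<and> y \<in> chart ?e2"
    if x: "x \<in> space (coord_measure ?e1)" and y: "y \<in> space (coord_measure ?e2)"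
      and ne: "\<And>i j. i \<in> set r1 \<Longrightarrow> j \<in> set r2 \<Longrightarrow> y j \<noteq> x i" for x y
  proof -
    have sp: "?m (x, y) \<in> space (coord_measure ?e)"
      using x y by (auto simp: space_PiM PiE_def extensional_def merge_def)
    have "inj_on (?m (x, y)) (set r1) = inj_on x (set r1)" "inj_on (?m (x, y)) (set r2) = inj_on y (set r2)"
      by (intro inj_on_cong m1 m2, assumption)+
    moreover have "set r1 - set r2 = set r1" "set r2 - set r1 = set r2"
      using dist by auto
    moreover have "?m (x, y) ` set r1 \<inter> ?m (x, y) ` set r2 = {}"
      using ne by (force simp: m1 m2)
    ultimately have "inj_on (?m (x, y)) (set r1 \<union> set r2) \<longleftrightarrow> inj_on x (set r1) \<and> inj_on y (set r2)"
      unfolding inj_on_Un by simp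
    moreover have "(\<forall>i\<in>set r1 \<union> set r2. ?m (x, y) i \<noteq> 0 \<and> ?m (x, y) i \<noteq> 1) \<longleftrightarrow>
        (\<forall>i\<in>set r1. x i \<noteq> 0 \<and> x i \<noteq> 1) \<and> (\<forall>i\<in>set r2. y i \<noteq> 0 \<and> y i \<noteq> 1)"
      by (simp add: ball_Un m1 m2)
    ultimately show ?thesis
      using sp x y unfolding chart_iff[OF e(1)] chart_iff[OF e(2)] chart_iff[OF e(3)] coords set_append
      by blast
  qed
  have eq: "product_integrand F ?e Ts (?m (x, y)) = product_integrand F ?e1 Ts1 x * product_integrand F ?e2 Ts2 y"
    if "x \<in> space (coord_measure ?e1)" "y \<in> space (coord_measure ?e2)"
      "\<And>i j. i \<in> set r1 \<Longrightarrow> j \<in> set r2 \<Longrightarrow> y j \<noteq> x i" for x y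
  proof -
    have "(\<Prod>T\<in>set Ts. F T (tmap (some_enum T) (forget T (param ?e (?m (x, y)))))) =
      (\<Prod>T\<in>set Ts1. F T (tmap (some_enum T) (forget T (param ?e (?m (x, y)))))) *
      (\<Prod>T\<in>set Ts2. F T (tmap (some_enum T) (forget T (param ?e (?m (x, y))))))"
      unfolding set using disj by (intro prod.union_disjoint) auto
    also have "(\<Prod>T\<in>set Ts1. F T (tmap (some_enum T) (forget T (param ?e (?m (x, y)))))) =
      (\<Prod>T\<in>set Ts1. F T (tmap (some_enum T) (forget T (param ?e1 x))))"
      by (intro prod.cong refl) (subst forget_param_append[OF sub, where t' = x], simp_all add: m1)
    also have "(\<Prod>T\<in>set Ts2. F T (tmap (some_enum T) (forget T (param ?e (?m (x, y)))))) =
      (\<Prod>T\<in>set Ts2. F T (tmap (some_enum T) (forget T (param ?e2 y))))"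
      by (intro prod.cong refl) (subst forget_param_append[OF sub', where t' = y], simp_all add: m2)
    finally show ?thesis
      using chart[OF that] unfolding product_integrand_def jac
      by (auto simp: indicator_def ennreal_mult mult_ac)
  qed
  have F1: "\<And>T. T \<in> set Ts1 \<Longrightarrow> F T \<in> borel_measurable (coord_measure (some_enum T))"
    and F2: "\<And>T. T \<in> set Ts2 \<Longrightarrow> F T \<in> borel_measurable (coord_measure (some_enum T))"
    using F set by auto
  note meas = product_integrand_measurable[OF nd(1) e(1) F1] product_integrand_measurable[OF nd(2) e(2) F2]
    product_integrand_measurable[OF nd(3) e(3) F]
  have "(\<integral>\<^sup>+ t. product_integrand F ?e Ts t \<partial>coord_measure ?e) =
    (\<integral>\<^sup>+ x. (\<integral>\<^sup>+ y. product_integrand F ?e Ts (?m (x, y)) \<partial>coord_measure ?e2) \<partial>coord_measure ?e1)"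
    using lborel_product.product_nn_integral_fold[of "set r1" "set r2" "product_integrand F ?e Ts"] dist meas(3)
    unfolding coords set_append by simp
  also have "\<dots> = (\<integral>\<^sup>+ x. (\<integral>\<^sup>+ y. product_integrand F ?e1 Ts1 x * product_integrand F ?e2 Ts2 y
      \<partial>coord_measure ?e2) \<partial>coord_measure ?e1)"
  proof (rule nn_integral_cong, rule nn_integral_cong_AE)
    fix x assume x: "x \<in> space (coord_measure ?e1)"
    \<comment> \<open>For fixed \<open>x\<close> only finitely many values are forbidden for each
      coordinate of \<open>y\<close>.\<close>
    have "AE y in coord_measure ?e2. \<forall>j\<in>set r2. \<forall>i\<in>set r1. y j \<noteq> x i"
      unfolding coords by (intro AE_finite_allI AE_PiM_lborel_neq) auto
    then show "AE y in coord_measure ?e2. product_integrand F ?e Ts (?m (x, y)) =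
        product_integrand F ?e1 Ts1 x * product_integrand F ?e2 Ts2 y"
      using AE_space[of "coord_measure ?e2"] by eventually_elim (rule eq[OF x], auto)
  qed
  also have "\<dots> = (\<integral>\<^sup>+ t. product_integrand F ?e1 Ts1 t \<partial>coord_measure ?e1) *
      (\<integral>\<^sup>+ t. product_integrand F ?e2 Ts2 t \<partial>coord_measure ?e2)"
    using meas by (simp add: nn_integral_cmult nn_integral_multc)
  finally show ?thesis ..
qed

text \<open>Induction along the decomposition. The enumeration \<open>e\<close> is arbitrary, so the
  induction hypotheses can be used for enumerations of both parts that begin with their three common
  points.\<close>

lemma nn_integral_product_integrand:
  assumes "nondegenerate S Ts" "enum_of S e"
    and "\<And>T. T \<in> set Ts \<Longrightarrow> F T \<in> borel_measurable (coord_measure (some_enum T))"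
  shows "(\<Prod>T\<in>set Ts. \<integral>\<^sup>+ t. F T t * indicator (chart (some_enum T)) t \<partial>coord_measure (some_enum T)) =
    (\<integral>\<^sup>+ t. product_integrand F e Ts t \<partial>coord_measure e)"
  using assms
proof (induction arbitrary: e)
  case (single S)
  let ?e = "some_enum S"
  have e': "enum_of S ?e"
    using single(1) by (intro enum_of_some_enum) simp
  \<comment> \<open>For a single factor the map is the identity of the moduli space, so the claim is
    the change from \<open>e\<close> to \<open>some_enum S\<close>.\<close>
  have "enum_jacobian e ?e t = product_jacobian e [S] t" for t
    unfolding jacobian_of_def
    using length_coords[OF e'] length_coords[OF single(2)]
    by (intro tdet_cong) (auto simp: pulled_coords_def coord_vector_def forget_param[OF single(2)])
  then have "product_integrand F e [S] t =
      F S (tmap ?e (param e t)) * (ennreal \<bar>enum_jacobian e ?e t\<bar> * indicator (chart e) t)" for t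
    by (simp add: product_integrand_def forget_param[OF single(2)])
  then show ?case
    using change_of_enum[OF single(2) e'] single(3) by (simp add: change_of_enum_def)
next
  case (decompose S T1 T2 Ts1 Ts2 Ts)
  have nd: "nondegenerate S Ts"
    by (rule nondegenerate.decompose[OF decompose.hyps])
  have pm: "4 \<le> card T1" "4 \<le> card T2" "card (T1 \<inter> T2) = 3" "S = T1 \<union> T2"
    using decompose(1) by (auto simp: product_map_def)
  then have fin: "finite T1" "finite T2"
    using card_ge_0_finite by force+
  have "finite (T1 \<inter> T2)" "finite (T1 - T2)" "finite (T2 - T1)"
    using fin by auto
  then obtain r0 r1 r2 where r: "set r0 = T1 \<inter> T2" "distinct r0" "set r1 = T1 - T2" "distinct r1"
    "set r2 = T2 - T1" "distinct r2"
    using finite_distinct_list by metis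
  then have "length r0 = 3"
    using pm(3) distinct_card by metis
  then obtain a b c where r0: "r0 = [a, b, c]"
    by (auto simp: numeral_3_eq_3 length_Suc_conv)
  have e: "enum_of T1 ([a, b, c] @ r1)" "enum_of T2 ([a, b, c] @ r2)" "enum_of S ([a, b, c] @ r1 @ r2)"
    unfolding enum_of_def r0[symmetric] using r pm(4) \<open>length r0 = 3\<close> by auto
  have set: "set Ts = set Ts1 \<union> set Ts2"
    using decompose.hyps(4) by (metis mset_append mset_eq_setD set_append)
  have "distinct (Ts1 @ Ts2)"
    using nondegenerate_facts[OF nd] decompose.hyps(4) mset_eq_imp_distinct_iff[of Ts "Ts1 @ Ts2"] by simp
  then have disj: "set Ts1 \<inter> set Ts2 = {}"
    by simp
  let ?I = "\<lambda>T. \<integral>\<^sup>+ t. F T t * indicator (chart (some_enum T)) t \<partial>coord_measure (some_enum T)"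
  have "(\<Prod>T\<in>set Ts. ?I T) = (\<Prod>T\<in>set Ts1. ?I T) * (\<Prod>T\<in>set Ts2. ?I T)"
    unfolding set using disj by (intro prod.union_disjoint) auto
  also have "\<dots> = (\<integral>\<^sup>+ t. product_integrand F ([a, b, c] @ r1) Ts1 t \<partial>coord_measure ([a, b, c] @ r1)) *
      (\<integral>\<^sup>+ t. product_integrand F ([a, b, c] @ r2) Ts2 t \<partial>coord_measure ([a, b, c] @ r2))"
    using decompose.IH(1)[OF e(1)] decompose.IH(2)[OF e(2)] decompose.prems(2) set by simp
  also have "\<dots> = (\<integral>\<^sup>+ t. product_integrand F ([a, b, c] @ r1 @ r2) Ts t \<partial>coord_measure ([a, b, c] @ r1 @ r2))"
    by (rule nn_integral_product_integrand_merge[OF decompose.hyps(2,3) nd decompose.hyps(4) e decompose.prems(2)])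
  also have "\<dots> = (\<integral>\<^sup>+ t. product_integrand F e Ts t \<partial>coord_measure e)"
    by (rule nn_integral_change_of_enum[OF decompose.prems(1) e(3) change_of_enum[OF decompose.prems(1) e(3)]
          regular_list_pulled_coords[OF nd] product_integrand_measurable[OF nd e(3) decompose.prems(2)]])
  finally show ?case .
qed

section \<open>Dihedral structures and cells\<close>

text \<open>Splittings, unlike rotation numbers, are compatible with \<open>filter\<close>.\<close>

lemma rotate_iff: "(\<exists>k. ys = rotate k xs) \<longleftrightarrow> (\<exists>us vs. xs = us @ vs \<and> ys = vs @ us)"
proof
  assume "\<exists>k. ys = rotate k xs"
  then obtain k where "ys = rotate k xs" ..
  then show "\<exists>us vs. xs = us @ vs \<and> ys = vs @ us"
    by (intro exI[of _ "take (k mod length xs) xs"] exI[of _ "drop (k mod length xs) xs"])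
      (simp add: rotate_drop_take)
next
  assume "\<exists>us vs. xs = us @ vs \<and> ys = vs @ us"
  then obtain us vs where "xs = us @ vs" "ys = vs @ us"
    by blast
  then show "\<exists>k. ys = rotate k xs"
    by (intro exI[of _ "length us"]) (simp add: rotate_append)
qed

lemma in_dihedral_class_iff:
  "ys \<in> dihedral_class xs \<longleftrightarrow>
    (\<exists>us vs. (xs = us @ vs \<or> rev xs = us @ vs) \<and> ys = vs @ us)"
proof -
  have "ys \<in> dihedral_class xs \<longleftrightarrow> (\<exists>k. ys = rotate k xs) \<or> (\<exists>k. ys = rotate k (rev xs))"
    by (auto simp: dihedral_class_def)
  then show ?thesis
    unfolding rotate_iff by blast
qed

lemma self_in_dihedral_class: "xs \<in> dihedral_class xs"
  unfolding in_dihedral_class_iff by (rule exI[of _ "[]"]) auto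

lemma rotate_in_dihedral_class:
  assumes "us @ vs \<in> dihedral_class xs"
  shows "vs @ us \<in> dihedral_class xs"
proof -
  have "\<exists>k. vs @ us = rotate k (us @ vs)"
    unfolding rotate_iff by blast
  with assms show ?thesis
    unfolding dihedral_class_def by (auto simp: rotate_rotate)
qed

lemma rev_in_dihedral_class:
  assumes "ys \<in> dihedral_class xs"
  shows "rev ys \<in> dihedral_class xs"
proof -
  obtain us vs where *: "xs = us @ vs \<or> rev xs = us @ vs" "ys = vs @ us"
    using assms unfolding in_dihedral_class_iff by blast
  then have "rev xs = rev vs @ rev us \<or> xs = rev vs @ rev us"
    by (metis rev_append rev_rev_ident)
  then show ?thesis
    unfolding in_dihedral_class_iff using * by (intro exI[of _ "rev vs"] exI[of _ "rev us"]) auto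
qed

lemma dihedral_class_subset:
  assumes "ys \<in> dihedral_class xs"
  shows "dihedral_class ys \<subseteq> dihedral_class xs"
proof
  fix zs assume "zs \<in> dihedral_class ys"
  then obtain us vs where *: "ys = us @ vs \<or> rev ys = us @ vs" "zs = vs @ us"
    unfolding in_dihedral_class_iff by blast
  then have "us @ vs \<in> dihedral_class xs"
    using assms rev_in_dihedral_class[OF assms] by auto
  then show "zs \<in> dihedral_class xs"
    unfolding * by (rule rotate_in_dihedral_class)
qed

lemma dihedral_class_sym:
  assumes "ys \<in> dihedral_class xs"
  shows "xs \<in> dihedral_class ys"
proof -
  obtain us vs where *: "xs = us @ vs \<or> rev xs = us @ vs" "ys = vs @ us"
    using assms unfolding in_dihedral_class_iff by blast
  have uv: "us @ vs \<in> dihedral_class ys"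
    unfolding *(2) by (rule rotate_in_dihedral_class[OF self_in_dihedral_class])
  from *(1) show ?thesis
  proof
    assume "rev xs = us @ vs"
    then have "xs = rev (us @ vs)"
      by (metis rev_rev_ident)
    then show ?thesis
      using rev_in_dihedral_class[OF uv] by simp
  qed (use uv in simp)
qed

lemma dihedral_class_eqI: "ys \<in> dihedral_class xs \<Longrightarrow> dihedral_class ys = dihedral_class xs"
  by (rule equalityI[OF dihedral_class_subset dihedral_class_subset[OF dihedral_class_sym]])

lemma dihedral_class_map: "dihedral_class (map f xs) = map f ` dihedral_class xs"
proof -
  have "rotate m (map f xs) = map f (rotate m xs)" "rotate m (rev (map f xs)) = map f (rotate m (rev xs))" for m
    by (simp_all add: rotate_map rev_map)
  then show ?thesis
    unfolding dihedral_class_def by auto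
qed

lemma set_dihedral_class: "ys \<in> dihedral_class xs \<Longrightarrow> set ys = set xs"
  by (auto simp: dihedral_class_def)

lemma finite_dihedral_class: "finite (dihedral_class xs)"
proof -
  have "dihedral_class xs \<subseteq> {ys. set ys \<subseteq> set xs \<and> length ys = length xs}"
    by (auto simp: dihedral_class_def)
  then show ?thesis
    by (rule finite_subset) (rule finite_lists_length_eq, simp)
qed

lemma filter_append_split:
  "filter P xs = us @ vs \<Longrightarrow> \<exists>us' vs'. xs = us' @ vs' \<and> filter P us' = us \<and> filter P vs' = vs"
proof (induction us arbitrary: xs)
  case Nil
  then show ?case
    by (intro exI[of _ "[]"] exI[of _ xs]) simp
next
  case (Cons u us)
  then obtain as bs where xs: "xs = as @ u # bs" "\<forall>a\<in>set as. \<not> P a" "P u" "filter P bs = us @ vs"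
    using filter_eq_ConsD[of P xs u "us @ vs"] by auto
  obtain us' vs' where "bs = us' @ vs'" "filter P us' = us" "filter P vs' = vs"
    using Cons.IH[OF xs(4)] by blast
  then show ?case
    using xs by (intro exI[of _ "as @ u # us'"] exI[of _ vs']) simp
qed

text \<open>By \<open>filter_append_split\<close> every cut of the shortened list lifts to a cut of
  the whole list, so filtering a class yields a whole class.\<close>

lemma restrict_dihedral_class:
  "restrict_dihedral (dihedral_class xs) T = dihedral_class (filter (\<lambda>i. i \<in> T) xs)"
proof (intro equalityI subsetI)
  let ?f = "filter (\<lambda>i. i \<in> T)"
  fix ys assume "ys \<in> restrict_dihedral (dihedral_class xs) T"
  then obtain zs where zs: "zs \<in> dihedral_class xs" "ys = ?f zs"
    unfolding restrict_dihedral_def by blast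
  then obtain us vs where "xs = us @ vs \<or> rev xs = us @ vs" "ys = ?f (vs @ us)"
    using zs(1)[unfolded in_dihedral_class_iff] by metis
  then show "ys \<in> dihedral_class (?f xs)"
    unfolding in_dihedral_class_iff
    by (intro exI[of _ "?f us"] exI[of _ "?f vs"]) (auto simp: rev_filter)
next
  let ?f = "filter (\<lambda>i. i \<in> T)"
  fix ys assume "ys \<in> dihedral_class (?f xs)"
  then obtain us vs where *: "?f xs = us @ vs \<or> ?f (rev xs) = us @ vs" "ys = vs @ us"
    unfolding in_dihedral_class_iff rev_filter by blast
  then obtain us' vs' where "xs = us' @ vs' \<or> rev xs = us' @ vs'" "?f us' = us" "?f vs' = vs"
    using filter_append_split by metis
  then have "vs' @ us' \<in> dihedral_class xs" "?f (vs' @ us') = ys"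
    using * unfolding in_dihedral_class_iff by auto
  then show "ys \<in> restrict_dihedral (dihedral_class xs) T"
    unfolding restrict_dihedral_def by blast
qed

text \<open>The points run once around the circle, in either direction and from any starting point;
  linear sortedness alone is not preserved by Moebius maps.\<close>

definition cyclically_sorted :: "proj1 list \<Rightarrow> bool" where
  "cyclically_sorted zs \<longleftrightarrow> (\<exists>ws\<in>dihedral_class zs. sorted_wrt (<) ws)"

lemma sorted_split:
  fixes q :: "'b :: linorder"
  assumes "sorted_wrt (<) zs"
  shows "zs = filter (\<lambda>z. z < q) zs @ filter (\<lambda>z. \<not> z < q) zs"
  using assms
proof (induction zs)
  case (Cons z zs)
  show ?case
  proof (cases "z < q")
    case False
    then have "filter (\<lambda>z. z < q) zs = []" "filter (\<lambda>z. \<not> z < q) zs = zs"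
      using Cons.prems by (auto simp: filter_empty_conv filter_id_conv)
    with False show ?thesis
      by simp
  qed (use Cons in simp)
qed simp

text \<open>\<open>g\<close> is increasing on either side of the cut \<open>q\<close> and puts the
  upper side below the lower one, so the image is sorted after one rotation.\<close>

lemma cyclically_sorted_map_cut:
  fixes g :: "proj1 \<Rightarrow> proj1"
  assumes "\<And>z w. z < w \<Longrightarrow> (w < q \<longleftrightarrow> z < q) \<Longrightarrow> g z < g w"
    and "\<And>z w. z < q \<Longrightarrow> \<not> w < q \<Longrightarrow> g w < g z" and zs: "sorted_wrt (<) zs"
  shows "cyclically_sorted (map g zs)"
proof -
  let ?A = "filter (\<lambda>z. z < q) zs" and ?B = "filter (\<lambda>z. \<not> z < q) zs"
  have eq: "zs = ?A @ ?B"
    by (rule sorted_split[OF zs])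
  have "sorted_wrt (<) ?A" "sorted_wrt (<) ?B"
    using zs by (auto intro: sorted_wrt_filter)
  then have "sorted_wrt (\<lambda>z w. g z < g w) ?A" "sorted_wrt (\<lambda>z w. g z < g w) ?B"
    by (auto elim!: sorted_wrt_mono_rel[rotated] intro!: assms(1))
  then have "sorted_wrt (<) (map g (?B @ ?A))"
    using assms(2) by (auto simp: sorted_wrt_append sorted_wrt_map)
  moreover have "map g (?B @ ?A) \<in> dihedral_class (map g (?A @ ?B))"
    using rotate_in_dihedral_class[OF self_in_dihedral_class, of "map g ?B" "map g ?A"] by simp
  ultimately show ?thesis
    unfolding cyclically_sorted_def using eq by metis
qed

lemma cyclically_sorted_affine:
  assumes "a > 0" "sorted_wrt (<) zs"
  shows "cyclically_sorted (map (moebius a b 0 1) zs)"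
\<comment> \<open>No point lies below \<open>None\<close>, so the cut is vacuous for an increasing
  affine map.\<close>
proof (rule cyclically_sorted_map_cut[OF _ _ assms(2), of None])
  show "moebius a b 0 1 z < moebius a b 0 1 w" if "z < w" for z w
    using that assms(1) by (cases z; cases w) (auto simp: moebius_alt)
qed simp

lemma cyclically_sorted_inversion:
  assumes "sorted_wrt (<) zs"
  shows "cyclically_sorted (map (moebius 0 (- 1) 1 0) zs)"
\<comment> \<open>Below the cut lie infinity and the negative numbers, which go to 0 and the
  positive numbers; 0 goes to infinity and positive numbers become negative.\<close>
proof (rule cyclically_sorted_map_cut[OF _ _ assms, of "Some 0"])
  have inv: "moebius 0 (- 1) 1 0 None = Some 0"
    "moebius 0 (- 1) 1 0 (Some x) = (if x = 0 then None else Some (- 1 / x))" for x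
    by (auto simp: moebius_alt)
  show "moebius 0 (- 1) 1 0 z < moebius 0 (- 1) 1 0 w"
    if "z < w" "w < Some 0 \<longleftrightarrow> z < Some 0" for z w
    using that by (cases z; cases w) (auto simp: inv field_simps divide_less_0_iff zero_less_divide_iff)
  show "moebius 0 (- 1) 1 0 w < moebius 0 (- 1) 1 0 z"
    if "z < Some 0" "\<not> w < Some 0" for z w
    using that by (cases z; cases w) (auto simp: inv field_simps divide_less_0_iff zero_less_divide_iff)
qed

text \<open>Negation reverses the finite points but fixes infinity, which a sorted list has in
  front; after the reversal it stands at the end and one rotation brings it back.\<close>

lemma cyclically_sorted_neg:
  assumes "sorted_wrt (<) zs"
  shows "cyclically_sorted (map (moebius (- 1) 0 0 1) zs)"
proof -
  let ?n = "moebius (- 1) 0 0 1"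
  have n: "?n None = None" "?n (Some x) = Some (- x)" for x
    by (auto simp: moebius_alt)
  have less: "?n w < ?n z" if "z < w" "z \<noteq> None" for z w
    using that by (cases z; cases w) (auto simp: n)
  have rev: "sorted_wrt (<) (map ?n (rev ys))" if "sorted_wrt (<) ys" "None \<notin> set ys" for ys
  proof -
    have "sorted_wrt (\<lambda>z w. ?n w < ?n z) ys"
      by (rule sorted_wrt_mono_rel[OF _ that(1)]) (use that(2) less in metis)
    then show ?thesis
      by (simp add: sorted_wrt_map sorted_wrt_rev)
  qed
  show ?thesis
  proof (cases "None \<in> set zs")
    case False
    then show ?thesis
      unfolding cyclically_sorted_def
      using rev[OF assms False] rev_in_dihedral_class[OF self_in_dihedral_class, of "map ?n zs"]
      by (auto simp: rev_map)
  next
    case True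
    then obtain y ys where y: "zs = y # ys"
      by (cases zs) auto
    have "y = None"
      using True assms y by (cases y) auto
    have ys: "sorted_wrt (<) ys" "None \<notin> set ys"
      using assms y \<open>y = None\<close> by auto
    have "sorted_wrt (<) (None # map ?n (rev ys))"
      using rev[OF ys] ys(2) by (auto simp: n(2) intro!: ) (metis n(2) less_option_None_Some option.exhaust)
    moreover have "map ?n (rev ys) @ [None] \<in> dihedral_class (map ?n zs)"
      using rev_in_dihedral_class[OF self_in_dihedral_class, of "map ?n zs"] y \<open>y = None\<close>
      by (simp add: n rev_map)
    then have "None # map ?n (rev ys) \<in> dihedral_class (map ?n zs)"
      using rotate_in_dihedral_class[of "map ?n (rev ys)" "[None]"] by simp
    ultimately show ?thesis
      unfolding cyclically_sorted_def by blast
  qed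
qed

lemma cyclically_sorted_mapI:
  assumes "cyclically_sorted zs" "\<And>ws. sorted_wrt (<) ws \<Longrightarrow> cyclically_sorted (map f ws)"
  shows "cyclically_sorted (map f zs)"
proof -
  obtain ws where ws: "ws \<in> dihedral_class zs" "sorted_wrt (<) ws"
    using assms(1) unfolding cyclically_sorted_def by blast
  have "dihedral_class (map f ws) = dihedral_class (map f zs)"
    unfolding dihedral_class_map dihedral_class_eqI[OF ws(1)] ..
  then show ?thesis
    using assms(2)[OF ws(2)] unfolding cyclically_sorted_def by simp
qed

lemma moebius_scale: "k \<noteq> 0 \<Longrightarrow> moebius (k * a) (k * b) (k * c) (k * d) z = moebius a b c d z"
  by (cases z) (auto simp: moebius_alt mult.assoc simp flip: distrib_left)

text \<open>Bruhat decomposition: a matrix of positive determinant is a scalar multiple of an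
  increasing affine map, or of a product of two of them with \<open>z \<mapsto> - 1 / z\<close> in between.\<close>

lemma cyclically_sorted_moebius_pos:
  assumes "cyclically_sorted zs" "a * d - b * c > 0"
  shows "cyclically_sorted (map (moebius a b c d) zs)"
proof (cases "c = 0")
  case True
  with assms(2) have "d \<noteq> 0" "a / d > 0"
    by (auto simp: zero_less_mult_iff zero_less_divide_iff)
  then have "moebius a b c d = moebius (a / d) (b / d) 0 1"
    using moebius_scale[of d "a / d" "b / d" 0 1] True by auto
  then show ?thesis
    using cyclically_sorted_mapI[OF assms(1) cyclically_sorted_affine[OF \<open>a / d > 0\<close>]] by simp
next
  case False
  \<comment> \<open>From (a z + b) / (c z + d) = a / c - k / (z + d / c).\<close>
  let ?k = "(a * d - b * c) / c^2"
  have k: "?k > 0" and one: "(1 :: real) > 0"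
    using assms(2) False by simp_all
  have "moebius a b c d z = moebius ?k (a / c) 0 1 (moebius 0 (- 1) 1 0 (moebius 1 (d / c) 0 1 z))" for z
  proof -
    have "moebius ?k (a / c) 0 1 (moebius 0 (- 1) 1 0 (moebius 1 (d / c) 0 1 z)) =
        moebius (a / c) (b / c) 1 (d / c) z"
      using False by (simp add: moebius_compose power2_eq_square field_simps)
    then show ?thesis
      using moebius_scale[of c "a / c" "b / c" 1 "d / c"] False by simp
  qed
  then have "map (moebius a b c d) zs =
      map (moebius ?k (a / c) 0 1) (map (moebius 0 (- 1) 1 0) (map (moebius 1 (d / c) 0 1) zs))"
    by simp
  then show ?thesis
    by (simp only:) (intro cyclically_sorted_mapI[OF cyclically_sorted_mapI[OF cyclically_sorted_mapI[OF assms(1)]]]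
        cyclically_sorted_affine[OF k] cyclically_sorted_affine[OF one] cyclically_sorted_inversion)
qed

text \<open>A matrix of negative determinant is negation after a matrix of positive determinant.
  Reversal of the circle is allowed in a dihedral class, which is why all of PGL_2 preserves the
  cells.\<close>

lemma cyclically_sorted_moebius:
  assumes "cyclically_sorted zs" "a * d - b * c \<noteq> 0"
  shows "cyclically_sorted (map (moebius a b c d) zs)"
proof (cases "a * d - b * c > 0")
  case True
  with assms(1) show ?thesis
    by (rule cyclically_sorted_moebius_pos)
next
  case False
  with assms(2) have det: "(- a) * d - (- b) * c > 0"
    by simp
  then have "moebius a b c d z = moebius (- 1) 0 0 1 (moebius (- a) (- b) c d z)" for z
    by (subst moebius_compose) auto
  then have "map (moebius a b c d) zs = map (moebius (- 1) 0 0 1) (map (moebius (- a) (- b) c d) zs)"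
    by simp
  then show ?thesis
    by (simp only:)
      (rule cyclically_sorted_mapI[OF cyclically_sorted_moebius_pos[OF assms(1) det] cyclically_sorted_neg])
qed

text \<open>\<open>cell\<close> asks for some sorted representative; by invariance of the cyclic
  order every representative is sorted by a suitable labelling in the class.\<close>

lemma orbit_in_cell_iff:
  assumes "dihedral_structure S \<gamma>"
  shows "orbit S p \<in> cell S \<gamma> \<longleftrightarrow> inj_on p S \<and> (\<exists>xs\<in>\<gamma>. sorted_wrt (<) (map p xs))"
proof
  assume "orbit S p \<in> cell S \<gamma>"
  then obtain q xs where q: "orbit S q = orbit S p" "inj_on q S" "xs \<in> \<gamma>" "sorted_wrt (<) (map q xs)"
    unfolding cell_def by auto
  obtain zs where zs: "set zs = S" "\<gamma> = dihedral_class zs"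
    using assms unfolding dihedral_structure_def by blast
  have \<gamma>: "\<gamma> = dihedral_class xs" and xs: "set xs = S"
    using dihedral_class_eqI[of xs zs] set_dihedral_class[of xs zs] q(3) zs by auto
  obtain a b c d where m: "a * d - b * c \<noteq> 0" "\<forall>i\<in>S. p i = moebius a b c d (q i)"
    using orbit_eqD[OF q(1)] by (elim exE conjE)
  have "cyclically_sorted (map q xs)"
    using q(4) self_in_dihedral_class unfolding cyclically_sorted_def by blast
  then have "cyclically_sorted (map (moebius a b c d) (map q xs))"
    by (rule cyclically_sorted_moebius[OF _ m(1)])
  also have "map (moebius a b c d) (map q xs) = map p xs"
    using m(2) xs by simp
  finally have "\<exists>ys\<in>\<gamma>. sorted_wrt (<) (map p ys)"
    unfolding cyclically_sorted_def dihedral_class_map \<gamma> by blast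
  moreover have "inj_on p S"
    using q(1,2) orbit_in_moduli_iff by metis
  ultimately show "inj_on p S \<and> (\<exists>xs\<in>\<gamma>. sorted_wrt (<) (map p xs))"
    by blast
qed (auto simp: cell_def)

text \<open>One representative serves both cells, and the labelling that sorts its distinct values
  is unique; a class is determined by any of its members.\<close>

lemma dihedral_structure_eqI:
  assumes "dihedral_structure S \<gamma>" "dihedral_structure S \<gamma>'" "x \<in> cell S \<gamma>" "x \<in> cell S \<gamma>'"
  shows "\<gamma> = \<gamma>'"
proof -
  obtain p where p: "x = orbit S p"
    using assms(3) unfolding cell_def by blast
  have inj: "inj_on p S"
    using assms(3) orbit_in_cell_iff[OF assms(1)] p by blast
  obtain xs where xs: "xs \<in> \<gamma>" "sorted_wrt (<) (map p xs)"
    using assms(3) orbit_in_cell_iff[OF assms(1)] p by blast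
  obtain ys where ys: "ys \<in> \<gamma>'" "sorted_wrt (<) (map p ys)"
    using assms(4) orbit_in_cell_iff[OF assms(2)] p by blast
  have "\<gamma> = dihedral_class xs \<and> set xs = S" "\<gamma>' = dihedral_class ys \<and> set ys = S"
    using assms(1,2) xs(1) ys(1) dihedral_class_eqI set_dihedral_class
    unfolding dihedral_structure_def by metis+
  moreover from this have "map p xs = map p ys"
    using xs(2) ys(2) by (intro strict_sorted_equal) (auto simp: image_set[symmetric])
  ultimately show ?thesis
    using map_inj_on[of p xs ys] inj by simp
qed

lemma ex_cell:
  assumes "finite S" "x \<in> moduli S"
  shows "\<exists>\<gamma>. dihedral_structure S \<gamma> \<and> x \<in> cell S \<gamma>"
proof -
  obtain p where p: "x = orbit S p" "inj_on p S"
    using assms(2) unfolding moduli_def by blast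
  define zs where "zs = sorted_list_of_set (p ` S)"
  define xs where "xs = map (inv_into S p) zs"
  have zs: "set zs = p ` S" "sorted_wrt (<) zs"
    using assms(1) by (simp_all add: zs_def)
  have "map p xs = zs"
    unfolding xs_def using zs(1) by (auto simp: f_inv_into_f intro!: map_idI)
  moreover have "set xs = S"
    unfolding xs_def using zs(1) p(2) by (auto simp: image_image)
  moreover have "distinct xs"
    using zs(2) \<open>map p xs = zs\<close> strict_sorted_iff distinct_map by metis
  ultimately have "dihedral_structure S (dihedral_class xs)" "x \<in> cell S (dihedral_class xs)"
    using p zs(2) self_in_dihedral_class[of xs] unfolding dihedral_structure_def cell_def by auto
  then show ?thesis
    by blast
qed

lemma dihedral_structure_restrict:
  assumes "dihedral_structure S \<gamma>" "T \<subseteq> S"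
  shows "dihedral_structure T (restrict_dihedral \<gamma> T)"
proof -
  obtain xs where "distinct xs" "set xs = S" "\<gamma> = dihedral_class xs"
    using assms(1) unfolding dihedral_structure_def by blast
  then show ?thesis
    unfolding dihedral_structure_def restrict_dihedral_class using assms(2)
    by (intro exI[of _ "filter (\<lambda>i. i \<in> T) xs"]) (auto simp: restrict_dihedral_class)
qed

lemma forget_in_cell:
  assumes "dihedral_structure S \<gamma>" "T \<subseteq> S" "x \<in> cell S \<gamma>"
  shows "forget T x \<in> cell T (restrict_dihedral \<gamma> T)"
proof -
  obtain p xs where p: "x = orbit S p" "inj_on p S" "xs \<in> \<gamma>" "sorted_wrt (<) (map p xs)"
    using assms(3) unfolding cell_def by blast
  have "filter (\<lambda>i. i \<in> T) xs \<in> restrict_dihedral \<gamma> T"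
    using p(3) unfolding restrict_dihedral_def by blast
  moreover have "sorted_wrt (<) (map p (filter (\<lambda>i. i \<in> T) xs))"
    using p(4) unfolding sorted_wrt_map by (rule sorted_wrt_filter)
  moreover have "inj_on p T"
    using p(2) assms(2) by (rule inj_on_subset)
  ultimately show ?thesis
    unfolding p(1) forget_orbit[OF assms(2)] cell_def by blast
qed

lemma cell_subset_moduli: "cell S \<gamma> \<subseteq> moduli S"
  by (auto simp: cell_def moduli_def)

text \<open>The point lies in some cell of S, and its image in T lies in the cell of the restricted
  structure. Since cells of T are disjoint, that restriction is the prescribed one as soon as the
  image lies in the prescribed cell.\<close>

lemma compatible_cell_iff:
  assumes "finite S" "dihedral_structure S \<delta>" "x \<in> moduli S" "\<And>T. T \<in> set Ts \<Longrightarrow> T \<subseteq> S"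
  shows "(\<exists>\<gamma>\<in>compatible_structures S \<delta> Ts. x \<in> cell S \<gamma>) \<longleftrightarrow>
    (\<forall>T\<in>set Ts. forget T x \<in> cell T (restrict_dihedral \<delta> T))"
proof
  assume "\<exists>\<gamma>\<in>compatible_structures S \<delta> Ts. x \<in> cell S \<gamma>"
  then obtain \<gamma> where \<gamma>: "dihedral_structure S \<gamma>" "x \<in> cell S \<gamma>"
    "\<And>i. i < length Ts \<Longrightarrow> restrict_dihedral \<gamma> (Ts ! i) = restrict_dihedral \<delta> (Ts ! i)"
    unfolding compatible_structures_def by blast
  show "\<forall>T\<in>set Ts. forget T x \<in> cell T (restrict_dihedral \<delta> T)"
  proof
    fix T assume T: "T \<in> set Ts"
    then have "restrict_dihedral \<gamma> T = restrict_dihedral \<delta> T"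
      using \<gamma>(3) by (metis in_set_conv_nth)
    then show "forget T x \<in> cell T (restrict_dihedral \<delta> T)"
      using forget_in_cell[OF \<gamma>(1) assms(4)[OF T] \<gamma>(2)] by simp
  qed
next
  assume *: "\<forall>T\<in>set Ts. forget T x \<in> cell T (restrict_dihedral \<delta> T)"
  obtain \<gamma> where \<gamma>: "dihedral_structure S \<gamma>" "x \<in> cell S \<gamma>"
    using ex_cell[OF assms(1,3)] by blast
  have "restrict_dihedral \<gamma> T = restrict_dihedral \<delta> T" if T: "T \<in> set Ts" for T
    using dihedral_structure_restrict[OF \<gamma>(1) assms(4)[OF T]]
      dihedral_structure_restrict[OF assms(2) assms(4)[OF T]]
      forget_in_cell[OF \<gamma>(1) assms(4)[OF T] \<gamma>(2)] * T
    by (intro dihedral_structure_eqI[of T _ _ "forget T x"]) auto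
  then show "\<exists>\<gamma>\<in>compatible_structures S \<delta> Ts. x \<in> cell S \<gamma>"
    using \<gamma> unfolding compatible_structures_def by auto
qed

lemma finite_compatible_structures:
  assumes "finite S"
  shows "finite (compatible_structures S \<delta> Ts)"
proof -
  have "compatible_structures S \<delta> Ts \<subseteq> dihedral_class ` {xs. set xs \<subseteq> S \<and> distinct xs}"
    by (auto simp: compatible_structures_def dihedral_structure_def)
  moreover have "finite {xs. set xs \<subseteq> S \<and> distinct xs}"
    using finite_subset_distinct[OF assms] .
  ultimately show ?thesis
    by (meson finite_imageI finite_subset)
qed

lemma coord_region_cell_measurable:
  assumes e: "enum_of S e" and \<gamma>: "dihedral_structure S \<gamma>"
  shows "coord_region e (cell S \<gamma>) \<in> sets (coord_measure e)"
proof -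
  have S: "set e = S"
    using e by (simp add: enum_of_def)
  obtain zs where zs: "set zs = S" "\<gamma> = dihedral_class zs"
    using \<gamma> unfolding dihedral_structure_def by blast
  have less: "{t \<in> space (coord_measure e). normal_config e t i < normal_config e t j} \<in> sets (coord_measure e)"
    if ij: "i \<in> S" "j \<in> S" for i j
  proof -
    let ?fin = "\<lambda>k. k = e ! 0 \<or> k = e ! 1 \<or> k \<noteq> e ! 2"
    \<comment> \<open>The order with \<open>None\<close> least is expressed by the sign of the
      bracket, a measurable function of the coordinates, and by which points are finite, which is
      independent of them.\<close>
    have "z < w \<longleftrightarrow> snd (homog w) = 1 \<and> (snd (homog z) = 0 \<or> bracket z w < 0)" for z w
      by (cases z; cases w) auto
    moreover have "snd (homog (normal_config e t k)) = (if ?fin k then 1 else 0)" for t k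
      by (simp add: normal_config_def)
    ultimately have "{t \<in> space (coord_measure e). normal_config e t i < normal_config e t j} =
      (if \<not> ?fin j then {} else if ?fin i then
        {t \<in> space (coord_measure e). bracket (normal_config e t i) (normal_config e t j) < 0}
       else space (coord_measure e))"
      by auto
    moreover have "{t \<in> space (coord_measure e). bracket (normal_config e t i) (normal_config e t j) < 0}
        \<in> sets (coord_measure e)"
      by (intro borel_measurable_less bracket_measurable[OF e ij] borel_measurable_const)
    ultimately show ?thesis
      by (simp only: sets.empty_sets sets.top split: if_split) blast
  qed
  have "coord_region e (cell S \<gamma>) = chart e \<inter> {t \<in> space (coord_measure e).
      \<exists>xs\<in>\<gamma>. \<forall>i\<in>{..<length xs}. \<forall>j\<in>{..<i}. normal_config e t (xs ! j) < normal_config e t (xs ! i)}"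
    unfolding coord_region_def chart_def S param_normal_config orbit_in_cell_iff[OF \<gamma>] orbit_in_moduli_iff
    by (auto simp: sorted_wrt_iff_nth_less)
  also have "\<dots> \<in> sets (coord_measure e)"
  proof (intro sets.Int chart_measurable[OF e] sets.sets_Collect_finite_Ex sets.sets_Collect_finite_All less)
    show "finite \<gamma>"
      by (simp add: zs(2) finite_dihedral_class)
    fix xs i j assume "xs \<in> \<gamma>" "i \<in> {..<length xs}" "j \<in> {..<i}"
    then show "xs ! j \<in> S" "xs ! i \<in> S"
      using set_dihedral_class[of xs zs] zs nth_mem[of i xs] nth_mem[of j xs] by auto
  qed auto
  finally show ?thesis .
qed

section \<open>The integral formula\<close>

definition chart_measure :: "'a list \<Rightarrow> ('a \<Rightarrow> real) measure" where
  "chart_measure e = density (coord_measure e) (indicator (chart e))"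

lemma sigma_finite_chart_measure:
  assumes "enum_of S e"
  shows "sigma_finite_measure (chart_measure e)"
proof -
  interpret finite_product_sigma_finite "\<lambda>_. lborel :: real measure" "set (coords e)"
    by standard simp
  show ?thesis
    unfolding chart_measure_def
  proof (rule sigma_finite_iff_density_finite[THEN iffD2])
    show "indicator (chart e) \<in> borel_measurable (coord_measure e)"
      by (rule borel_measurable_indicator[OF chart_measurable[OF assms]])
    show "AE t in coord_measure e. (indicator (chart e) t :: ennreal) \<noteq> \<infinity>"
      by (auto simp: indicator_def)
  qed
qed

lemma emeasure_chart_measure:
  assumes "enum_of S e" "A \<in> sets (coord_measure e)"
  shows "emeasure (chart_measure e) A = (\<integral>\<^sup>+ t. indicator A t * indicator (chart e) t \<partial>coord_measure e)"
  unfolding chart_measure_def using assms chart_measurable[OF assms(1)]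
  by (subst emeasure_density) (auto intro!: nn_integral_cong simp: indicator_def)

text \<open>The product of measures asks for a sigma-finite measure at every index of the type;
  outside \<open>Ts\<close> a null measure fills in.\<close>

definition chart_product :: "'a set list \<Rightarrow> 'a set \<Rightarrow> ('a \<Rightarrow> real) measure" where
  "chart_product Ts T = (if T \<in> set Ts then chart_measure (some_enum T) else null_measure (count_space UNIV))"

text \<open>The coordinate system itself, read in the charts of the factors.\<close>

definition product_chart :: "'a list \<Rightarrow> 'a set list \<Rightarrow> ('a \<Rightarrow> real) \<Rightarrow> 'a set \<Rightarrow> 'a \<Rightarrow> real" where
  "product_chart e Ts t = (\<lambda>T\<in>set Ts. tmap (some_enum T) (forget T (param e t)))"

lemma nondegenerate_enum:
  assumes "nondegenerate S Ts" "T \<in> set Ts"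
  shows "T \<subseteq> S" "enum_of T (some_enum T)"
  using nondegenerate_facts[OF assms(1)] assms(2) by (auto intro!: enum_of_some_enum)

lemma product_sigma_finite_chart_product:
  assumes "nondegenerate S Ts"
  shows "product_sigma_finite (chart_product Ts)"
proof (rule product_sigma_finite.intro)
  fix T
  show "sigma_finite_measure (chart_product Ts T)"
  proof (cases "T \<in> set Ts")
    case True
    then show ?thesis
      using sigma_finite_chart_measure[OF nondegenerate_enum(2)[OF assms True]]
      by (simp add: chart_product_def)
  next
    case False
    have "finite_measure (null_measure (count_space (UNIV :: ('a \<Rightarrow> real) set)))"
      by standard simp
    then show ?thesis
      using False by (simp add: chart_product_def finite_measure.axioms(1))
  qed
qed

lemma product_chart_measurable:
  assumes nd: "nondegenerate S Ts" and e: "enum_of S e"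
  shows "product_chart e Ts \<in> measurable (coord_measure e) (PiM (set Ts) (chart_product Ts))"
  unfolding product_chart_def[abs_def]
proof (rule measurable_restrict)
  fix T assume T: "T \<in> set Ts"
  have "sets (chart_product Ts T) = sets (coord_measure (some_enum T))"
    using T by (simp add: chart_product_def chart_measure_def)
  then show "(\<lambda>t. tmap (some_enum T) (forget T (param e t))) \<in> measurable (coord_measure e) (chart_product Ts T)"
    using tmap_measurable[OF e nondegenerate_enum(2,1)[OF nd T]] measurable_cong_sets[OF refl] by blast
qed

text \<open>On boxes this is the product formula for indicators. As an identity of measures it also
  transfers integrals of signed functions.\<close>

lemma distr_product_chart:
  assumes nd: "nondegenerate S Ts" and e: "enum_of S e"
  shows "distr (density (coord_measure e) (\<lambda>t. ennreal \<bar>product_jacobian e Ts t\<bar> * indicator (chart e) t))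
      (PiM (set Ts) (chart_product Ts)) (product_chart e Ts) = PiM (set Ts) (chart_product Ts)"
    (is "distr ?D ?P ?\<Phi> = _")
proof (rule product_sigma_finite.PiM_eqI[OF product_sigma_finite_chart_product[OF nd]])
  fix A assume A: "\<And>T. T \<in> set Ts \<Longrightarrow> A T \<in> sets (chart_product Ts T)"
  then have A': "A T \<in> sets (coord_measure (some_enum T))" if "T \<in> set Ts" for T
    using that by (simp add: chart_product_def chart_measure_def)
  note \<Phi> = product_chart_measurable[OF nd e]
  note J = abs_jacobian_measurable[OF e regular_list_pulled_coords[OF nd]]
  have PA: "Pi\<^sub>E (set Ts) A \<in> sets ?P"
    using A by (intro sets_PiM_I_finite) auto
  have pre: "?\<Phi> -` Pi\<^sub>E (set Ts) A \<inter> space (coord_measure e) \<in> sets (coord_measure e)"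
    using measurable_sets[OF \<Phi> PA] .
  have "emeasure (distr ?D ?P ?\<Phi>) (Pi\<^sub>E (set Ts) A) =
    (\<integral>\<^sup>+ t. ennreal \<bar>product_jacobian e Ts t\<bar> * indicator (chart e) t *
      indicator (?\<Phi> -` Pi\<^sub>E (set Ts) A \<inter> space (coord_measure e)) t \<partial>coord_measure e)"
    using \<Phi> PA pre J by (subst emeasure_distr) (simp_all add: emeasure_density)
  also have "\<dots> = (\<integral>\<^sup>+ t. product_integrand (\<lambda>T. indicator (A T)) e Ts t \<partial>coord_measure e)"
  proof (rule nn_integral_cong)
    fix t assume "t \<in> space (coord_measure e)"
    then have "indicator (?\<Phi> -` Pi\<^sub>E (set Ts) A \<inter> space (coord_measure e)) t =
      (\<Prod>T\<in>set Ts. indicator (A T) (tmap (some_enum T) (forget T (param e t))) :: ennreal)"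
      by (cases "\<forall>T\<in>set Ts. tmap (some_enum T) (forget T (param e t)) \<in> A T")
        (auto simp: indicator_def product_chart_def)
    then show "ennreal \<bar>product_jacobian e Ts t\<bar> * indicator (chart e) t *
        indicator (?\<Phi> -` Pi\<^sub>E (set Ts) A \<inter> space (coord_measure e)) t =
        product_integrand (\<lambda>T. indicator (A T)) e Ts t"
      by (simp add: product_integrand_def mult.commute)
  qed
  also have "\<dots> = (\<Prod>T\<in>set Ts. \<integral>\<^sup>+ t. indicator (A T) t * indicator (chart (some_enum T)) t
      \<partial>coord_measure (some_enum T))"
    using A' by (intro nn_integral_product_integrand[OF nd e, symmetric]) auto
  also have "\<dots> = (\<Prod>T\<in>set Ts. emeasure (chart_product Ts T) (A T))"
  proof (intro prod.cong refl)
    fix T assume T: "T \<in> set Ts"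
    then show "(\<integral>\<^sup>+ t. indicator (A T) t * indicator (chart (some_enum T)) t \<partial>coord_measure (some_enum T)) =
        emeasure (chart_product Ts T) (A T)"
      using emeasure_chart_measure[OF nondegenerate_enum(2)[OF nd T] A'[OF T]]
      by (simp add: chart_product_def)
  qed
  finally show "emeasure (distr ?D ?P ?\<Phi>) (Pi\<^sub>E (set Ts) A) = (\<Prod>T\<in>set Ts. emeasure (chart_product Ts T) (A T))" .
qed simp_all

definition real_product_integrand ::
    "('a set \<Rightarrow> ('a \<Rightarrow> real) \<Rightarrow> real) \<Rightarrow> 'a list \<Rightarrow> 'a set list \<Rightarrow> ('a \<Rightarrow> real) \<Rightarrow> real" where
  "real_product_integrand f e Ts t =
     product_fun f Ts (param e t) * (\<bar>product_jacobian e Ts t\<bar> * indicator (chart e) t)"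

text \<open>Integrals of products over a product measure factor; pulling back along
  \<open>product_chart\<close> introduces the absolute Jacobian. Since \<open>f T\<close> vanishes
  off its chart, the density of \<open>chart_measure\<close> does not change its integral.\<close>

lemma integral_real_product_integrand:
  assumes nd: "nondegenerate S Ts" and e: "enum_of S e"
    and f: "\<And>T. T \<in> set Ts \<Longrightarrow> integrable (coord_measure (some_enum T)) (f T)"
    and f0: "\<And>T t. T \<in> set Ts \<Longrightarrow> t \<notin> chart (some_enum T) \<Longrightarrow> f T t = 0"
  shows "integrable (coord_measure e) (real_product_integrand f e Ts)"
    and "(\<integral>t. real_product_integrand f e Ts t \<partial>coord_measure e) =
      (\<Prod>T\<in>set Ts. \<integral>t. f T t \<partial>coord_measure (some_enum T))"
proof -
  interpret product_sigma_finite "chart_product Ts"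
    by (rule product_sigma_finite_chart_product[OF nd])
  let ?J = "\<lambda>t. \<bar>product_jacobian e Ts t\<bar> * indicator (chart e) t"
  have J: "(\<lambda>t. ennreal \<bar>product_jacobian e Ts t\<bar> * indicator (chart e) t) = (\<lambda>t. ennreal (?J t))"
    by (auto simp: indicator_def)
  have "(\<lambda>t. \<bar>product_jacobian e Ts t * indicator (chart e) t\<bar>) \<in> borel_measurable (coord_measure e)"
    using jacobian_measurable[OF e regular_list_pulled_coords[OF nd]] by measurable
  then have Jm: "?J \<in> borel_measurable (coord_measure e)"
    by (simp add: abs_mult)
  let ?P = "PiM (set Ts) (chart_product Ts)"
  let ?D = "density (coord_measure e) (\<lambda>t. ennreal (?J t))"
  let ?\<Phi> = "product_chart e Ts"
  have distr: "distr ?D ?P ?\<Phi> = ?P"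
    using distr_product_chart[OF nd e] unfolding J .
  have \<Phi>: "?\<Phi> \<in> measurable ?D ?P"
    using product_chart_measurable[OF nd e] by simp
  have int: "integrable (chart_product Ts T) (f T)"
    "(\<integral>t. f T t \<partial>chart_product Ts T) = (\<integral>t. f T t \<partial>coord_measure (some_enum T))" if T: "T \<in> set Ts" for T
  proof -
    note eT = nondegenerate_enum(2)[OF nd T]
    have m: "f T \<in> borel_measurable (coord_measure (some_enum T))"
      using f[OF T] by (rule borel_measurable_integrable)
    have i: "(\<lambda>t. indicator (chart (some_enum T)) t *\<^sub>R f T t) = f T"
    proof
      fix t
      show "indicator (chart (some_enum T)) t *\<^sub>R f T t = f T t"
        using f0[OF T, of t] by (cases "t \<in> chart (some_enum T)") auto
    qed
    have d: "chart_product Ts T = density (coord_measure (some_enum T))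
        (\<lambda>t. ennreal (indicator (chart (some_enum T)) t))"
      using T by (simp add: chart_product_def chart_measure_def ennreal_indicator)
    show "integrable (chart_product Ts T) (f T)"
      unfolding d using f[OF T] chart_measurable[OF eT] m
      by (subst integrable_density) (simp_all add: i[simplified])
    show "(\<integral>t. f T t \<partial>chart_product Ts T) = (\<integral>t. f T t \<partial>coord_measure (some_enum T))"
      unfolding d using chart_measurable[OF eT] m
      by (subst integral_density) (simp_all add: i[simplified])
  qed
  let ?f = "\<lambda>s. \<Prod>T\<in>set Ts. f T (s T)"
  have prod: "integrable ?P ?f" "(\<integral>s. ?f s \<partial>?P) = (\<Prod>T\<in>set Ts. \<integral>t. f T t \<partial>chart_product Ts T)"
    using product_integrable_prod[of "set Ts" f] product_integral_prod[of "set Ts" f] int(1) by auto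
  have fm: "?f \<in> borel_measurable ?P"
    using prod(1) by (rule borel_measurable_integrable)
  have eq: "(\<lambda>t. ?J t *\<^sub>R ?f (?\<Phi> t)) = (real_product_integrand f e Ts)"
    by (auto simp: real_product_integrand_def product_fun_def product_chart_def)
  have fm': "(\<lambda>t. ?f (?\<Phi> t)) \<in> borel_measurable (coord_measure e)"
    using measurable_compose[OF product_chart_measurable[OF nd e] fm] .
  have "integrable (distr ?D ?P ?\<Phi>) ?f"
    using prod(1) unfolding distr .
  then have "integrable ?D (\<lambda>t. ?f (?\<Phi> t))"
    by (rule integrable_distr[OF \<Phi>])
  then have "integrable (coord_measure e) (\<lambda>t. ?J t *\<^sub>R ?f (?\<Phi> t))"
    using integrable_density[OF fm' Jm] by auto
  then show "integrable (coord_measure e) (real_product_integrand f e Ts)"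
    unfolding eq .
  have "(\<integral>t. real_product_integrand f e Ts t \<partial>coord_measure e) = (\<integral>t. ?J t *\<^sub>R ?f (?\<Phi> t) \<partial>coord_measure e)"
    unfolding eq ..
  also have "\<dots> = (\<integral>t. ?f (?\<Phi> t) \<partial>?D)"
    using integral_density[OF fm' Jm] by auto
  also have "\<dots> = (\<integral>s. ?f s \<partial>distr ?D ?P ?\<Phi>)"
    by (rule integral_distr[OF \<Phi> fm, symmetric])
  also have "\<dots> = (\<Prod>T\<in>set Ts. \<integral>t. f T t \<partial>coord_measure (some_enum T))"
    unfolding distr prod(2) using int(2) by (intro prod.cong) auto
  finally show "(\<integral>t. real_product_integrand f e Ts t \<partial>coord_measure e) =
      (\<Prod>T\<in>set Ts. \<integral>t. f T t \<partial>coord_measure (some_enum T))" .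
qed

section \<open>Signs, cells and the final sum\<close>

lemma prod_set_nth:
  assumes "distinct xs"
  shows "(\<Prod>x\<in>set xs. g x) = (\<Prod>i<length xs. g (xs ! i))"
  by (rule prod.reindex_bij_betw[symmetric]) (rule bij_betw_nth[OF assms refl refl])

lemma sgn_prod: "sgn (\<Prod>i\<in>A. g i) = (\<Prod>i\<in>A. sgn (g i :: real))"
  by (induction A rule: infinite_finite_induct) (auto simp: sgn_mult)

lemma coefficient_product_pullback:
  assumes nd: "nondegenerate S Ts" and e: "enum_of S e" and t: "t \<in> chart e"
    and \<omega>: "\<And>i. i < length Ts \<Longrightarrow> volume_form (Ts ! i) (\<omega> i)"
  shows "coefficient e (product_pullback Ts \<omega>) t =
    (\<Prod>i<length Ts. coefficient (some_enum (Ts ! i)) (\<omega> i)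
      (tmap (some_enum (Ts ! i)) (forget (Ts ! i) (param e t)))) * product_jacobian e Ts t"
  unfolding coefficient_def[of e] jacobian_of_def
proof (rule product_pullback_eq)
  show "param e t \<in> moduli S"
    by (rule param_in_moduli[OF e t])
  then show "tangent_vector S (param e t) v" if "v \<in> set (map (coord_vector e t) (coords e))" for v
    using that by (auto intro: tangent_coord_vector[OF e])
  show "T \<subseteq> S \<and> 3 \<le> card T" if "T \<in> set Ts" for T
    using nondegenerate_facts[OF nd] that by auto
  show "length (map (coord_vector e t) (coords e)) = (\<Sum>T\<leftarrow>Ts. card T - 3)"
    using nondegenerate_facts[OF nd] length_coords[OF e] by simp
qed (rule \<omega>)

theorem corollary7p10:
  fixes S :: "'a set" and \<delta> :: "'a list set" and Ts :: "'a set list"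
    and \<omega> \<eta> :: "nat \<Rightarrow> 'a form"
  assumes "finite S"
    and "dihedral_structure S \<delta>"
    and "nondegenerate S Ts"
    and "\<And>i. i < length Ts \<Longrightarrow>
      orientation_form (Ts ! i) (cell (Ts ! i) (restrict_dihedral \<delta> (Ts ! i))) (\<eta> i)"
    and "\<And>i. i < length Ts \<Longrightarrow> volume_form (Ts ! i) (\<omega> i)"
    and "\<And>i. i < length Ts \<Longrightarrow>
      converges_abs (Ts ! i) (cell (Ts ! i) (restrict_dihedral \<delta> (Ts ! i))) (\<omega> i)"
  shows "(\<forall>\<gamma>\<in>compatible_structures S \<delta> Ts.
            converges_abs S (cell S \<gamma>) (product_pullback Ts \<omega>)) \<and>
         (\<Prod>i<length Ts. oriented_integral (Ts ! i)
            (cell (Ts ! i) (restrict_dihedral \<delta> (Ts ! i))) (\<eta> i) (\<omega> i)) =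
         (\<Sum>\<gamma>\<in>compatible_structures S \<delta> Ts.
            oriented_integral S (cell S \<gamma>) (product_pullback Ts \<eta>) (product_pullback Ts \<omega>))"
proof -
  note nd = assms(3)
  note facts = nondegenerate_facts[OF nd]
  have \<eta>: "volume_form (Ts ! i) (\<eta> i)" if "i < length Ts" for i
    using assms(4)[OF that] by (simp add: orientation_form_def)
  define e where "e = some_enum S"
  have e: "enum_of S e"
    unfolding e_def using facts by (intro enum_of_some_enum) simp
  \<comment> \<open>Forms are indexed by position, products by the sets of the list; the description
    is well defined because \<open>Ts\<close> is distinct.\<close>
  define idx where "idx T = (THE i. i < length Ts \<and> Ts ! i = T)" for T
  have idx: "idx (Ts ! i) = i" if "i < length Ts" for i
    unfolding idx_def using that facts by (auto simp: nth_eq_iff_index_eq)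
  let ?en = "\<lambda>i. some_enum (Ts ! i)"
  let ?R = "\<lambda>i. coord_region (?en i) (cell (Ts ! i) (restrict_dihedral \<delta> (Ts ! i)))"
  have sub: "Ts ! i \<subseteq> S" and en: "enum_of (Ts ! i) (?en i)" if "i < length Ts" for i
    using nondegenerate_enum[OF nd nth_mem[OF that]] by auto
  have R_chart: "?R i \<subseteq> chart (?en i)" if "i < length Ts" for i
    using cell_subset_moduli[of "Ts ! i"] en[OF that] by (auto simp: coord_region_def chart_def enum_of_def)
  \<comment> \<open>\<open>h\<close> is the integrand without orientation, for convergence on the
    cells of S; \<open>f\<close> includes the sign of the orientation form, for the value of the
    integrals.\<close>
  define h where "h i t = indicator (?R i) t * coefficient (?en i) (\<omega> i) t" for i t
  define f where "f i t = indicator (?R i) t * (sgn (coefficient (?en i) (\<eta> i) t) * coefficient (?en i) (\<omega> i) t)" for i t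
  have h: "integrable (coord_measure (?en i)) (h i)" if "i < length Ts" for i
    using assms(6)[OF that] unfolding converges_abs_def h_def[abs_def] set_integrable_def Let_def by simp
  have f: "integrable (coord_measure (?en i)) (f i)" if i: "i < length Ts" for i
  proof (rule Bochner_Integration.integrable_bound[OF h[OF i]])
    \<comment> \<open>The orientation coefficient is known to be measurable only on the chart, so
      the indicator is placed inside \<open>sgn\<close>; on the cell it equals 1.\<close>
    have "(\<lambda>t. sgn (coefficient (?en i) (\<eta> i) t * indicator (chart (?en i)) t) * h i t)
        \<in> borel_measurable (coord_measure (?en i))"
      using coefficient_measurable[OF \<eta>[OF i] en[OF i]] borel_measurable_integrable[OF h[OF i]]
      by measurable
    also have "(\<lambda>t. sgn (coefficient (?en i) (\<eta> i) t * indicator (chart (?en i)) t) * h i t) = f i"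
      using R_chart[OF i] by (auto simp: h_def f_def indicator_def fun_eq_iff)
    finally show "f i \<in> borel_measurable (coord_measure (?en i))" .
    show "AE t in coord_measure (?en i). norm (f i t) \<le> norm (h i t)"
      by (auto simp: f_def h_def abs_mult sgn_if)
  qed
  let ?\<tau> = "\<lambda>i t. tmap (?en i) (forget (Ts ! i) (param e t))"
  let ?J = "product_jacobian e Ts"
  have integrand: "real_product_integrand (\<lambda>T. g (idx T)) e Ts t =
      (\<Prod>i<length Ts. g i (?\<tau> i t)) * (\<bar>?J t\<bar> * indicator (chart e) t)" for g t
    unfolding real_product_integrand_def product_fun_def using facts by (subst prod_set_nth) (auto simp: idx)
  have int: "integrable (coord_measure e) (real_product_integrand (\<lambda>T. g (idx T)) e Ts)"
    "(\<integral>t. real_product_integrand (\<lambda>T. g (idx T)) e Ts t \<partial>coord_measure e) =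
      (\<Prod>i<length Ts. \<integral>t. g i t \<partial>coord_measure (?en i))"
    if g: "\<And>i. i < length Ts \<Longrightarrow> integrable (coord_measure (?en i)) (g i)"
      "\<And>i t. i < length Ts \<Longrightarrow> t \<notin> ?R i \<Longrightarrow> g i t = 0" for g
  proof -
    have 1: "integrable (coord_measure (some_enum T)) (g (idx T))"
      "t \<notin> chart (some_enum T) \<Longrightarrow> g (idx T) t = 0" if "T \<in> set Ts" for T t
    proof -
      obtain i where i: "i < length Ts" "T = Ts ! i"
        using \<open>T \<in> set Ts\<close> by (auto simp: in_set_conv_nth)
      show "integrable (coord_measure (some_enum T)) (g (idx T))"
        using g(1)[OF i(1)] by (simp add: i idx)
      show "g (idx T) t = 0" if "t \<notin> chart (some_enum T)"
        using g(2)[OF i(1), of t] R_chart[OF i(1)] that by (auto simp: i idx)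
    qed
    show "integrable (coord_measure e) (real_product_integrand (\<lambda>T. g (idx T)) e Ts)"
      by (rule integral_real_product_integrand(1)[OF nd e 1])
    have "(\<integral>t. real_product_integrand (\<lambda>T. g (idx T)) e Ts t \<partial>coord_measure e) =
        (\<Prod>T\<in>set Ts. \<integral>t. g (idx T) t \<partial>coord_measure (some_enum T))"
      by (rule integral_real_product_integrand(2)[OF nd e 1])
    then show "(\<integral>t. real_product_integrand (\<lambda>T. g (idx T)) e Ts t \<partial>coord_measure e) =
      (\<Prod>i<length Ts. \<integral>t. g i t \<partial>coord_measure (?en i))"
      using facts by (simp add: prod_set_nth idx)
  qed
  let ?H = "real_product_integrand (\<lambda>T. h (idx T)) e Ts"
    and ?F = "real_product_integrand (\<lambda>T. f (idx T)) e Ts"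
  have intH: "integrable (coord_measure e) ?H"
    by (rule int(1)) (simp_all add: h, simp add: h_def)
  have intF: "integrable (coord_measure e) ?F"
    "(\<integral>t. ?F t \<partial>coord_measure e) = (\<Prod>i<length Ts. \<integral>t. f i t \<partial>coord_measure (?en i))"
    by ((rule int, simp add: f, simp add: f_def)+)
  let ?C = "compatible_structures S \<delta> Ts"
  let ?X = "\<lambda>\<gamma>. coord_region e (cell S \<gamma>)"
  have X_chart: "?X \<gamma> \<subseteq> chart e" for \<gamma>
    using cell_subset_moduli[of S \<gamma>] e by (auto simp: coord_region_def chart_def enum_of_def)
  have X_meas: "?X \<gamma> \<in> sets (coord_measure e)" if "\<gamma> \<in> ?C" for \<gamma>
    using that by (intro coord_region_cell_measurable[OF e]) (simp add: compatible_structures_def)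
  \<comment> \<open>In coordinates, the union of the compatible cells is the preimage of the product
    of the cells of the factors.\<close>
  have ex: "(\<exists>\<gamma>\<in>?C. t \<in> ?X \<gamma>) \<longleftrightarrow> (\<forall>i<length Ts. ?\<tau> i t \<in> ?R i)" if t: "t \<in> chart e" for t
  proof -
    note x = param_in_moduli[OF e t]
    have "?\<tau> i t \<in> ?R i \<longleftrightarrow> forget (Ts ! i) (param e t) \<in> cell (Ts ! i) (restrict_dihedral \<delta> (Ts ! i))"
      if "i < length Ts" for i
      using tmap_in_space[of "?en i"] param_tmap[OF en[OF that] forget_moduli[OF sub[OF that] x]]
      by (simp add: coord_region_def)
    moreover have "(\<exists>\<gamma>\<in>?C. param e t \<in> cell S \<gamma>) \<longleftrightarrow>
        (\<forall>T\<in>set Ts. forget T (param e t) \<in> cell T (restrict_dihedral \<delta> T))"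
      using facts by (intro compatible_cell_iff[OF assms(1,2) x]) auto
    ultimately show ?thesis
      using chart_in_space[OF t] by (simp add: coord_region_def all_set_conv_all_nth)
  qed
  have coef: "coefficient e (product_pullback Ts \<zeta>) t =
      (\<Prod>i<length Ts. coefficient (?en i) (\<zeta> i) (?\<tau> i t)) * ?J t"
    if "t \<in> chart e" "\<And>i. i < length Ts \<Longrightarrow> volume_form (Ts ! i) (\<zeta> i)" for \<zeta> t
    by (rule coefficient_product_pullback[OF nd e that])
  have in_X: "?\<tau> i t \<in> ?R i" "t \<in> chart e" if "\<gamma> \<in> ?C" "t \<in> ?X \<gamma>" "i < length Ts" for \<gamma> t i
    using ex[of t] X_chart[of \<gamma>] that by auto
  have in_X': "t \<in> chart e" if "t \<in> ?X \<gamma>" for \<gamma> t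
    using X_chart that by auto
  \<comment> \<open>The coefficient carries J, the function \<open>?H\<close> carries |J|; the sign
    that separates them is bounded by 1, so convergence is inherited from \<open>?H\<close>.\<close>
  have eqH: "indicator (?X \<gamma>) t *\<^sub>R coefficient e (product_pullback Ts \<omega>) t =
      indicator (?X \<gamma>) t * (sgn (?J t * indicator (chart e) t) * ?H t)" if \<gamma>: "\<gamma> \<in> ?C" for \<gamma> t
  proof (cases "t \<in> ?X \<gamma>")
    case True
    have "?H t = (\<Prod>i<length Ts. coefficient (?en i) (\<omega> i) (?\<tau> i t)) * \<bar>?J t\<bar>"
      unfolding integrand using in_X[OF \<gamma> True] in_X'[OF True] by (simp add: h_def)
    then show ?thesis
      using True in_X'[OF True] coef[OF in_X'[OF True] assms(5)] by (simp add: abs_mult_sgn mult_ac)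
  qed simp
  \<comment> \<open>The coefficient of the pulled-back orientation is the product of those of the
    factors times the same J, so its sign supplies sgn J and turns J into |J|.\<close>
  have eqF: "indicator (?X \<gamma>) t *\<^sub>R (sgn (coefficient e (product_pullback Ts \<eta>) t) *
      coefficient e (product_pullback Ts \<omega>) t) = indicator (?X \<gamma>) t * ?F t" if \<gamma>: "\<gamma> \<in> ?C" for \<gamma> t
  proof (cases "t \<in> ?X \<gamma>")
    case True
    have "?F t = (\<Prod>i<length Ts. sgn (coefficient (?en i) (\<eta> i) (?\<tau> i t)) *
        coefficient (?en i) (\<omega> i) (?\<tau> i t)) * \<bar>?J t\<bar>"
      unfolding integrand using in_X[OF \<gamma> True] in_X'[OF True] by (simp add: f_def)
    also have "\<dots> = sgn (\<Prod>i<length Ts. coefficient (?en i) (\<eta> i) (?\<tau> i t)) *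
        (\<Prod>i<length Ts. coefficient (?en i) (\<omega> i) (?\<tau> i t)) * (sgn (?J t) * ?J t)"
      by (simp add: prod.distrib sgn_prod abs_sgn mult.commute)
    also have "\<dots> = sgn (coefficient e (product_pullback Ts \<eta>) t) * coefficient e (product_pullback Ts \<omega>) t"
      using coef[OF in_X'[OF True] \<eta>] coef[OF in_X'[OF True] assms(5)] by (simp add: sgn_mult mult_ac)
    finally show ?thesis
      by simp
  qed simp
  have "converges_abs S (cell S \<gamma>) (product_pullback Ts \<omega>)" if \<gamma>: "\<gamma> \<in> ?C" for \<gamma>
  proof -
    have Jm: "(\<lambda>t. ?J t * indicator (chart e) t) \<in> borel_measurable (coord_measure e)"
      by (rule jacobian_measurable[OF e regular_list_pulled_coords[OF nd]])
    note [measurable] = X_meas[OF \<gamma>] Jm borel_measurable_integrable[OF intH]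
    have "integrable (coord_measure e) (\<lambda>t. indicator (?X \<gamma>) t * (sgn (?J t * indicator (chart e) t) * ?H t))"
    proof (rule Bochner_Integration.integrable_bound[OF intH])
      show "(\<lambda>t. indicator (?X \<gamma>) t * (sgn (?J t * indicator (chart e) t) * ?H t))
          \<in> borel_measurable (coord_measure e)"
        by measurable
      show "AE t in coord_measure e.
          norm (indicator (?X \<gamma>) t * (sgn (?J t * indicator (chart e) t) * ?H t)) \<le> norm (?H t)"
        by (auto simp: abs_mult indicator_def sgn_if)
    qed
    then show ?thesis
      unfolding converges_abs_def set_integrable_def Let_def e_def[symmetric] eqH[OF \<gamma>] .
  qed
  moreover have "(\<Prod>i<length Ts. oriented_integral (Ts ! i)
      (cell (Ts ! i) (restrict_dihedral \<delta> (Ts ! i))) (\<eta> i) (\<omega> i)) =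
    (\<Sum>\<gamma>\<in>?C. oriented_integral S (cell S \<gamma>) (product_pullback Ts \<eta>) (product_pullback Ts \<omega>))"
  proof -
    \<comment> \<open>At most one compatible cell contains \<open>t\<close>; if none does, some
      factor \<open>f i\<close> vanishes there or \<open>t\<close> lies off the chart, so
      \<open>?F t\<close> is 0 as well.\<close>
    have split: "?F t = (\<Sum>\<gamma>\<in>?C. indicator (?X \<gamma>) t * ?F t)" for t
    proof (cases "t \<in> chart e \<and> (\<exists>\<gamma>\<in>?C. t \<in> ?X \<gamma>)")
      case True
      then obtain \<gamma> where \<gamma>: "\<gamma> \<in> ?C" "t \<in> ?X \<gamma>"
        by blast
      have "indicator (?X \<gamma>') t = (if \<gamma>' = \<gamma> then 1 else 0 :: real)" if "\<gamma>' \<in> ?C" for \<gamma>'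
      proof -
        have uniq: "\<gamma>' = \<gamma>" if "t \<in> ?X \<gamma>'"
          using that \<gamma> \<open>\<gamma>' \<in> ?C\<close> unfolding coord_region_def compatible_structures_def
          by (intro dihedral_structure_eqI[of S _ _ "param e t"]) auto
        show ?thesis
        proof (cases "\<gamma>' = \<gamma>")
          case True
          show ?thesis
            unfolding True using \<gamma>(2) by simp
        next
          case False
          then have "t \<notin> ?X \<gamma>'"
            using uniq by blast
          then show ?thesis
            using False by simp
        qed
      qed
      then have "(\<Sum>\<gamma>'\<in>?C. indicator (?X \<gamma>') t * ?F t) = (\<Sum>\<gamma>'\<in>?C. if \<gamma>' = \<gamma> then ?F t else 0)"
        by (intro sum.cong) auto
      then show ?thesis
        using \<gamma>(1) finite_compatible_structures[OF assms(1)] by simp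
    next
      case False
      have "?F t = 0"
      proof (cases "t \<in> chart e")
        case True
        then obtain i where i: "i < length Ts" "?\<tau> i t \<notin> ?R i"
          using False ex by blast
        then have "f i (?\<tau> i t) = 0"
          by (simp add: f_def)
        then have "(\<Prod>i<length Ts. f i (?\<tau> i t)) = 0"
          using i(1) by (intro prod_zero) auto
        then show ?thesis
          by (simp add: integrand)
      qed (simp add: integrand)
      then show ?thesis
        by simp
    qed
    have intX: "integrable (coord_measure e) (\<lambda>t. indicator (?X \<gamma>) t * ?F t)" if "\<gamma> \<in> ?C" for \<gamma>
      using integrable_mult_indicator[OF X_meas[OF that] intF(1)] by simp
    have "(\<Prod>i<length Ts. oriented_integral (Ts ! i)
        (cell (Ts ! i) (restrict_dihedral \<delta> (Ts ! i))) (\<eta> i) (\<omega> i)) =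
      (\<Prod>i<length Ts. \<integral>t. f i t \<partial>coord_measure (?en i))"
      by (simp add: oriented_integral_def set_lebesgue_integral_def Let_def f_def)
    also have "\<dots> = (\<integral>t. ?F t \<partial>coord_measure e)"
      by (rule intF(2)[symmetric])
    also have "\<dots> = (\<integral>t. (\<Sum>\<gamma>\<in>?C. indicator (?X \<gamma>) t * ?F t) \<partial>coord_measure e)"
      by (rule Bochner_Integration.integral_cong[OF refl split])
    also have "\<dots> = (\<Sum>\<gamma>\<in>?C. \<integral>t. indicator (?X \<gamma>) t * ?F t \<partial>coord_measure e)"
      by (rule Bochner_Integration.integral_sum) (rule intX)
    also have "\<dots> = (\<Sum>\<gamma>\<in>?C. oriented_integral S (cell S \<gamma>) (product_pullback Ts \<eta>) (product_pullback Ts \<omega>))"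
      unfolding oriented_integral_def set_lebesgue_integral_def Let_def e_def[symmetric]
      by (intro sum.cong refl) (simp only: eqF)
    finally show ?thesis .
  qed
  ultimately show ?thesis
    by blast
qed

end
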